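(* Let $(X^+,T)$ be a transitive locally compact one-sided topological Markov shift over a countably infinite set of states $S$, let $\lambda>0$, and let $\phi:X^+\to\mathbb{R}$ be a $\lambda$-transient potential function with summable variations. Let $\mu\in\mathrm{Conf}(\lambda)$ and assume that $\mu$ is extremal. Then there exists $\omega\in\mathcal{M}(\lambda)$ such that $\mu\propto\mu_\omega$.
   Context: Let $S$ be a countably infinite set and $\mathbb{A}\in\{0,1\}^{S\times S}$. The one-sided topological Markov shift (TMS) is $X^+=\{x\in S^{\mathbb{N}\cup\{0\}}:\mathbb{A}_{(x)_i,(x)_{i+1}}=1\ \forall i\ge 0\}$ with the shift $(Tx)_i=(x)_{i+1}$ and metric $d(x,y)=2^{-\inf\{i\ge0:(x)_i\ne(y)_i\}}$. Cylinders: $[a_0,\dots,a_m]=\{x\in X^+:(x)_i=a_i,\ 0\le i\le m\}$; a finite word is admissible if its cylinder is nonempty. Transitive: for all $a,b\in S$ there is $n\ge1$ with $T^{-n}[a]\cap[b]\neq\varnothing$. Locally compact: $\sum_b\mathbb{A}_{a,b}<\infty$ for every $a\in S$ (then cylinders are compact). $C_c(X^+)$ is the space of real continuous compactly supported functions and $C_c^+(X^+)$ its non-negative members. For $\phi:X^+\to\mathbb{R}$ let $Var_m(\phi)=\sup\{|\phi(x)-\phi(y)|:(x)_i=(y)_i,\ 0\le i\le m-1\}$; $\phi$ has summable variations if $\sum_{m\ge2}Var_m(\phi)<\infty$. Ruelle operator: $(L_\phi f)(x)=\sum_{y:Ty=x}e^{\phi(y)}f(y)$. Green's function: $G(f,x|\lambda)=\sum_{n\ge0}\lambda^{-n}(L_\phi^nf)(x)$.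 $\phi$ is $\lambda$-transient if $G(f,x|\lambda)<\infty$ for every (equivalently, some) $f\in C_c^+(X^+)\setminus\{0\}$ and $x\in X^+$. $\mathrm{Conf}(\lambda)$ is the set of positive Radon measures $\mu$ on $X^+$ with $L_\phi^*\mu=\lambda\mu$, i.e. $\int L_\phi 1_K\,d\mu=\lambda\mu(K)$ for every compact $K\subseteq X^+$. We write $\mu_1\propto\mu_2$ if $\mu_1=c\mu_2$ for some $c\in\mathbb{R}$. A measure $\mu\in\mathrm{Conf}(\lambda)$ is extremal if whenever $\mu=\mu_1+\mu_2$ with $\mu_1,\mu_2\in\mathrm{Conf}(\lambda)$, we have $\mu_i\propto\mu$ for $i=1,2$. Martin boundary: fix an origin state $o\in S$ and set $K(f,x|\lambda)=G(f,x|\lambda)/G(1_{[o]},x|\lambda)$ for $f\in C_c(X^+)$, $x\in X^+$. Let $\{w_i\}_{i\ge1}$ enumerate all admissible finite words and let $C_{i}>0$ be constants with $K(1_{[w_i]},x|\lambda)\le C_{i}$ for all $x\in X^+$ (such constants exist). Define the metric $$\rho(x,y)=\sum_{i\ge1}\frac{|K(1_{[w_i]},x|\lambda)-K(1_{[w_i]},y|\lambda)|+|1_{[w_i]}(x)-1_{[w_i]}(y)|}{2^i(C_i+1)}.$$ $\widehat{X^+}(\lambda)$ is the completion of $X^+$ with respect to $\rho$, and $\mathcal{M}(\lambda)=\widehat{X^+}(\lambda)\setminus X^+$. For each $f\in C_c(X^+)$, $K(f,\cdot|\lambda)$ extends uniquely to a $\rho$-continuous function on $\widehat{X^+}(\lambda)$,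 denoted by the same symbol. For $\omega\in\mathcal{M}(\lambda)$, $\mu_\omega$ is the Radon measure $\mu_\omega(f)=K(f,\omega|\lambda)$. *)

theory Defs
  imports "HOL-Analysis.Analysis"
begin

section \<open>One-sided topological Markov shifts\<close>

text \<open>
  The state space is the type \<open>'s\<close>, and the 0-1 matrix is a relation \<open>A\<close> on it.
\<close>

definition tms :: "('s \<Rightarrow> 's \<Rightarrow> bool) \<Rightarrow> (nat \<Rightarrow> 's) set" where
  "tms A = {x. \<forall>i. A (x i) (x (Suc i))}"

definition shift :: "(nat \<Rightarrow> 's) \<Rightarrow> (nat \<Rightarrow> 's)" where
  "shift x = (\<lambda>i. x (Suc i))"

definition tms_dist :: "(nat \<Rightarrow> 's) \<Rightarrow> (nat \<Rightarrow> 's) \<Rightarrow> real" where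
  "tms_dist x y = (if x = y then 0 else (1/2) ^ (LEAST i. x i \<noteq> y i))"

lemma Metric_space_tms: "Metric_space (tms A) tms_dist"
proof
  fix x y z :: "nat \<Rightarrow> 's"
  show "0 \<le> tms_dist x y" by (simp add: tms_dist_def)
  show "tms_dist x y = tms_dist y x"
    by (auto simp: tms_dist_def eq_commute[of "x _"])
  show "tms_dist x y = 0 \<longleftrightarrow> x = y" by (simp add: tms_dist_def)
  show "tms_dist x z \<le> tms_dist x y + tms_dist y z"
  proof (cases "x = y \<or> y = z \<or> x = z")
    case True
    then show ?thesis by (auto simp: tms_dist_def)
  next
    case False
    then obtain k where "x k \<noteq> z k" by blast
    define i where "i = (LEAST i. x i \<noteq> z i)"
    have i: "x i \<noteq> z i" unfolding i_def using \<open>x k \<noteq> z k\<close> by (rule LeastI)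
    have "x i \<noteq> y i \<or> y i \<noteq> z i" using i by auto
    then have "(LEAST i. x i \<noteq> y i) \<le> i \<or> (LEAST i. y i \<noteq> z i) \<le> i"
      by (auto intro: Least_le)
    then have "(1/2::real) ^ i \<le> (1/2) ^ (LEAST i. x i \<noteq> y i) \<or>
        (1/2::real) ^ i \<le> (1/2) ^ (LEAST i. y i \<noteq> z i)"
      by (auto intro: power_decreasing)
    then have "(1/2::real) ^ i
        \<le> (1/2) ^ (LEAST i. x i \<noteq> y i) + (1/2) ^ (LEAST i. y i \<noteq> z i)"
      by (auto intro: add_increasing add_increasing2)
    then show ?thesis using False by (auto simp: tms_dist_def i_def)
  qed
qed

definition tms_top :: "('s \<Rightarrow> 's \<Rightarrow> bool) \<Rightarrow> (nat \<Rightarrow> 's) topology" where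
  "tms_top A = Metric_space.mtopology (tms A) tms_dist"

definition cyl :: "('s \<Rightarrow> 's \<Rightarrow> bool) \<Rightarrow> 's list \<Rightarrow> (nat \<Rightarrow> 's) set" where
  "cyl A w = {x \<in> tms A. \<forall>i<length w. x i = w ! i}"

definition admissible_words :: "('s \<Rightarrow> 's \<Rightarrow> bool) \<Rightarrow> 's list set" where
  "admissible_words A = {w. w \<noteq> [] \<and> cyl A w \<noteq> {}}"

definition transitive_tms :: "('s \<Rightarrow> 's \<Rightarrow> bool) \<Rightarrow> bool" where
  "transitive_tms A \<longleftrightarrow>
     (\<forall>a b. \<exists>n\<ge>1. (shift ^^ n) -` cyl A [a] \<inter> cyl A [b] \<noteq> {})"

definition locally_compact_tms :: "('s \<Rightarrow> 's \<Rightarrow> bool) \<Rightarrow> bool" where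
  "locally_compact_tms A \<longleftrightarrow> (\<forall>a. finite {b. A a b})"

text \<open>
  Functions on the shift space are total functions on \<open>nat \<Rightarrow> 's\<close>; only their
  values on \<open>tms A\<close> matter.
\<close>

definition Cc :: "('s \<Rightarrow> 's \<Rightarrow> bool) \<Rightarrow> ((nat \<Rightarrow> 's) \<Rightarrow> real) set" where
  "Cc A = {f. continuous_map (tms_top A) euclideanreal f \<and>
              compactin (tms_top A) (tms_top A closure_of {x \<in> tms A. f x \<noteq> 0})}"

definition Cc_nonneg :: "('s \<Rightarrow> 's \<Rightarrow> bool) \<Rightarrow> ((nat \<Rightarrow> 's) \<Rightarrow> real) set" where
  "Cc_nonneg A = {f \<in> Cc A. \<forall>x\<in>tms A. 0 \<le> f x}"


section \<open>Potentials, Ruelle operator and Green's function\<close>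

text \<open>The variations are extended reals: \<open>Var\<^sub>1\<close> may be infinite.\<close>

definition Var :: "('s \<Rightarrow> 's \<Rightarrow> bool) \<Rightarrow> ((nat \<Rightarrow> 's) \<Rightarrow> real) \<Rightarrow> nat \<Rightarrow> ennreal" where
  "Var A \<phi> m =
     Sup {ennreal \<bar>\<phi> x - \<phi> y\<bar> | x y. x \<in> tms A \<and> y \<in> tms A \<and> (\<forall>i<m. x i = y i)}"

definition summable_variations ::
    "('s \<Rightarrow> 's \<Rightarrow> bool) \<Rightarrow> ((nat \<Rightarrow> 's) \<Rightarrow> real) \<Rightarrow> bool" where
  "summable_variations A \<phi> \<longleftrightarrow> (\<Sum>m. Var A \<phi> (m + 2)) < \<infinity>"

text \<open>
  A point may have infinitely many preimages, but a function with relatively compact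
  support is nonzero at only finitely many of them, so on the functions that occur below
  the infinite sum is a finite one.
\<close>

definition ruelle ::
    "('s \<Rightarrow> 's \<Rightarrow> bool) \<Rightarrow> ((nat \<Rightarrow> 's) \<Rightarrow> real) \<Rightarrow>
     ((nat \<Rightarrow> 's) \<Rightarrow> real) \<Rightarrow> (nat \<Rightarrow> 's) \<Rightarrow> real" where
  "ruelle A \<phi> f x = (\<Sum>\<^sub>\<infinity>y\<in>{y \<in> tms A. shift y = x}. exp (\<phi> y) * f y)"

definition green ::
    "('s \<Rightarrow> 's \<Rightarrow> bool) \<Rightarrow> ((nat \<Rightarrow> 's) \<Rightarrow> real) \<Rightarrow> real \<Rightarrow>
     ((nat \<Rightarrow> 's) \<Rightarrow> real) \<Rightarrow> (nat \<Rightarrow> 's) \<Rightarrow> real" where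
  "green A \<phi> lam f x = (\<Sum>n. (ruelle A \<phi> ^^ n) f x / lam ^ n)"

text \<open>
  For \<open>f \<ge> 0\<close> the terms of Green's function are nonnegative, so finiteness of the
  sum is summability.
\<close>

definition transient_potential ::
    "('s \<Rightarrow> 's \<Rightarrow> bool) \<Rightarrow> ((nat \<Rightarrow> 's) \<Rightarrow> real) \<Rightarrow> real \<Rightarrow> bool" where
  "transient_potential A \<phi> lam \<longleftrightarrow>
     (\<forall>f\<in>Cc_nonneg A. (\<exists>x\<in>tms A. f x \<noteq> 0) \<longrightarrow>
        (\<forall>x\<in>tms A. summable (\<lambda>n. (ruelle A \<phi> ^^ n) f x / lam ^ n)))"


section \<open>Conformal measures\<close>

definition radon_measure :: "('s \<Rightarrow> 's \<Rightarrow> bool) \<Rightarrow> (nat \<Rightarrow> 's) measure \<Rightarrow> bool" where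
  "radon_measure A \<mu> \<longleftrightarrow>
     space \<mu> = tms A \<and>
     sets \<mu> = sigma_sets (tms A) {U. openin (tms_top A) U} \<and>
     (\<forall>K. compactin (tms_top A) K \<longrightarrow> emeasure \<mu> K < \<infinity>) \<and>
     (\<forall>B\<in>sets \<mu>. emeasure \<mu> B = Sup {emeasure \<mu> K | K. compactin (tms_top A) K \<and> K \<subseteq> B})"

text \<open>The zero measure counts as a (positive) Radon measure.\<close>

definition Conf ::
    "('s \<Rightarrow> 's \<Rightarrow> bool) \<Rightarrow> ((nat \<Rightarrow> 's) \<Rightarrow> real) \<Rightarrow> real \<Rightarrow> (nat \<Rightarrow> 's) measure set" where
  "Conf A \<phi> lam = {\<mu>. radon_measure A \<mu> \<and>
     (\<forall>K. compactin (tms_top A) K \<longrightarrow>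
        (\<integral>\<^sup>+x. ennreal (ruelle A \<phi> (indicator K) x) \<partial>\<mu>) = ennreal lam * emeasure \<mu> K)}"

text \<open>
  Between positive measures a negative factor is possible only if both are zero, in which
  case the factor \<open>0\<close> does as well.
\<close>

definition proportional :: "'a measure \<Rightarrow> 'a measure \<Rightarrow> bool" where
  "proportional \<mu> \<nu> \<longleftrightarrow> (\<exists>c::real. 0 \<le> c \<and> \<mu> = scale_measure (ennreal c) \<nu>)"

definition extremal ::
    "('s \<Rightarrow> 's \<Rightarrow> bool) \<Rightarrow> ((nat \<Rightarrow> 's) \<Rightarrow> real) \<Rightarrow> real \<Rightarrow> (nat \<Rightarrow> 's) measure \<Rightarrow> bool" where
  "extremal A \<phi> lam \<mu> \<longleftrightarrow>
     (\<forall>\<mu>1\<in>Conf A \<phi> lam. \<forall>\<mu>2\<in>Conf A \<phi> lam.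
        (\<forall>B\<in>sets \<mu>. emeasure \<mu> B = emeasure \<mu>1 B + emeasure \<mu>2 B) \<longrightarrow>
        proportional \<mu>1 \<mu> \<and> proportional \<mu>2 \<mu>)"


section \<open>Martin boundary\<close>

definition martin_kernel ::
    "('s \<Rightarrow> 's \<Rightarrow> bool) \<Rightarrow> ((nat \<Rightarrow> 's) \<Rightarrow> real) \<Rightarrow> real \<Rightarrow> 's \<Rightarrow>
     ((nat \<Rightarrow> 's) \<Rightarrow> real) \<Rightarrow> (nat \<Rightarrow> 's) \<Rightarrow> real" where
  "martin_kernel A \<phi> lam org f x =
     green A \<phi> lam f x / green A \<phi> lam (indicator (cyl A [org])) x"

definition word_enumeration :: "('s \<Rightarrow> 's \<Rightarrow> bool) \<Rightarrow> (nat \<Rightarrow> 's list) \<Rightarrow> bool" where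
  "word_enumeration A w \<longleftrightarrow> bij_betw w {1..} (admissible_words A)"

definition kernel_bounds ::
    "('s \<Rightarrow> 's \<Rightarrow> bool) \<Rightarrow> ((nat \<Rightarrow> 's) \<Rightarrow> real) \<Rightarrow> real \<Rightarrow> 's \<Rightarrow>
     (nat \<Rightarrow> 's list) \<Rightarrow> (nat \<Rightarrow> real) \<Rightarrow> bool" where
  "kernel_bounds A \<phi> lam org w C \<longleftrightarrow>
     (\<forall>i\<ge>1. 0 < C i \<and>
        (\<forall>x\<in>tms A. martin_kernel A \<phi> lam org (indicator (cyl A (w i))) x \<le> C i))"

text \<open>
  The words and constants are indexed by \<open>i \<ge> 1\<close>, whereas \<open>\<Sum>\<close> starts at
  \<open>0\<close>; hence the shift in the index.
\<close>

definition martin_dist ::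
    "('s \<Rightarrow> 's \<Rightarrow> bool) \<Rightarrow> ((nat \<Rightarrow> 's) \<Rightarrow> real) \<Rightarrow> real \<Rightarrow> 's \<Rightarrow>
     (nat \<Rightarrow> 's list) \<Rightarrow> (nat \<Rightarrow> real) \<Rightarrow> (nat \<Rightarrow> 's) \<Rightarrow> (nat \<Rightarrow> 's) \<Rightarrow> real" where
  "martin_dist A \<phi> lam org w C x y =
     (\<Sum>j. let i = Suc j; ind = (indicator (cyl A (w i)) :: (nat \<Rightarrow> 's) \<Rightarrow> real) in
        (\<bar>martin_kernel A \<phi> lam org ind x - martin_kernel A \<phi> lam org ind y\<bar>
          + \<bar>ind x - ind y\<bar>) / (2 ^ i * (C i + 1)))"

text \<open>
  A completion of the metric space \<open>(M, d)\<close>: a complete metric space \<open>Xh\<close>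
  together with an isometry \<open>\<iota>\<close> of \<open>M\<close> onto a dense subset of it. It is unique up
  to an isometry that respects the embeddings.
\<close>

definition is_completion ::
    "'a set \<Rightarrow> ('a \<Rightarrow> 'a \<Rightarrow> real) \<Rightarrow> 'b metric \<Rightarrow> ('a \<Rightarrow> 'b) \<Rightarrow> bool" where
  "is_completion M d Xh \<iota> \<longleftrightarrow>
     mcomplete_of Xh \<and> \<iota> ` M \<subseteq> mspace Xh \<and>
     (\<forall>x\<in>M. \<forall>y\<in>M. mdist Xh (\<iota> x) (\<iota> y) = d x y) \<and>
     mtopology_of Xh closure_of (\<iota> ` M) = mspace Xh"

definition martin_boundary ::
    "('s \<Rightarrow> 's \<Rightarrow> bool) \<Rightarrow> 'b metric \<Rightarrow> ((nat \<Rightarrow> 's) \<Rightarrow> 'b) \<Rightarrow> 'b set" where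
  "martin_boundary A Xh \<iota> = mspace Xh - \<iota> ` tms A"

definition ext_kernel ::
    "('s \<Rightarrow> 's \<Rightarrow> bool) \<Rightarrow> ((nat \<Rightarrow> 's) \<Rightarrow> real) \<Rightarrow> real \<Rightarrow> 's \<Rightarrow>
     'b metric \<Rightarrow> ((nat \<Rightarrow> 's) \<Rightarrow> 'b) \<Rightarrow> ((nat \<Rightarrow> 's) \<Rightarrow> real) \<Rightarrow> 'b \<Rightarrow> real" where
  "ext_kernel A \<phi> lam org Xh \<iota> f \<omega> =
     (THE r. \<exists>g. continuous_map (mtopology_of Xh) euclideanreal g \<and>
                 (\<forall>x\<in>tms A. g (\<iota> x) = martin_kernel A \<phi> lam org f x) \<and> g \<omega> = r)"

definition martin_measure ::
    "('s \<Rightarrow> 's \<Rightarrow> bool) \<Rightarrow> ((nat \<Rightarrow> 's) \<Rightarrow> real) \<Rightarrow> real \<Rightarrow> 's \<Rightarrow>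
     'b metric \<Rightarrow> ((nat \<Rightarrow> 's) \<Rightarrow> 'b) \<Rightarrow> 'b \<Rightarrow> (nat \<Rightarrow> 's) measure" where
  "martin_measure A \<phi> lam org Xh \<iota> \<omega> =
     (THE \<nu>. radon_measure A \<nu> \<and>
             (\<forall>f\<in>Cc A. (\<integral>x. f x \<partial>\<nu>) = ext_kernel A \<phi> lam org Xh \<iota> f \<omega>))"

end

theory Submission
  imports Defs "HOL-Library.Diagonal_Subsequence"
begin

text \<open>
  Let \<open>\<mu> \<noteq> 0\<close> be extremal, and write \<open>T\<close> for the shift. Conformality gives
  \<open>\<integral> G(f, x) h(x) d\<mu> = \<integral> f(x) (\<Sum>n. h(T\<^sup>n x)) d\<mu>\<close>, so by transience almost every orbit leaves
  every compact set. For \<open>U\<close> relatively compact, decomposing an orbit at its last visit to \<open>U\<close>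
  shows that \<open>\<mu>([v] \<inter> {x. \<exists>n. T\<^sup>n x \<in> U})\<close> is the integral of \<open>G(1\<^bsub>[v]\<^esub>, \<cdot>)\<close> over a subset of \<open>U\<close>
  that does not depend on \<open>v\<close>. Exhausting a general \<open>U\<close>, an inequality between Green's functions
  of two cylinders on \<open>U\<close> passes to their measures as soon as almost every orbit hits \<open>U\<close>.

  The set of points whose orbit visits \<open>U\<close> outside every compact set is \<open>T\<close>-invariant, so restricting
  \<open>\<mu>\<close> to it gives a conformal measure and extremality makes it null or conull. If near infinity no
  point \<open>x\<close> had the kernels \<open>K(1\<^bsub>[v]\<^esub>, x)\<close> close to \<open>\<mu>[v] / \<mu>[o]\<close> for finitely many given \<open>v\<close>,
  finitely many half-spaces \<open>{K(1\<^bsub>[v]\<^esub>, x) \<ge> \<mu>[v] / \<mu>[o] + \<epsilon>}\<close> and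
  \<open>{K(1\<^bsub>[v]\<^esub>, x) \<le> \<mu>[v] / \<mu>[o] - \<epsilon>}\<close> would cover a neighbourhood of infinity; one of them would be
  visited in this way by almost every orbit, contradicting the comparison. Points chosen closer and
  closer to infinity then converge to the required boundary point.

  For \<open>\<mu> = 0\<close> it remains to see that the boundary carries some point whose Martin measure exists:
  along an escaping sequence with convergent kernels, the limits define a measure by
  Caratheodory's extension theorem.
\<close>

section \<open>Topology of the shift space\<close>

text \<open>Conformality speaks about integrals, whereas a boundary point requires actual points
  with prescribed kernel values. The bridge is that the set of last visits depends on the target set
  alone: it acts as the same weight for every cylinder, so a pointwise inequality between two
  Green's functions can be integrated against it although nothing is known about its size. The
  target value \<open>\<mu>[v] / \<mu>[o]\<close> is forced by the normalisation K(1_[o], x) = 1.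

  Only finitely many words are approximated at a time because the contradiction is a pigeonhole over
  two half-spaces per word: each is null or conull as a set of escaping visits, and they cannot all
  be null, since almost every orbit leaves every compact set. That fact needs Green's function to be
  bounded on a cylinder, while transience gives finiteness only point by point; summable variations
  supply the uniform bound through distortion.

  Green's function occurs in two versions: the real \<open>green\<close> of the statement, and the
  extended nonnegative \<open>Gp\<close>, for which sums and integrals may be exchanged freely. They
  agree on cylinders of nonempty words.\<close>

lemma cyl_prefix: "cyl A (map x [0..<n]) = {y \<in> tms A. \<forall>i<n. y i = x i}"
  by (auto simp: cyl_def)

lemma cyl_single: "cyl A [a] = {x \<in> tms A. x 0 = a}"
  by (auto simp: cyl_def)

lemma cyl_subset: "cyl A w \<subseteq> tms A"
  by (auto simp: cyl_def)

lemma prefix_in_cyl: "x \<in> tms A \<Longrightarrow> x \<in> cyl A (map x [0..<n])"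
  by (simp add: cyl_prefix)

lemma cyl_eq_prefix:
  assumes "x \<in> cyl A w" shows "cyl A w = cyl A (map x [0..<length w])"
  using assms by (auto simp: cyl_def)

lemma shift_tms: "x \<in> tms A \<Longrightarrow> shift x \<in> tms A"
  by (simp add: tms_def shift_def)

lemma funpow_shift: "(shift ^^ n) x = (\<lambda>i. x (i + n))"
  by (induction n arbitrary: x) (auto simp: shift_def)

lemma funpow_shift_tms: "x \<in> tms A \<Longrightarrow> (shift ^^ n) x \<in> tms A"
  by (simp add: tms_def funpow_shift)

lemma case_nat_tms: "x \<in> tms A \<Longrightarrow> case_nat a x \<in> tms A \<longleftrightarrow> A a (x 0)"
  by (auto simp: tms_def split: nat.split dest: spec[of _ 0])

lemma shift_case_nat: "shift (case_nat a x) = x"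
  by (simp add: shift_def)

lemma case_nat_shift: "case_nat (x 0) (shift x) = x"
  by (auto simp: shift_def split: nat.split)

lemma tms_dist_less_iff: "tms_dist x y < (1/2)^n \<longleftrightarrow> (\<forall>i\<le>n. x i = y i)"
proof (cases "x = y")
  case False
  define k where "k = (LEAST i. x i \<noteq> y i)"
  obtain i where "x i \<noteq> y i" using False by blast
  then have k: "x k \<noteq> y k"
    unfolding k_def by (rule LeastI)
  have below: "x i = y i" if "i < k" for i
    using not_less_Least[OF that[unfolded k_def]] by simp
  have "tms_dist x y < (1/2)^n \<longleftrightarrow> n < k"
    using False by (simp add: tms_dist_def flip: k_def)
  also have "\<dots> \<longleftrightarrow> (\<forall>i\<le>n. x i = y i)"
    using k below by (meson le_less_trans not_less)
  finally show ?thesis .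
qed (simp add: tms_dist_def)

text \<open>A ball of radius \<open>(1/2)^n\<close> consists of the points agreeing with the centre
  in coordinates \<open>0\<close> to \<open>n\<close>, so it is the cylinder of a prefix of length
  \<open>Suc n\<close>; prefix cylinders therefore form a neighbourhood base.\<close>

lemma openin_tms_top:
  "openin (tms_top A) U \<longleftrightarrow> U \<subseteq> tms A \<and> (\<forall>x\<in>U. \<exists>n. cyl A (map x [0..<n]) \<subseteq> U)"
proof -
  interpret Metric_space "tms A" tms_dist by (rule Metric_space_tms)
  have ball: "cyl A (map x [0..<Suc n]) = mball x ((1/2)^n)" if "x \<in> tms A" for x n
    using that by (auto simp: cyl_prefix tms_dist_less_iff less_Suc_eq_le simp del: upt_Suc)
  have "(\<exists>r>0. mball x r \<subseteq> U) \<longleftrightarrow> (\<exists>n. cyl A (map x [0..<n]) \<subseteq> U)"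
    if x: "x \<in> tms A" for x
  proof
    assume "\<exists>r>0. mball x r \<subseteq> U"
    then obtain r where r: "r > 0" "mball x r \<subseteq> U" by blast
    obtain n where "(1/2::real)^n < r"
      using real_arch_pow_inv[of r "1/2"] r by auto
    then have "mball x ((1/2)^n) \<subseteq> mball x r" by (intro mball_subset_concentric) simp
    then show "\<exists>n. cyl A (map x [0..<n]) \<subseteq> U"
      using r ball[OF x, of n] by blast
  next
    assume "\<exists>n. cyl A (map x [0..<n]) \<subseteq> U"
    then obtain n where "cyl A (map x [0..<n]) \<subseteq> U" by blast
    moreover have "cyl A (map x [0..<Suc n]) \<subseteq> cyl A (map x [0..<n])"
      unfolding cyl_prefix by auto
    ultimately have "mball x ((1/2)^n) \<subseteq> U" using ball[OF x, of n] by blast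
    then show "\<exists>r>0. mball x r \<subseteq> U"
      by (intro exI[of _ "(1/2)^n"]) auto
  qed
  then have "(\<forall>x\<in>U. \<exists>r>0. mball x r \<subseteq> U) \<longleftrightarrow> (\<forall>x\<in>U. \<exists>n. cyl A (map x [0..<n]) \<subseteq> U)"
    if "U \<subseteq> tms A" using that by (intro ball_cong refl) auto
  then show ?thesis
    unfolding tms_top_def openin_mtopology Ball_def[symmetric] by (intro conj_cong refl) simp
qed

lemma topspace_tms_top [simp]: "topspace (tms_top A) = tms A"
  using Metric_space.topspace_mtopology[OF Metric_space_tms] by (simp add: tms_top_def)

lemma Hausdorff_tms_top: "Hausdorff_space (tms_top A)"
  unfolding tms_top_def by (rule Metric_space.Hausdorff_space_mtopology[OF Metric_space_tms])

lemma openin_cyl: "openin (tms_top A) (cyl A w)"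
proof -
  have "cyl A (map x [0..<length w]) \<subseteq> cyl A w" if "x \<in> cyl A w" for x
    using cyl_eq_prefix[OF that] by simp
  then show ?thesis
    unfolding openin_tms_top using cyl_subset[of A w] by blast
qed

lemma openin_first_symbol: "openin (tms_top A) {x \<in> tms A. P (x 0)}"
proof -
  have "{x \<in> tms A. P (x 0)} = \<Union>{cyl A [a] | a. P a}" by (auto simp: cyl_single)
  then show ?thesis by (auto intro!: openin_Union openin_cyl)
qed

lemma closedin_cyl: "closedin (tms_top A) (cyl A w)"
proof -
  have "cyl A (map x [0..<length w]) \<subseteq> tms A - cyl A w" if x: "x \<in> tms A - cyl A w" for x
  proof -
    obtain i where "i < length w" "x i \<noteq> w ! i" using x by (auto simp: cyl_def)
    then show ?thesis unfolding cyl_prefix by (auto simp: cyl_def)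
  qed
  then have "openin (tms_top A) (tms A - cyl A w)"
    unfolding openin_tms_top by blast
  then show ?thesis
    using cyl_subset[of A w] by (simp add: closedin_def)
qed

text \<open>Each coordinate of a Cauchy sequence is eventually constant, and the limit collects the
  stable values. Admissibility survives because it only compares neighbouring coordinates.\<close>

lemma mcomplete_tms: "Metric_space.mcomplete (tms A) tms_dist"
proof -
  interpret Metric_space "tms A" tms_dist by (rule Metric_space_tms)
  show ?thesis
    unfolding mcomplete_def
  proof (intro allI impI)
    fix \<sigma> assume "MCauchy \<sigma>"
    then have \<sigma>: "\<And>n. \<sigma> n \<in> tms A"
      and C: "\<And>\<epsilon>. \<epsilon> > 0 \<Longrightarrow> \<exists>N. \<forall>n n'. N \<le> n \<longrightarrow> N \<le> n' \<longrightarrow> tms_dist (\<sigma> n) (\<sigma> n') < \<epsilon>"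
      unfolding MCauchy_def by blast+
    have "\<exists>N. \<forall>n\<ge>N. \<forall>i\<le>k. \<sigma> n i = \<sigma> N i" for k
    proof -
      obtain N where "\<forall>n n'. N \<le> n \<longrightarrow> N \<le> n' \<longrightarrow> tms_dist (\<sigma> n) (\<sigma> n') < (1/2)^k"
        using C[of "(1/2)^k"] by auto
      then show ?thesis
        unfolding tms_dist_less_iff by (meson order_refl)
    qed
    then obtain N where N: "\<And>k n i. n \<ge> N k \<Longrightarrow> i \<le> k \<Longrightarrow> \<sigma> n i = \<sigma> (N k) i"
      by metis
    define x where "x k = \<sigma> (N k) k" for k
    have x: "\<sigma> n i = x i" if "n \<ge> N i" for n i
      unfolding x_def by (rule N[OF that order_refl])
    have eq: "\<sigma> n i = x i" if "n \<ge> N k" "i \<le> k" for n i k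
    proof -
      \<comment> \<open>\<open>N\<close> need not be monotone, so coordinate \<open>i\<close> is
        read at a time beyond both \<open>n\<close> and \<open>N i\<close>.\<close>
      have "\<sigma> n i = \<sigma> (max n (N i)) i"
        using N[OF that] N[OF le_trans[OF that(1) max.cobounded1] that(2)] by (metis (no_types))
      then show ?thesis using x[of i "max n (N i)"] by simp
    qed
    have "x \<in> tms A"
    proof -
      have "A (x i) (x (Suc i))" for i
      proof -
        have "\<sigma> (N (Suc i)) i = x i" "\<sigma> (N (Suc i)) (Suc i) = x (Suc i)"
          by (rule eq[of "Suc i"]; simp)+
        moreover have "A (\<sigma> (N (Suc i)) i) (\<sigma> (N (Suc i)) (Suc i))"
          using \<sigma>[of "N (Suc i)"] unfolding tms_def by blast
        ultimately show ?thesis by simp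
      qed
      then show ?thesis by (simp add: tms_def)
    qed
    moreover have "\<exists>N. \<forall>n\<ge>N. tms_dist (\<sigma> n) x < \<epsilon>" if "\<epsilon> > 0" for \<epsilon>
    proof -
      obtain k where k: "(1/2::real)^k < \<epsilon>"
        using real_arch_pow_inv[of \<epsilon> "1/2"] \<open>\<epsilon> > 0\<close> by auto
      have "tms_dist (\<sigma> n) x < (1/2)^k" if "n \<ge> N k" for n
        unfolding tms_dist_less_iff by (intro allI impI eq[OF that])
      then have "\<forall>n\<ge>N k. tms_dist (\<sigma> n) x < \<epsilon>" using k by (auto intro: less_trans)
      then show ?thesis ..
    qed
    ultimately show "\<exists>x. limitin mtopology \<sigma> x sequentially"
      unfolding limit_metric_sequentially using \<sigma> by (intro exI[of _ x] conjI allI impI) auto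
  qed
qed

section \<open>Finite branching and compact sets\<close>

text \<open>Every state has finitely many successors, so the tree of words rooted in a finite set of
  letters has finite levels.\<close>

lemma finite_prefixes:
  assumes "locally_compact_tms A" "finite F"
  shows "finite {map x [0..<n] | x. x \<in> tms A \<and> x 0 \<in> F}"
proof (induction n)
  case (Suc n)
  show ?case
  proof (cases n)
    case 0
    have "{map x [0..<Suc n] | x. x \<in> tms A \<and> x 0 \<in> F} \<subseteq> (\<lambda>a. [a]) ` F"
      using 0 by auto
    then show ?thesis using assms(2) finite_surj by blast
  next
    case (Suc m)
    let ?S = "{map x [0..<n] | x. x \<in> tms A \<and> x 0 \<in> F}"
    have "{map x [0..<Suc n] | x. x \<in> tms A \<and> x 0 \<in> F}
        \<subseteq> (\<Union>w\<in>?S. (\<lambda>b. w @ [b]) ` {b. A (last w) b})"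
    proof clarify
      fix x assume x: "x \<in> tms A" "x 0 \<in> F"
      have "last (map x [0..<n]) = x m" using Suc by simp
      then have "A (last (map x [0..<n])) (x n)" using x Suc by (auto simp: tms_def)
      then show "map x [0..<Suc n] \<in> (\<Union>w\<in>?S. (\<lambda>b. w @ [b]) ` {b. A (last w) b})"
        using x by (intro UN_I[of "map x [0..<n]"]) auto
    qed
    moreover have "finite (\<Union>w\<in>?S. (\<lambda>b. w @ [b]) ` {b. A (last w) b})"
      using Suc.IH assms(1) by (auto simp: locally_compact_tms_def)
    ultimately show ?thesis using finite_subset by blast
  qed
qed (auto intro: finite_subset[of _ "{[]}"])

text \<open>Prefixes of length \<open>Suc n\<close> cut the set into finitely many pieces whose
  points are pairwise closer than \<open>(1/2)^n\<close>. This is total boundedness, and the set is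
  closed in a complete space.\<close>

lemma compactin_first_symbol:
  assumes lc: "locally_compact_tms A" and F: "finite F"
  shows "compactin (tms_top A) {x \<in> tms A. x 0 \<in> F}"
proof -
  interpret Metric_space "tms A" tms_dist by (rule Metric_space_tms)
  let ?S = "{x \<in> tms A. x 0 \<in> F}"
  have "mtotally_bounded ?S"
    unfolding mtotally_bounded_def
  proof (intro allI impI)
    fix \<epsilon> :: real assume "\<epsilon> > 0"
    then obtain n where n: "(1/2::real)^n < \<epsilon>"
      using real_arch_pow_inv[of \<epsilon> "1/2"] by auto
    define pre where "pre x = map x [0..<Suc n]" for x :: "nat \<Rightarrow> 'a"
    have "finite (pre ` ?S)"
      using finite_prefixes[OF lc F, of "Suc n"] unfolding pre_def image_Collect by (simp add: conj_commute)
    from finite_subset_image[OF this subset_refl]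
    obtain K where K: "K \<subseteq> ?S" "finite K" "pre ` ?S = pre ` K"
      by blast
    have "x \<in> (\<Union>y\<in>K. mball y \<epsilon>)" if "x \<in> ?S" for x
    proof -
      have "pre x \<in> pre ` K" using imageI[OF that, of pre] K(3) by simp
      then obtain y where y: "y \<in> K" "pre x = pre y" by blast
      have "\<forall>i\<in>set [0..<Suc n]. x i = y i"
        using y(2) unfolding pre_def map_eq_conv .
      then have "\<forall>i\<le>n. y i = x i" by (simp add: less_Suc_eq_le del: upt_Suc)
      then have "tms_dist y x < (1/2)^n" unfolding tms_dist_less_iff .
      then have "tms_dist y x < \<epsilon>" using n by linarith
      moreover have "x \<in> tms A" "y \<in> tms A" using that y(1) K(1) by auto
      ultimately have "x \<in> mball y \<epsilon>" by simp
      then show ?thesis using y(1) by blast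
    qed
    then show "\<exists>K. finite K \<and> K \<subseteq> ?S \<and> ?S \<subseteq> (\<Union>x\<in>K. mball x \<epsilon>)"
      using K(1,2) by (intro exI[of _ K] conjI subsetI) auto
  qed
  then have "compactin mtopology (mtopology closure_of ?S)"
    using mtotally_bounded_eq_compact_closure_of[OF mcomplete_tms] by blast
  moreover have "closedin (tms_top A) ?S"
  proof -
    have "tms A - ?S = {x \<in> tms A. x 0 \<notin> F}" by auto
    then show ?thesis using openin_first_symbol[of A "\<lambda>s. s \<notin> F"] by (auto simp: closedin_def)
  qed
  ultimately show ?thesis
    unfolding tms_top_def by (simp add: closure_of_closedin)
qed

lemma compactin_cyl:
  assumes "locally_compact_tms A" "w \<noteq> []"
  shows "compactin (tms_top A) (cyl A w)"
proof (rule closed_compactin[OF compactin_first_symbol[OF assms(1), of "{hd w}"]])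
  show "cyl A w \<subseteq> {x \<in> tms A. x 0 \<in> {hd w}}"
    using assms(2) by (auto simp: cyl_def hd_conv_nth)
qed (auto simp: closedin_cyl)

text \<open>One-letter cylinders form an open cover, of which a compact set needs only finitely
  many.\<close>

lemma compactin_imp_finite_first_symbols:
  assumes "compactin (tms_top A) K"
  obtains F where "finite F" "K \<subseteq> {x \<in> tms A. x 0 \<in> F}"
proof -
  have "K \<subseteq> tms A" using assms compactin_subset_topspace by fastforce
  then have "K \<subseteq> \<Union>(range (\<lambda>a. cyl A [a]))" by (auto simp: cyl_single)
  moreover have "\<And>U. U \<in> range (\<lambda>a. cyl A [a]) \<Longrightarrow> openin (tms_top A) U"
    using openin_cyl by blast
  ultimately obtain \<F> where \<F>: "finite \<F>" "\<F> \<subseteq> range (\<lambda>a. cyl A [a])" "K \<subseteq> \<Union>\<F>"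
    using compactinD[OF assms, of "range (\<lambda>a. cyl A [a])"] by metis
  obtain F where "finite F" "\<F> = (\<lambda>a. cyl A [a]) ` F"
    using finite_subset_image[OF \<F>(1,2)] by blast
  with \<F>(3) have "K \<subseteq> {x \<in> tms A. x 0 \<in> F}" by (auto simp: cyl_single)
  with \<open>finite F\<close> that show thesis by blast
qed

section \<open>Compactly supported functions and step functions on cylinders\<close>

lemma Cc_indicator_cyl:
  assumes "locally_compact_tms A" "w \<noteq> []"
  shows "indicator (cyl A w) \<in> Cc A"
proof -
  have "continuous_map (tms_top A) euclideanreal (indicator (cyl A w))"
    unfolding continuous_map_def
  proof (intro conjI allI impI)
    fix U :: "real set" assume "openin euclideanreal U"
    have "{x \<in> tms A. indicator (cyl A w) x \<in> U}
        = (if 1 \<in> U then cyl A w else {}) \<union> (if 0 \<in> U then tms A - cyl A w else {})"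
      using cyl_subset[of A w] by (auto simp: indicator_def)
    moreover have "openin (tms_top A) (tms A - cyl A w)"
      using closedin_cyl[of A w] by (simp add: closedin_def)
    ultimately show "openin (tms_top A) {x \<in> topspace (tms_top A). indicator (cyl A w) x \<in> U}"
      by (simp add: openin_Un openin_cyl)
  qed auto
  moreover have "{x \<in> tms A. indicator (cyl A w) x \<noteq> (0::real)} = cyl A w"
    using cyl_subset[of A w] by (auto simp: indicator_def)
  ultimately show ?thesis
    using assms by (simp add: Cc_def closure_of_closedin[OF closedin_cyl] compactin_cyl)
qed

text \<open>The factor \<open>indicator F (x 0)\<close>, with \<open>F\<close> independent of
  \<open>\<epsilon>\<close>, confines the error to finitely many cylinders; a positive linear
  functional such as the Martin kernel can then be applied to the estimate.\<close>

lemma Cc_approx: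
  assumes lc: "locally_compact_tms A" and f: "f \<in> Cc A"
  obtains F where "finite F"
    "\<forall>\<epsilon>>0. \<exists>W c. finite W \<and> W \<subseteq> admissible_words A \<and>
        (\<forall>x\<in>tms A. \<bar>f x - (\<Sum>w\<in>W. c w * indicator (cyl A w) x)\<bar> \<le> \<epsilon> * indicator F (x 0))"
proof -
  have cont: "continuous_map (tms_top A) euclideanreal f"
    and supp: "compactin (tms_top A) (tms_top A closure_of {x \<in> tms A. f x \<noteq> 0})"
    using f by (auto simp: Cc_def)
  obtain F where F: "finite F" "tms_top A closure_of {x \<in> tms A. f x \<noteq> 0} \<subseteq> {x \<in> tms A. x 0 \<in> F}"
    using compactin_imp_finite_first_symbols[OF supp] by blast
  have f0: "x 0 \<in> F" if "x \<in> tms A" "f x \<noteq> 0" for x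
  proof -
    have "x \<in> tms_top A closure_of {x \<in> tms A. f x \<noteq> 0}"
      using closure_of_subset[of "{x \<in> tms A. f x \<noteq> 0}" "tms_top A"] that by auto
    then show ?thesis using F(2) by blast
  qed
  let ?E = "{x \<in> tms A. x 0 \<in> F}"
  have "\<exists>W c. finite W \<and> W \<subseteq> admissible_words A \<and>
        (\<forall>x\<in>tms A. \<bar>f x - (\<Sum>w\<in>W. c w * indicator (cyl A w) x)\<bar> \<le> \<epsilon> * indicator F (x 0))"
    if "\<epsilon> > 0" for \<epsilon> :: real
  proof -
    have "\<exists>n. \<forall>y\<in>cyl A (map x [0..<n]). \<bar>f y - f x\<bar> < \<epsilon>/2" if x: "x \<in> tms A" for x
    proof -
      have "openin (tms_top A) {y \<in> topspace (tms_top A). f y \<in> ball (f x) (\<epsilon>/2)}"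
        by (rule openin_continuous_map_preimage[OF cont]) auto
      moreover have "x \<in> {y \<in> topspace (tms_top A). f y \<in> ball (f x) (\<epsilon>/2)}"
        using x \<open>\<epsilon> > 0\<close> by auto
      ultimately obtain n where "cyl A (map x [0..<n]) \<subseteq> {y \<in> topspace (tms_top A). f y \<in> ball (f x) (\<epsilon>/2)}"
        unfolding openin_tms_top by blast
      then have "\<forall>y\<in>cyl A (map x [0..<n]). dist (f x) (f y) < \<epsilon>/2" by auto
      then show ?thesis
        by (intro exI[of _ n]) (simp add: dist_real_def abs_minus_commute)
    qed
    then obtain n where n: "\<And>x y. x \<in> tms A \<Longrightarrow> y \<in> cyl A (map x [0..<n x]) \<Longrightarrow> \<bar>f y - f x\<bar> < \<epsilon>/2"
      by metis
    define N where "N x = cyl A (map x [0..<n x])" for x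
    have "?E \<subseteq> \<Union>(N ` ?E)" by (auto simp: N_def prefix_in_cyl)
    moreover have "openin (tms_top A) U" if "U \<in> N ` ?E" for U
      using that by (auto simp: N_def openin_cyl)
    ultimately have "\<exists>\<F>. finite \<F> \<and> \<F> \<subseteq> N ` ?E \<and> ?E \<subseteq> \<Union>\<F>"
      by (intro compactinD[OF compactin_first_symbol[OF lc F(1)]])
    then obtain \<F> where \<F>: "finite \<F>" "\<F> \<subseteq> N ` ?E" "?E \<subseteq> \<Union>\<F>" by (elim exE conjE)
    from finite_subset_image[OF \<F>(1,2)] obtain P where P: "P \<subseteq> ?E" "finite P" "\<F> = N ` P"
      by (elim exE conjE)
    \<comment> \<open>One length for all words, so that a point lies in at most one of their
      cylinders; it is at least every \<open>n p\<close>, and \<open>Suc\<close> keeps the words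
      nonempty.\<close>
    define m where "m = Suc (Max (insert 0 (n ` P)))"
    have m: "n p \<le> m" if "p \<in> P" for p
      unfolding m_def using P(2) that by (intro le_SucI Max_ge) auto
    define W where "W = {map x [0..<m] | x. x \<in> tms A \<and> x 0 \<in> F}"
    have finW: "finite W"
      unfolding W_def by (rule finite_prefixes[OF lc F(1)])
    \<comment> \<open>A sample value of \<open>f\<close> on the cylinder; by \<open>osc\<close>
      every choice is good enough.\<close>
    define c where "c v = f (SOME y. y \<in> cyl A v)" for v
    have osc: "\<bar>f x - f y\<bar> < \<epsilon>" if x: "x \<in> ?E" and y: "y \<in> cyl A (map x [0..<m])" for x y
    proof -
      \<comment> \<open>Both \<open>x\<close> and \<open>y\<close> lie in one neighbourhood
        \<open>N p\<close>, on which \<open>f\<close> stays within \<open>\<epsilon>/2\<close> of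
        \<open>f p\<close>.\<close>
      have "x \<in> \<Union>(N ` P)" using \<F>(3) x unfolding P(3) by (rule subsetD)
      then obtain p where p: "p \<in> P" "x \<in> N p" by (elim UN_E)
      have "y \<in> N p" using y p m[OF p(1)] by (auto simp: N_def cyl_prefix)
      then show ?thesis
        using n[of p x] n[of p y] p P(1) unfolding N_def by (auto simp: abs_if split: if_splits)
    qed
    have "\<bar>f x - (\<Sum>w\<in>W. c w * indicator (cyl A w) x)\<bar> \<le> \<epsilon> * indicator F (x 0)"
      if x: "x \<in> tms A" for x
    proof -
      have ind: "indicator (cyl A w) x = (if w = map x [0..<m] then 1 else (0::real))" if w: "w \<in> W" for w
      proof -
        obtain y where "w = map y [0..<m]" using w by (auto simp: W_def)
        then have "x \<in> cyl A w \<longleftrightarrow> w = map x [0..<m]"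
          using x by (auto simp: cyl_prefix)
        then show ?thesis by (simp add: indicator_def)
      qed
      have "(\<Sum>w\<in>W. c w * indicator (cyl A w) x) = (\<Sum>w\<in>W. if w = map x [0..<m] then c w else 0)"
        by (rule sum.cong) (auto simp: ind)
      also have "\<dots> = (if map x [0..<m] \<in> W then c (map x [0..<m]) else 0)"
        using finW by (simp add: sum.delta)
      finally have S: "(\<Sum>w\<in>W. c w * indicator (cyl A w) x) = (if map x [0..<m] \<in> W then c (map x [0..<m]) else 0)" .
      show ?thesis
      proof (cases "x 0 \<in> F")
        case True
        then have "map x [0..<m] \<in> W" using x by (auto simp: W_def)
        moreover have "(SOME y. y \<in> cyl A (map x [0..<m])) \<in> cyl A (map x [0..<m])"
          using prefix_in_cyl[OF x] by (metis someI)
        then have "\<bar>f x - c (map x [0..<m])\<bar> < \<epsilon>"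
          unfolding c_def using osc True x by blast
        ultimately show ?thesis using S True by simp
      next
        case False
        have "map x [0..<m] \<notin> W"
          using False unfolding W_def m_def by (force simp: upt_conv_Cons)
        moreover have "f x = 0" using f0 x False by blast
        ultimately show ?thesis using S False by simp
      qed
    qed
    moreover have "W \<subseteq> admissible_words A"
      unfolding W_def admissible_words_def m_def using prefix_in_cyl by (auto simp del: upt_Suc)
    ultimately show ?thesis using finW by blast
  qed
  then show thesis using that[OF F(1)] by simp
qed

section \<open>Cylinders as a semiring generating the Borel sets\<close>

definition tms_sets :: "('s \<Rightarrow> 's \<Rightarrow> bool) \<Rightarrow> (nat \<Rightarrow> 's) set set" where
  "tms_sets A = sigma_sets (tms A) {U. openin (tms_top A) U}"

text \<open>It is the word that is nonempty, not the cylinder: the empty set may belong to the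
  family. Dropping the empty word drops the whole space, and under local compactness the remaining
  cylinders are compact.\<close>

definition nonempty_cyls :: "('s \<Rightarrow> 's \<Rightarrow> bool) \<Rightarrow> (nat \<Rightarrow> 's) set set" where
  "nonempty_cyls A = cyl A ` {w. w \<noteq> []}"

text \<open>An open set is the union of the cylinders inside it, and a countable alphabet has only
  countably many words.\<close>

lemma tms_sets_eq_cyls:
  fixes A :: "'s::countable \<Rightarrow> 's \<Rightarrow> bool"
  shows "tms_sets A = sigma_sets (tms A) (nonempty_cyls A)"
proof
  have "U \<in> sigma_sets (tms A) (nonempty_cyls A)" if U: "openin (tms_top A) U" for U
  proof -
    have "\<exists>n. cyl A (map x [0..<Suc n]) \<subseteq> U" if x: "x \<in> U" for x
    proof -
      obtain n where "cyl A (map x [0..<n]) \<subseteq> U"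
        using U x unfolding openin_tms_top by blast
      moreover have "cyl A (map x [0..<Suc n]) \<subseteq> cyl A (map x [0..<n])"
        unfolding cyl_prefix by auto
      ultimately show ?thesis by blast
    qed
    then obtain n where n: "\<And>x. x \<in> U \<Longrightarrow> cyl A (map x [0..<Suc (n x)]) \<subseteq> U" by metis
    have "U = (\<Union>v\<in>{v. v \<noteq> [] \<and> cyl A v \<subseteq> U}. cyl A v)"
    proof
      show "U \<subseteq> (\<Union>v\<in>{v. v \<noteq> [] \<and> cyl A v \<subseteq> U}. cyl A v)"
      proof
        fix x assume "x \<in> U"
        then show "x \<in> (\<Union>v\<in>{v. v \<noteq> [] \<and> cyl A v \<subseteq> U}. cyl A v)"
          using n[of x] U prefix_in_cyl[of x A "Suc (n x)"] unfolding openin_tms_top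
          by (intro UN_I[of "map x [0..<Suc (n x)]"]) auto
      qed
    qed auto
    moreover have "(\<Union>v\<in>{v. v \<noteq> [] \<and> cyl A v \<subseteq> U}. cyl A v) \<in> sigma_sets (tms A) (nonempty_cyls A)"
      by (rule sigma_sets_UNION) (auto simp: nonempty_cyls_def intro: sigma_sets.Basic)
    ultimately show ?thesis by simp
  qed
  then show "tms_sets A \<subseteq> sigma_sets (tms A) (nonempty_cyls A)"
    unfolding tms_sets_def by (intro sigma_sets_mono) auto
  show "sigma_sets (tms A) (nonempty_cyls A) \<subseteq> tms_sets A"
    unfolding tms_sets_def nonempty_cyls_def using openin_cyl
    by (intro sigma_sets_mono) (auto intro!: sigma_sets.Basic)
qed

lemma nonempty_cyls_subset: "nonempty_cyls A \<subseteq> Pow (tms A)"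
  by (auto simp: nonempty_cyls_def cyl_def)

text \<open>Two cylinders with a common point are given by prefixes of that point, so the longer
  prefix describes the intersection; for disjoint cylinders the assumption steps in.\<close>

lemma Int_stable_nonempty_cyls:
  fixes A :: "'s::countable \<Rightarrow> 's \<Rightarrow> bool"
  assumes "{} \<in> nonempty_cyls A"
  shows "Int_stable (nonempty_cyls A)"
  unfolding Int_stable_def
proof (intro ballI)
  fix S S' assume "S \<in> nonempty_cyls A" "S' \<in> nonempty_cyls A"
  then obtain v v' where v: "S = cyl A v" "v \<noteq> []" "S' = cyl A v'" "v' \<noteq> []"
    by (auto simp: nonempty_cyls_def)
  show "S \<inter> S' \<in> nonempty_cyls A"
  proof (cases "S \<inter> S' = {}")
    case False
    then obtain x where x: "x \<in> S" "x \<in> S'" by blast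
    have "S \<inter> S' = cyl A (map x [0..<max (length v) (length v')])"
      using cyl_eq_prefix[of x A v] cyl_eq_prefix[of x A v'] x v by (auto simp: cyl_prefix less_max_iff_disj)
    then show ?thesis using v by (auto simp: nonempty_cyls_def)
  qed (use assms in simp)
qed

text \<open>If every transition were allowed, each state would have infinitely many successors.
  Hence some two-letter word is forbidden, and its cylinder is the empty set that a semiring must
  contain.\<close>

lemma empty_in_nonempty_cyls:
  fixes A :: "'s \<Rightarrow> 's \<Rightarrow> bool"
  assumes "infinite (UNIV :: 's set)" "locally_compact_tms A"
  shows "{} \<in> nonempty_cyls A"
proof -
  have "\<exists>a b. \<not> A a b"
  proof (rule ccontr)
    assume "\<not> ?thesis"
    then show False using assms by (simp add: locally_compact_tms_def)
  qed
  then obtain a b where "\<not> A a b" by blast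
  then have "x \<notin> cyl A [a, b]" for x
    by (auto simp: cyl_def tms_def less_Suc_eq all_conj_distrib dest: spec[of _ 0])
  then have "cyl A [a, b] = {}" by blast
  then show ?thesis unfolding nonempty_cyls_def by (auto intro!: image_eqI[of _ _ "[a, b]"])
qed

text \<open>Cylinders of the common length \<open>n\<close> lie either inside or outside each of
  \<open>S\<close> and \<open>S'\<close>, and local compactness leaves finitely many of them within
  \<open>S\<close>.\<close>

lemma semiring_nonempty_cyls:
  fixes A :: "'s::countable \<Rightarrow> 's \<Rightarrow> bool"
  assumes lc: "locally_compact_tms A" and empty: "{} \<in> nonempty_cyls A"
  shows "semiring_of_sets (tms A) (nonempty_cyls A)"
proof
  show "nonempty_cyls A \<subseteq> Pow (tms A)" by (rule nonempty_cyls_subset)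
  show "{} \<in> nonempty_cyls A" by (rule empty)
  fix S S' assume S: "S \<in> nonempty_cyls A" "S' \<in> nonempty_cyls A"
  then show "S \<inter> S' \<in> nonempty_cyls A"
    using Int_stable_nonempty_cyls[OF empty] by (simp add: Int_stable_def)
  from S obtain u v where u: "S = cyl A u" "u \<noteq> []" and v: "S' = cyl A v"
    by (auto simp: nonempty_cyls_def)
  define n where "n = max (length u) (length v)"
  define \<C> where "\<C> = (\<lambda>x. cyl A (map x [0..<n])) ` (S - S')"
  have n: "length u \<le> n" "length v \<le> n" "n \<noteq> 0" using u(2) by (auto simp: n_def)
  have sub: "cyl A (map x [0..<n]) \<subseteq> S - S'" if x: "x \<in> S - S'" for x
  proof
    fix y assume "y \<in> cyl A (map x [0..<n])"
    then have y: "y \<in> tms A" "\<And>i. i < n \<Longrightarrow> y i = x i" by (auto simp: cyl_prefix)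
    have "y \<in> cyl A u" using x u y n(1) by (auto simp: cyl_def)
    moreover have "y \<notin> cyl A v"
    proof
      assume yv: "y \<in> cyl A v"
      have "x i = v ! i" if "i < length v" for i
        using yv y(2)[of i] n(2) that by (simp add: cyl_def)
      then show False using x u v by (auto simp: cyl_def)
    qed
    ultimately show "y \<in> S - S'" using u v by simp
  qed
  have "\<C> \<subseteq> nonempty_cyls A"
    unfolding \<C>_def nonempty_cyls_def using n(3) by auto
  moreover have "finite \<C>"
  proof -
    have "\<C> \<subseteq> cyl A ` {map x [0..<n] | x. x \<in> tms A \<and> x 0 \<in> {hd u}}"
    proof -
      have "x \<in> tms A \<and> x 0 \<in> {hd u}" if "x \<in> S - S'" for x
        using that u by (auto simp: cyl_def hd_conv_nth)
      then show ?thesis unfolding \<C>_def by blast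
    qed
    moreover have "finite (cyl A ` {map x [0..<n] | x. x \<in> tms A \<and> x 0 \<in> {hd u}})"
      by (intro finite_imageI finite_prefixes[OF lc]) simp
    ultimately show ?thesis by (rule finite_subset)
  qed
  moreover have "disjoint \<C>"
    unfolding disjoint_def
  proof (intro ballI impI)
    fix D D' assume "D \<in> \<C>" "D' \<in> \<C>" "D \<noteq> D'"
    then obtain x y where xy: "D = cyl A (map x [0..<n])" "D' = cyl A (map y [0..<n])" "D \<noteq> D'"
      unfolding \<C>_def by blast
    show "D \<inter> D' = {}"
    proof (rule ccontr)
      assume "D \<inter> D' \<noteq> {}"
      then obtain z where z: "z \<in> D" "z \<in> D'" by blast
      have "D = cyl A (map z [0..<n])" "D' = cyl A (map z [0..<n])"
        using cyl_eq_prefix[of z A "map x [0..<n]"] cyl_eq_prefix[of z A "map y [0..<n]"] z xy by simp_all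
      with xy show False by simp
    qed
  qed
  moreover have "S - S' = \<Union>\<C>"
  proof
    show "S - S' \<subseteq> \<Union>\<C>"
      unfolding \<C>_def using u(1) cyl_subset[of A u] prefix_in_cyl[of _ A n] by blast
    show "\<Union>\<C> \<subseteq> S - S'" unfolding \<C>_def using sub by blast
  qed
  ultimately show "\<exists>C\<subseteq>nonempty_cyls A. finite C \<and> disjoint C \<and> S - S' = \<Union>C" by blast
qed

section \<open>Measures on the shift space\<close>

text \<open>Serves only as a measurable space, the common domain for measurability statements about
  all measures that occur.\<close>

definition tms_M :: "('s \<Rightarrow> 's \<Rightarrow> bool) \<Rightarrow> (nat \<Rightarrow> 's) measure" where
  "tms_M A = sigma (tms A) (nonempty_cyls A)"

lemma space_tms_M [simp]: "space (tms_M A) = tms A"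
  by (simp add: tms_M_def space_measure_of_conv)

lemma sets_tms_M:
  fixes A :: "'s::countable \<Rightarrow> 's \<Rightarrow> bool"
  shows "sets (tms_M A) = tms_sets A"
  using nonempty_cyls_subset[of A] by (simp add: tms_M_def tms_sets_eq_cyls)

lemma tms_sets_sigma_algebra: "sigma_algebra (tms A) (tms_sets A)"
  unfolding tms_sets_def using openin_tms_top by (intro sigma_algebra_sigma_sets) blast

lemma openin_tms_sets: "openin (tms_top A) U \<Longrightarrow> U \<in> tms_sets A"
  unfolding tms_sets_def by (rule sigma_sets.Basic) simp

lemma cyl_tms_sets [simp]: "cyl A w \<in> tms_sets A"
  by (rule openin_tms_sets[OF openin_cyl])

lemma first_symbol_tms_sets [simp]: "{x \<in> tms A. P (x 0)} \<in> tms_sets A"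
  by (rule openin_tms_sets[OF openin_first_symbol])

lemma closedin_tms_sets:
  assumes "closedin (tms_top A) S" shows "S \<in> tms_sets A"
proof -
  interpret sigma_algebra "tms A" "tms_sets A" by (rule tms_sets_sigma_algebra)
  have "tms A - S \<in> tms_sets A" "S \<subseteq> tms A"
    using assms by (auto simp: closedin_def intro: openin_tms_sets)
  then show ?thesis using compl_sets[of "tms A - S"] by (simp add: double_diff)
qed

lemma compactin_tms_sets: "compactin (tms_top A) K \<Longrightarrow> K \<in> tms_sets A"
  by (intro closedin_tms_sets compactin_imp_closedin Hausdorff_tms_top)

lemma measurable_coord [measurable]:
  fixes A :: "'s::countable \<Rightarrow> 's \<Rightarrow> bool"
  shows "(\<lambda>x. x i) \<in> tms_M A \<rightarrow>\<^sub>M count_space UNIV"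
proof -
  have "{x \<in> tms A. x i = s} \<in> tms_sets A" for s
  proof -
    have "{x \<in> tms A. x i = s} = (\<Union>w\<in>{w. length w = Suc i \<and> w ! i = s}. cyl A w)"
    proof
      show "{x \<in> tms A. x i = s} \<subseteq> (\<Union>w\<in>{w. length w = Suc i \<and> w ! i = s}. cyl A w)"
      proof
        fix x assume "x \<in> {x \<in> tms A. x i = s}"
        then show "x \<in> (\<Union>w\<in>{w. length w = Suc i \<and> w ! i = s}. cyl A w)"
          by (intro UN_I[of "map x [0..<Suc i]"]) (auto simp: prefix_in_cyl nth_append simp del: upt_Suc)
      qed
    qed (auto simp: cyl_def)
    also have "openin (tms_top A) \<dots>" using openin_cyl by (intro openin_Union) auto
    finally show ?thesis by (rule openin_tms_sets)
  qed
  moreover have "(\<lambda>x. x i) -` {s} \<inter> space (tms_M A) = {x \<in> tms A. x i = s}" for s by auto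
  ultimately show ?thesis
    by (subst measurable_count_space_eq2_countable) (auto simp: sets_tms_M)
qed

lemma measurable_into_tms_M:
  fixes A :: "'s::countable \<Rightarrow> 's \<Rightarrow> bool"
  assumes "\<And>x. x \<in> space N \<Longrightarrow> f x \<in> tms A"
    and [measurable]: "\<And>i. (\<lambda>x. f x i) \<in> N \<rightarrow>\<^sub>M count_space UNIV"
  shows "f \<in> N \<rightarrow>\<^sub>M tms_M A"
  unfolding tms_M_def
proof (rule measurable_measure_of)
  fix S assume "S \<in> nonempty_cyls A"
  then obtain w where w: "S = cyl A w" by (auto simp: nonempty_cyls_def)
  have "f -` S \<inter> space N = {x \<in> space N. \<forall>i\<in>{..<length w}. f x i = w ! i}"
    using assms(1) by (auto simp: w cyl_def)
  also have "\<dots> \<in> sets N" by measurable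
  finally show "f -` S \<inter> space N \<in> sets N" .
qed (use assms(1) nonempty_cyls_subset in auto)

lemma measurable_shift [measurable]:
  fixes A :: "'s::countable \<Rightarrow> 's \<Rightarrow> bool"
  shows "shift \<in> tms_M A \<rightarrow>\<^sub>M tms_M A"
  by (rule measurable_into_tms_M) (simp_all add: shift_tms, simp add: shift_def)

lemma measurable_funpow_shift [measurable]:
  fixes A :: "'s::countable \<Rightarrow> 's \<Rightarrow> bool"
  shows "(shift ^^ n) \<in> tms_M A \<rightarrow>\<^sub>M tms_M A"
proof (rule measurable_into_tms_M)
  show "(shift ^^ n) x \<in> tms A" if "x \<in> space (tms_M A)" for x
    using that by (simp add: funpow_shift_tms)
  show "(\<lambda>x. (shift ^^ n) x i) \<in> tms_M A \<rightarrow>\<^sub>M count_space UNIV" for i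
    unfolding funpow_shift by (rule measurable_coord)
qed

lemma continuous_imp_measurable:
  fixes A :: "'s::countable \<Rightarrow> 's \<Rightarrow> bool" and f :: "_ \<Rightarrow> real"
  assumes "continuous_map (tms_top A) euclideanreal f"
  shows "f \<in> borel_measurable (tms_M A)"
proof (rule borel_measurableI)
  fix S :: "real set" assume "open S"
  have "f -` S \<inter> space (tms_M A) = {x \<in> topspace (tms_top A). f x \<in> S}" by auto
  also have "openin (tms_top A) \<dots>"
    using \<open>open S\<close> by (intro openin_continuous_map_preimage[OF assms]) auto
  finally show "f -` S \<inter> space (tms_M A) \<in> sets (tms_M A)"
    by (simp add: sets_tms_M openin_tms_sets)
qed

text \<open>Cylinders are an intersection-stable generator, and the one-letter ones cover the space
  by countably many sets of finite measure.\<close>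

lemma measure_eq_tms_on_cyls:
  fixes A :: "'s::countable \<Rightarrow> 's \<Rightarrow> bool"
  assumes empty: "{} \<in> nonempty_cyls A"
    and sets: "sets \<mu> = tms_sets A" "sets \<nu> = tms_sets A"
    and eq: "\<And>w. w \<in> admissible_words A \<Longrightarrow> emeasure \<mu> (cyl A w) = emeasure \<nu> (cyl A w)"
    and fin: "\<And>a. emeasure \<mu> (cyl A [a]) < \<infinity>"
  shows "\<mu> = \<nu>"
proof (rule measure_eqI_generator_eq_countable[where \<Omega> = "tms A" and E = "nonempty_cyls A"
      and A = "range (\<lambda>a. cyl A [a])"])
  show "Int_stable (nonempty_cyls A)" by (rule Int_stable_nonempty_cyls[OF empty])
  show "emeasure \<mu> S = emeasure \<nu> S" if "S \<in> nonempty_cyls A" for S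
  proof (cases "S = {}")
    case False
    then show ?thesis using that eq by (auto simp: nonempty_cyls_def admissible_words_def)
  qed simp
  show "sets \<mu> = sigma_sets (tms A) (nonempty_cyls A)" "sets \<nu> = sigma_sets (tms A) (nonempty_cyls A)"
    using sets tms_sets_eq_cyls by auto
  show "range (\<lambda>a. cyl A [a]) \<subseteq> nonempty_cyls A" by (auto simp: nonempty_cyls_def)
  show "(\<Union>(range (\<lambda>a. cyl A [a]))) = tms A" by (auto simp: cyl_single)
  show "emeasure \<mu> S \<noteq> \<infinity>" if "S \<in> range (\<lambda>a. cyl A [a])" for S
    using that fin less_top by auto
qed (use nonempty_cyls_subset in auto)

section \<open>Exhaustion by compact sets and regularity of measures\<close>

text \<open>An increasing exhaustion that, under local compactness, consists of compact sets. Every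
  compact set lies in some window, so leaving all windows means escaping to infinity.\<close>

definition window :: "('s::countable \<Rightarrow> 's \<Rightarrow> bool) \<Rightarrow> nat \<Rightarrow> (nat \<Rightarrow> 's) set" where
  "window A N = {x \<in> tms A. to_nat (x 0) < N}"

lemma window_eq: "window A N = {x \<in> tms A. x 0 \<in> {s. to_nat s < N}}"
  by (simp add: window_def)

lemma finite_to_nat_less [simp]: "finite {s :: 's::countable. to_nat s < N}"
  by (rule finite_imageD[of to_nat]) (auto intro: finite_subset[of _ "{..<N}"] inj_onI)

lemma compactin_window: "locally_compact_tms A \<Longrightarrow> compactin (tms_top A) (window A N)"
  unfolding window_eq by (rule compactin_first_symbol[OF _ finite_to_nat_less])

lemma window_tms_sets [simp]: "window A N \<in> tms_sets A"
  unfolding window_def by (rule first_symbol_tms_sets)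

lemma window_mono: "N \<le> N' \<Longrightarrow> window A N \<subseteq> window A N'"
  by (auto simp: window_def)

lemma Union_window: "(\<Union>N. window A N) = tms A"
  by (auto simp: window_def)

lemma compactin_subset_window:
  assumes "compactin (tms_top A) K" obtains N where "K \<subseteq> window A N"
proof -
  obtain F where F: "finite F" "K \<subseteq> {x \<in> tms A. x 0 \<in> F}"
    using compactin_imp_finite_first_symbols[OF assms] by blast
  have "to_nat a < Suc (Max (insert 0 (to_nat ` F)))" if "a \<in> F" for a
    using F(1) that by (intro le_imp_less_Suc Max_ge) auto
  then have "K \<subseteq> window A (Suc (Max (insert 0 (to_nat ` F))))"
    using F(2) unfolding window_def by blast
  then show thesis by (rule that)
qed

lemma window_eq_Union: "window A N = (\<Union>a\<in>{s. to_nat s < N}. cyl A [a])"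
  by (auto simp: window_def cyl_single)

lemma emeasure_window_finite:
  assumes sets: "sets \<mu> = tms_sets A" and fin: "\<And>a. emeasure \<mu> (cyl A [a]) < \<infinity>"
  shows "emeasure \<mu> (window A N) < \<infinity>"
proof -
  have "emeasure \<mu> (window A N) \<le> (\<Sum>a\<in>{s. to_nat s < N}. emeasure \<mu> (cyl A [a]))"
    unfolding window_eq_Union using finite_to_nat_less
    by (intro emeasure_subadditive_finite) (auto simp: sets)
  also have "\<dots> < \<infinity>" using fin by (simp add: less_top)
  finally show ?thesis .
qed

text \<open>Cylinders are both closed and open, and for a finite measure the sets with such an
  approximation form a sigma-algebra.\<close>

lemma closed_open_approx:
  fixes A :: "'s::countable \<Rightarrow> 's \<Rightarrow> bool"
  assumes sets: "sets \<mu> = tms_sets A" and fin: "finite_measure \<mu>"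
    and B: "B \<in> tms_sets A" and e: "e > 0"
  shows "\<exists>F U. closedin (tms_top A) F \<and> openin (tms_top A) U \<and> F \<subseteq> B \<and> B \<subseteq> U \<and> measure \<mu> (U - F) < e"
  using B[unfolded tms_sets_eq_cyls] e
proof (induction arbitrary: e)
  case (Basic S)
  then show ?case
    by (intro exI[of _ S]) (auto simp: nonempty_cyls_def closedin_cyl openin_cyl)
next
  case Empty
  then show ?case by (intro exI[of _ "{}"]) auto
next
  case (Compl S)
  obtain F U where FU: "closedin (tms_top A) F" "openin (tms_top A) U" "F \<subseteq> S" "S \<subseteq> U" "measure \<mu> (U - F) < e"
    using Compl.IH[OF Compl.prems] by blast
  have "closedin (tms_top A) (tms A - U)" "openin (tms_top A) (tms A - F)"
    using FU(1,2) by (auto simp: closedin_def double_diff openin_subset)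
      (metis double_diff openin_subset order_refl topspace_tms_top)+
  moreover have "(tms A - F) - (tms A - U) = U - F"
    using openin_subset[OF FU(2)] by auto
  ultimately show ?case
    using FU by (intro exI[of _ "tms A - U"] exI[of _ "tms A - F"]) auto
next
  case (Union a)
  interpret finite_measure \<mu> by (rule fin)
  have sp: "space \<mu> = tms A"
    using sets_eq_imp_space_eq[of \<mu> "tms_M A"] sets by (simp add: sets_tms_M)
  \<comment> \<open>These errors add up to \<open>e/2\<close>. The remaining \<open>e/2\<close> pays
    for truncating the union of the closed sets, which need not be closed, to a finite
    union.\<close>
  have "\<exists>F U. closedin (tms_top A) F \<and> openin (tms_top A) U \<and> F \<subseteq> a i \<and> a i \<subseteq> U \<and>
      measure \<mu> (U - F) < (e/2) * (1/2)^Suc i" for i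
    using Union.IH[of "(e/2) * (1/2)^Suc i" i] Union.prems by simp
  then obtain F U where F: "\<And>i. closedin (tms_top A) (F i)" and U: "\<And>i. openin (tms_top A) (U i)"
    and sub: "\<And>i. F i \<subseteq> a i" "\<And>i. a i \<subseteq> U i"
    and m: "\<And>i. measure \<mu> (U i - F i) < (e/2) * (1/2)^Suc i"
    by metis
  have meas: "F i \<in> sets \<mu>" "U i \<in> sets \<mu>" for i
    using F U by (auto simp: sets closedin_tms_sets openin_tms_sets)
  let ?G = "\<lambda>n. \<Union>i<n. F i" and ?V = "\<Union>i. U i"
  have UNF: "measure \<mu> (?V - (\<Union>i. F i)) \<le> e/2"
  proof -
    have sm: "summable (\<lambda>i. (e/2) * (1/2::real)^Suc i)" "(\<Sum>i. (e/2) * (1/2::real)^Suc i) = e/2"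
      using sums_mult[OF power_half_series, of "e/2"] by (auto simp: sums_iff)
    have s: "summable (\<lambda>i. measure \<mu> (U i - F i))"
    proof (rule summable_comparison_test'[OF sm(1), of 0])
      show "norm (measure \<mu> (U i - F i)) \<le> (e/2) * (1/2)^Suc i" for i
        using less_imp_le[OF m[of i]] by (simp only: real_norm_def abs_of_nonneg[OF measure_nonneg])
    qed
    have "measure \<mu> (?V - (\<Union>i. F i)) \<le> measure \<mu> (\<Union>i. U i - F i)"
      using meas by (intro finite_measure_mono) auto
    also have "\<dots> \<le> (\<Sum>i. measure \<mu> (U i - F i))"
      using meas by (intro finite_measure_subadditive_countably s) auto
    also have "\<dots> \<le> (\<Sum>i. (e/2) * (1/2::real)^Suc i)"
      by (intro suminf_le less_imp_le[OF m] s sm)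
    finally show ?thesis using sm by simp
  qed
  have "(\<lambda>n. measure \<mu> (?V - ?G n)) \<longlonglongrightarrow> measure \<mu> (\<Inter>n. ?V - ?G n)"
    using meas by (intro finite_Lim_measure_decseq) (auto simp: decseq_def)
  moreover have "(\<Inter>n. ?V - ?G n) = ?V - (\<Union>i. F i)" by auto
  ultimately have "\<forall>\<^sub>F n in sequentially. measure \<mu> (?V - ?G n) < e"
    using UNF Union.prems by (intro order_tendstoD(2)[of _ "measure \<mu> (?V - (\<Union>i. F i))"]) auto
  then obtain n where n: "measure \<mu> (?V - ?G n) < e" by (auto simp: eventually_sequentially)
  have "closedin (tms_top A) (?G n)" using F by (intro closedin_Union) auto
  moreover have "openin (tms_top A) ?V" using U by (intro openin_Union) auto
  moreover have "?G n \<subseteq> (\<Union>i. a i)" "(\<Union>i. a i) \<subseteq> ?V" using sub by blast+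
  ultimately show ?case using n by (intro exI[of _ "?G n"] exI[of _ ?V]) simp
qed

text \<open>Inside a window the measure is finite, and a closed set cut down to a window is compact.
  Closed inner approximation thus becomes compact inner approximation, and the windows exhaust the
  space.\<close>

lemma radon_measureI:
  fixes A :: "'s::countable \<Rightarrow> 's \<Rightarrow> bool"
  assumes lc: "locally_compact_tms A"
    and sets: "sets \<mu> = tms_sets A" and fin: "\<And>a. emeasure \<mu> (cyl A [a]) < \<infinity>"
  shows "radon_measure A \<mu>"
proof -
  have sp: "space \<mu> = tms A"
    using sets_eq_imp_space_eq[of \<mu> "tms_M A"] sets by (simp add: sets_tms_M)
  have finK: "emeasure \<mu> K < \<infinity>" if K: "compactin (tms_top A) K" for K
  proof -
    obtain N where "K \<subseteq> window A N" by (rule compactin_subset_window[OF K])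
    then have "emeasure \<mu> K \<le> emeasure \<mu> (window A N)"
      by (intro emeasure_mono) (auto simp: sets)
    then show ?thesis using emeasure_window_finite[OF sets fin, of N] by (rule le_less_trans)
  qed
  have "emeasure \<mu> B = Sup {emeasure \<mu> K | K. compactin (tms_top A) K \<and> K \<subseteq> B}" (is "_ = Sup ?S")
    if B: "B \<in> tms_sets A" for B
  proof (rule antisym)
    have win: "emeasure \<mu> (B \<inter> window A N) \<le> Sup ?S" for N
    proof (rule ennreal_le_epsilon)
      fix e :: real assume "e > 0"
      define \<nu> where "\<nu> = density \<mu> (indicator (window A N))"
      have \<nu>: "emeasure \<nu> C = emeasure \<mu> (window A N \<inter> C)" if "C \<in> tms_sets A" for C
        using that unfolding \<nu>_def by (intro emeasure_restricted) (simp_all add: sets)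
      have s\<nu>: "sets \<nu> = tms_sets A" "space \<nu> = tms A" by (simp_all add: \<nu>_def sets sp)
      interpret \<nu>: finite_measure \<nu>
      proof
        have "tms A \<in> tms_sets A" by (metis sets sets.top sp)
        moreover have "window A N \<inter> tms A = window A N" by (auto simp: window_def)
        ultimately show "emeasure \<nu> (space \<nu>) \<noteq> \<infinity>"
          using emeasure_window_finite[OF sets fin, of N] by (simp add: s\<nu> \<nu>)
      qed
      obtain F U where FU: "closedin (tms_top A) F" "openin (tms_top A) U" "F \<subseteq> B" "B \<subseteq> U" "measure \<nu> (U - F) < e"
        using closed_open_approx[OF s\<nu>(1) \<nu>.finite_measure_axioms B \<open>e > 0\<close>] by blast
      have mF: "F \<in> sets \<nu>" "U \<in> sets \<nu>" "B \<in> sets \<nu>"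
        using FU B by (auto simp: s\<nu> closedin_tms_sets openin_tms_sets)
      have "emeasure \<mu> (B \<inter> window A N) = emeasure \<nu> B"
        using B by (simp add: \<nu> Int_commute)
      also have "\<dots> \<le> emeasure \<nu> (F \<union> (U - F))"
        using FU mF by (intro emeasure_mono) auto
      also have "\<dots> \<le> emeasure \<nu> F + emeasure \<nu> (U - F)"
        using mF by (intro emeasure_subadditive) auto
      also have "emeasure \<nu> (U - F) \<le> ennreal e"
        using FU(5) by (simp add: \<nu>.emeasure_eq_measure ennreal_leI)
      also have "emeasure \<nu> F = emeasure \<mu> (window A N \<inter> F)"
        using mF s\<nu> by (simp add: \<nu>)
      also have "\<dots> \<le> Sup ?S"
      proof (rule Sup_upper)
        have "compactin (tms_top A) (window A N \<inter> F)"
          by (rule compact_Int_closedin[OF compactin_window[OF lc] FU(1)])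
        then show "emeasure \<mu> (window A N \<inter> F) \<in> ?S" using FU(3) by blast
      qed
      finally show "emeasure \<mu> (B \<inter> window A N) \<le> Sup ?S + ennreal e"
        by (simp add: add_left_mono add_right_mono)
    qed
    have "emeasure \<mu> B = emeasure \<mu> (\<Union>N. B \<inter> window A N)"
      using B sets sp sets.sets_into_space[of B \<mu>] Union_window[of A]
      by (intro arg_cong[of _ _ "emeasure \<mu>"]) auto
    also have "\<dots> = (SUP N. emeasure \<mu> (B \<inter> window A N))"
    proof (intro SUP_emeasure_incseq[symmetric])
      have "B \<inter> window A N \<in> sets \<mu>" for N
        using B by (intro sets.Int) (simp_all add: sets)
      then show "range (\<lambda>N. B \<inter> window A N) \<subseteq> sets \<mu>" by blast
      show "incseq (\<lambda>N. B \<inter> window A N)" using window_mono[of _ _ A] by (fastforce simp: incseq_def)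
    qed
    also have "\<dots> \<le> Sup ?S" by (intro SUP_least win)
    finally show "emeasure \<mu> B \<le> Sup ?S" .
    show "Sup ?S \<le> emeasure \<mu> B"
      using B by (intro Sup_least) (auto simp: sets intro!: emeasure_mono)
  qed
  then show ?thesis
    unfolding radon_measure_def using sp finK sets by (simp add: tms_sets_def)
qed

lemma radon_measureD:
  assumes "radon_measure A \<mu>"
  shows "sets \<mu> = tms_sets A" "space \<mu> = tms A"
    "locally_compact_tms A \<Longrightarrow> emeasure \<mu> (cyl A [a]) < \<infinity>"
    "compactin (tms_top A) K \<Longrightarrow> emeasure \<mu> K < \<infinity>"
  using assms compactin_cyl[of A "[a]"] unfolding radon_measure_def tms_sets_def by auto

section \<open>The Ruelle operator and Green's function\<close>

text \<open>This property makes the sum in \<open>ruelle\<close> finite and is preserved by the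
  operator. The bound added in \<open>bdd_fin_supp\<close> lets Green's function be dominated by
  those of finitely many one-letter cylinders.\<close>

definition fin_supp :: "('s \<Rightarrow> 's \<Rightarrow> bool) \<Rightarrow> ((nat \<Rightarrow> 's) \<Rightarrow> real) \<Rightarrow> bool" where
  "fin_supp A f \<longleftrightarrow> (\<exists>F. finite F \<and> (\<forall>x\<in>tms A. f x \<noteq> 0 \<longrightarrow> x 0 \<in> F))"

definition bdd_fin_supp :: "('s \<Rightarrow> 's \<Rightarrow> bool) \<Rightarrow> ((nat \<Rightarrow> 's) \<Rightarrow> real) \<Rightarrow> bool" where
  "bdd_fin_supp A f \<longleftrightarrow> (\<exists>F M. finite F \<and> (\<forall>x\<in>tms A. \<bar>f x\<bar> \<le> M * indicator F (x 0)))"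

lemma bdd_fin_supp_imp: "bdd_fin_supp A f \<Longrightarrow> fin_supp A f"
  unfolding bdd_fin_supp_def fin_supp_def by (force simp: indicator_def)

lemma bdd_fin_supp_cyl:
  assumes "w \<noteq> []" shows "bdd_fin_supp A (indicator (cyl A w))"
  unfolding bdd_fin_supp_def
proof (intro exI conjI ballI)
  show "finite {w ! 0}" by simp
  fix x
  show "\<bar>indicator (cyl A w) x :: real\<bar> \<le> 1 * indicator {w ! 0} (x 0)"
    using assms by (auto simp: cyl_def indicator_def)
qed

lemma bdd_fin_supp_lin:
  assumes "bdd_fin_supp A f" "bdd_fin_supp A g"
  shows "bdd_fin_supp A (\<lambda>x. c * f x + d * g x)"
proof -
  obtain F M G N where F: "finite F" "\<And>x. x \<in> tms A \<Longrightarrow> \<bar>f x\<bar> \<le> M * indicator F (x 0)"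
    and G: "finite G" "\<And>x. x \<in> tms A \<Longrightarrow> \<bar>g x\<bar> \<le> N * indicator G (x 0)"
    using assms unfolding bdd_fin_supp_def by meson
  have "\<bar>c * f x + d * g x\<bar> \<le> (\<bar>c\<bar> * \<bar>M\<bar> + \<bar>d\<bar> * \<bar>N\<bar>) * indicator (F \<union> G) (x 0)" if "x \<in> tms A" for x
  proof -
    have "M * indicator F (x 0) \<le> \<bar>M\<bar> * indicator (F \<union> G) (x 0)"
      "N * indicator G (x 0) \<le> \<bar>N\<bar> * indicator (F \<union> G) (x 0)"
      by (cases "x 0 \<in> F"; cases "x 0 \<in> G"; simp)+
    then have "\<bar>f x\<bar> \<le> \<bar>M\<bar> * indicator (F \<union> G) (x 0)" "\<bar>g x\<bar> \<le> \<bar>N\<bar> * indicator (F \<union> G) (x 0)"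
      using F(2)[OF that] G(2)[OF that] by linarith+
    then have "\<bar>c\<bar> * \<bar>f x\<bar> + \<bar>d\<bar> * \<bar>g x\<bar>
        \<le> \<bar>c\<bar> * (\<bar>M\<bar> * indicator (F \<union> G) (x 0)) + \<bar>d\<bar> * (\<bar>N\<bar> * indicator (F \<union> G) (x 0))"
      by (intro add_mono mult_left_mono) auto
    moreover have "\<bar>c * f x + d * g x\<bar> \<le> \<bar>c\<bar> * \<bar>f x\<bar> + \<bar>d\<bar> * \<bar>g x\<bar>"
      by (metis abs_mult abs_triangle_ineq)
    ultimately show ?thesis by (simp add: algebra_simps)
  qed
  then show ?thesis using F(1) G(1) unfolding bdd_fin_supp_def by blast
qed

lemma bdd_fin_supp_sum:
  assumes "\<And>i. i \<in> I \<Longrightarrow> bdd_fin_supp A (f i)"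
  shows "bdd_fin_supp A (\<lambda>x. \<Sum>i\<in>I. c i * f i x)"
proof (cases "finite I")
  case True
  then show ?thesis using assms
  proof induction
    case empty
    then show ?case by (auto simp: bdd_fin_supp_def intro!: exI[of _ "{}"])
  next
    case (insert i I)
    then show ?case using bdd_fin_supp_lin[of A "f i" "\<lambda>x. \<Sum>i\<in>I. c i * f i x" "c i" 1] by simp
  qed
qed (auto simp: bdd_fin_supp_def intro!: exI[of _ "{}"])

lemma preimages_eq:
  assumes "x \<in> tms A"
  shows "{y \<in> tms A. shift y = x} = (\<lambda>a. case_nat a x) ` {a. A a (x 0)}"
proof
  show "{y \<in> tms A. shift y = x} \<subseteq> (\<lambda>a. case_nat a x) ` {a. A a (x 0)}"
  proof clarify
    fix y assume y: "y \<in> tms A" "x = shift y"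
    then have "A (y 0) (shift y 0)" by (auto simp: tms_def shift_def)
    then show "y \<in> (\<lambda>a. case_nat a (shift y)) ` {a. A a (shift y 0)}"
      using case_nat_shift[of y] by (metis imageI mem_Collect_eq)
  qed
qed (use assms in \<open>auto simp: case_nat_tms shift_case_nat\<close>)

lemma ruelle_cong:
  assumes "\<And>y. y \<in> tms A \<Longrightarrow> f y = g y" shows "ruelle A \<phi> f = ruelle A \<phi> g"
  unfolding ruelle_def using assms by (intro ext infsum_cong) auto

text \<open>The preimages of \<open>x\<close> are the points \<open>case_nat a x\<close> with an
  allowed transition, and only letters \<open>a \<in> F\<close> can contribute.\<close>

lemma ruelle_eq:
  assumes F: "finite F" and f: "\<forall>y\<in>tms A. f y \<noteq> 0 \<longrightarrow> y 0 \<in> F" and x: "x \<in> tms A"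
  shows "ruelle A \<phi> f x =
    (\<Sum>a\<in>F. if A a (x 0) then exp (\<phi> (case_nat a x)) * f (case_nat a x) else 0)"
proof -
  let ?F = "{a \<in> F. A a (x 0)}"
  have inj: "inj_on (\<lambda>a. case_nat a x) ?F"
    by (rule inj_onI) (metis nat.case(1))
  have "ruelle A \<phi> f x = (\<Sum>\<^sub>\<infinity>y\<in>(\<lambda>a. case_nat a x) ` ?F. exp (\<phi> y) * f y)"
    unfolding ruelle_def preimages_eq[OF x]
  proof (rule infsum_cong_neutral)
    fix y assume y: "y \<in> (\<lambda>a. case_nat a x) ` {a. A a (x 0)} - (\<lambda>a. case_nat a x) ` ?F"
    then obtain a where a: "y = case_nat a x" "A a (x 0)" by blast
    with y have "a \<notin> F" by blast
    moreover have "y \<in> tms A" using a x by (simp add: case_nat_tms)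
    ultimately have "f y = 0" using f a by fastforce
    then show "exp (\<phi> y) * f y = 0" by simp
  qed auto
  also have "\<dots> = (\<Sum>a\<in>?F. exp (\<phi> (case_nat a x)) * f (case_nat a x))"
    using F by (simp add: sum.reindex[OF inj])
  also have "\<dots> = (\<Sum>a\<in>F. if A a (x 0) then exp (\<phi> (case_nat a x)) * f (case_nat a x) else 0)"
    using F by (simp add: sum.inter_filter)
  finally show ?thesis .
qed

lemma fin_supp_common:
  assumes "fin_supp A f" "fin_supp A g"
  obtains F where "finite F" "\<forall>y\<in>tms A. f y \<noteq> 0 \<longrightarrow> y 0 \<in> F" "\<forall>y\<in>tms A. g y \<noteq> 0 \<longrightarrow> y 0 \<in> F"
proof -
  obtain F G where F: "finite F" "\<forall>x\<in>tms A. f x \<noteq> 0 \<longrightarrow> x 0 \<in> F"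
    and G: "finite G" "\<forall>x\<in>tms A. g x \<noteq> 0 \<longrightarrow> x 0 \<in> G"
    using assms unfolding fin_supp_def by meson
  show thesis by (rule that[of "F \<union> G"]) (use F G in auto)
qed

lemma ruelle_lin:
  assumes "fin_supp A f" "fin_supp A g" and x: "x \<in> tms A"
  shows "ruelle A \<phi> (\<lambda>x. c * f x + d * g x) x = c * ruelle A \<phi> f x + d * ruelle A \<phi> g x"
proof -
  obtain F where F: "finite F" "\<forall>y\<in>tms A. f y \<noteq> 0 \<longrightarrow> y 0 \<in> F" "\<forall>y\<in>tms A. g y \<noteq> 0 \<longrightarrow> y 0 \<in> F"
    using fin_supp_common[OF assms(1,2)] .
  have lin: "\<forall>y\<in>tms A. c * f y + d * g y \<noteq> 0 \<longrightarrow> y 0 \<in> F" using F(2,3) by force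
  show ?thesis
    unfolding ruelle_eq[OF F(1,2) x] ruelle_eq[OF F(1,3) x] ruelle_eq[OF F(1) lin x]
      sum_distrib_left sum.distrib[symmetric]
    by (intro sum.cong) (auto simp: algebra_simps)
qed

lemma ruelle_mono:
  assumes "fin_supp A f" "fin_supp A g" and x: "x \<in> tms A"
    and le: "\<And>y. y \<in> tms A \<Longrightarrow> f y \<le> g y"
  shows "ruelle A \<phi> f x \<le> ruelle A \<phi> g x"
proof -
  obtain F where F: "finite F" "\<forall>y\<in>tms A. f y \<noteq> 0 \<longrightarrow> y 0 \<in> F" "\<forall>y\<in>tms A. g y \<noteq> 0 \<longrightarrow> y 0 \<in> F"
    using fin_supp_common[OF assms(1,2)] .
  show ?thesis
    unfolding ruelle_eq[OF F(1,2) x] ruelle_eq[OF F(1,3) x]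
    using le x by (intro sum_mono) (simp add: case_nat_tms)
qed

lemma ruelle_zero: "ruelle A \<phi> (\<lambda>_. 0) x = 0"
  by (simp add: ruelle_def)

text \<open>A nonzero value at \<open>x\<close> requires a transition from some letter of
  \<open>F\<close> to \<open>x 0\<close>, and \<open>F\<close> has finitely many successors.\<close>

lemma fin_supp_ruelle:
  assumes lc: "locally_compact_tms A" and "fin_supp A f"
  shows "fin_supp A (ruelle A \<phi> f)"
proof -
  obtain F where F: "finite F" "\<forall>x\<in>tms A. f x \<noteq> 0 \<longrightarrow> x 0 \<in> F"
    using assms unfolding fin_supp_def by meson
  have "x 0 \<in> (\<Union>a\<in>F. {b. A a b})" if x: "x \<in> tms A" and nz: "ruelle A \<phi> f x \<noteq> 0" for x
  proof -
    have "\<exists>a\<in>F. (if A a (x 0) then exp (\<phi> (case_nat a x)) * f (case_nat a x) else 0) \<noteq> 0"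
      using nz unfolding ruelle_eq[OF F x] by (elim sum.not_neutral_contains_not_neutral) (rule bexI)
    then show ?thesis by (auto split: if_splits)
  qed
  moreover have "finite (\<Union>a\<in>F. {b. A a b})" using F(1) lc by (auto simp: locally_compact_tms_def)
  ultimately show ?thesis unfolding fin_supp_def by blast
qed

lemma funpow_ruelle_fin_supp:
  "locally_compact_tms A \<Longrightarrow> fin_supp A f \<Longrightarrow> fin_supp A ((ruelle A \<phi> ^^ n) f)"
  by (induction n) (simp_all add: fin_supp_ruelle)

lemma funpow_ruelle_cong:
  assumes "\<And>y. y \<in> tms A \<Longrightarrow> f y = g y" "x \<in> tms A"
  shows "(ruelle A \<phi> ^^ n) f x = (ruelle A \<phi> ^^ n) g x"
  using assms(2)
proof (induction n arbitrary: x)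
  case (Suc n)
  then have "ruelle A \<phi> ((ruelle A \<phi> ^^ n) f) = ruelle A \<phi> ((ruelle A \<phi> ^^ n) g)"
    by (intro ruelle_cong)
  then show ?case by simp
qed (simp add: assms(1))

lemma funpow_ruelle_lin:
  assumes lc: "locally_compact_tms A" and f: "fin_supp A f" and g: "fin_supp A g" and "x \<in> tms A"
  shows "(ruelle A \<phi> ^^ n) (\<lambda>x. c * f x + d * g x) x = c * (ruelle A \<phi> ^^ n) f x + d * (ruelle A \<phi> ^^ n) g x"
  using \<open>x \<in> tms A\<close>
proof (induction n arbitrary: x)
  case (Suc n)
  then have "ruelle A \<phi> ((ruelle A \<phi> ^^ n) (\<lambda>x. c * f x + d * g x))
      = ruelle A \<phi> (\<lambda>x. c * (ruelle A \<phi> ^^ n) f x + d * (ruelle A \<phi> ^^ n) g x)"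
    by (intro ruelle_cong)
  then show ?case
    using ruelle_lin[OF funpow_ruelle_fin_supp[OF lc f] funpow_ruelle_fin_supp[OF lc g] Suc.prems] by simp
qed simp

lemma funpow_ruelle_zero: "x \<in> tms A \<Longrightarrow> (ruelle A \<phi> ^^ n) (\<lambda>_. 0) x = 0"
proof (induction n arbitrary: x)
  case (Suc n)
  then have "ruelle A \<phi> ((ruelle A \<phi> ^^ n) (\<lambda>_. 0)) = ruelle A \<phi> (\<lambda>_. 0)"
    by (intro ruelle_cong)
  then show ?case by (simp add: ruelle_zero)
qed simp

lemma funpow_ruelle_mono:
  assumes lc: "locally_compact_tms A" and f: "fin_supp A f" and g: "fin_supp A g" and "x \<in> tms A"
    and le: "\<And>y. y \<in> tms A \<Longrightarrow> f y \<le> g y"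
  shows "(ruelle A \<phi> ^^ n) f x \<le> (ruelle A \<phi> ^^ n) g x"
  using \<open>x \<in> tms A\<close>
proof (induction n arbitrary: x)
  case (Suc n)
  then show ?case
    using ruelle_mono[OF funpow_ruelle_fin_supp[OF lc f] funpow_ruelle_fin_supp[OF lc g]] by simp
qed (simp add: le)

lemma fin_supp_zero: "fin_supp A (\<lambda>_. 0)"
  by (auto simp: fin_supp_def)

lemma funpow_ruelle_nonneg:
  assumes "locally_compact_tms A" "fin_supp A f" "x \<in> tms A" "\<And>y. y \<in> tms A \<Longrightarrow> 0 \<le> f y"
  shows "0 \<le> (ruelle A \<phi> ^^ n) f x"
  using funpow_ruelle_mono[OF assms(1) fin_supp_zero assms(2,3), where n = n] assms
  by (simp add: funpow_ruelle_zero)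

lemma funpow_ruelle_sum:
  assumes lc: "locally_compact_tms A" and f: "\<And>i. i \<in> I \<Longrightarrow> bdd_fin_supp A (f i)" and x: "x \<in> tms A"
    and "finite I"
  shows "(ruelle A \<phi> ^^ n) (\<lambda>x. \<Sum>i\<in>I. c i * f i x) x = (\<Sum>i\<in>I. c i * (ruelle A \<phi> ^^ n) (f i) x)"
  using \<open>finite I\<close> f
proof induction
  case (insert i I)
  have "(ruelle A \<phi> ^^ n) (\<lambda>x. \<Sum>i\<in>insert i I. c i * f i x) x
      = (ruelle A \<phi> ^^ n) (\<lambda>x. c i * f i x + 1 * (\<Sum>i\<in>I. c i * f i x)) x"
    using insert.hyps by simp
  also have "\<dots> = c i * (ruelle A \<phi> ^^ n) (f i) x + 1 * (ruelle A \<phi> ^^ n) (\<lambda>x. \<Sum>i\<in>I. c i * f i x) x"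
    using insert.prems by (intro funpow_ruelle_lin lc x bdd_fin_supp_imp bdd_fin_supp_sum) auto
  finally show ?case using insert by simp
qed (simp add: funpow_ruelle_zero x)

lemma Var_bound:
  assumes sv: "summable_variations A \<phi>"
  obtains V where "\<And>m. 0 \<le> V m" "summable (\<lambda>m. V (m + 2))"
    "\<And>m x y. m \<ge> 2 \<Longrightarrow> x \<in> tms A \<Longrightarrow> y \<in> tms A \<Longrightarrow> \<forall>i<m. x i = y i \<Longrightarrow> \<bar>\<phi> x - \<phi> y\<bar> \<le> V m"
proof -
  \<comment> \<open>\<open>enn2real\<close> turns an infinite variation into \<open>0\<close>, so
    \<open>V\<close> is reliable only from index 2 on, where summability forces finiteness.\<close>
  define V where "V m = enn2real (Var A \<phi> m)" for m
  have fin: "(\<Sum>m. Var A \<phi> (m + 2)) < \<infinity>" using sv by (simp add: summable_variations_def)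
  have V: "ennreal (V m) = Var A \<phi> m" if "m \<ge> 2" for m
  proof -
    have "Var A \<phi> (m - 2 + 2) \<le> (\<Sum>m. Var A \<phi> (m + 2))"
      using sum_le_suminf[of "\<lambda>m. Var A \<phi> (m + 2)" "{m - 2}"] by simp
    moreover have "m - 2 + 2 = m" using that by simp
    ultimately have "Var A \<phi> m < top" using fin by (metis le_less_trans infinity_ennreal_def)
    then show ?thesis by (simp add: V_def)
  qed
  show thesis
  proof (rule that)
    show "0 \<le> V m" for m by (simp add: V_def)
    show "summable (\<lambda>m. V (m + 2))"
      using fin by (intro summable_suminf_not_top) (simp_all add: V, simp add: V_def)
    fix m x y assume "2 \<le> m" "x \<in> tms A" "y \<in> tms A" "\<forall>i<m. x i = y i"
    then have "ennreal \<bar>\<phi> x - \<phi> y\<bar> \<le> ennreal (V m)"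
      unfolding V[OF \<open>2 \<le> m\<close>] Var_def by (intro Sup_upper) blast
    then show "\<bar>\<phi> x - \<phi> y\<bar> \<le> V m" by (simp add: V_def)
  qed
qed

section \<open>Green's function of a transient potential\<close>

locale transient_tms =
  fixes A :: "'s::countable \<Rightarrow> 's \<Rightarrow> bool" and \<phi> :: "(nat \<Rightarrow> 's) \<Rightarrow> real" and lam :: real
  assumes infinite_states: "infinite (UNIV :: 's set)"
    and transitive: "transitive_tms A"
    and lc: "locally_compact_tms A"
    and lam_pos: "lam > 0"
    and summable_var: "summable_variations A \<phi>"
    and transient: "transient_potential A \<phi> lam"
begin

abbreviation L :: "((nat \<Rightarrow> 's) \<Rightarrow> real) \<Rightarrow> (nat \<Rightarrow> 's) \<Rightarrow> real" where
  "L \<equiv> ruelle A \<phi>"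

lemma cyl_single_nonempty: "\<exists>x\<in>tms A. x 0 = a"
proof -
  obtain n x where "x \<in> (shift ^^ n) -` cyl A [a] \<inter> cyl A [a]"
    using transitive unfolding transitive_tms_def by blast
  then show ?thesis by (auto simp: cyl_single)
qed

lemma single_admissible: "[a] \<in> admissible_words A"
  using cyl_single_nonempty[of a] by (auto simp: admissible_words_def cyl_single)

lemma summable_single:
  assumes "x \<in> tms A" shows "summable (\<lambda>n. (L ^^ n) (indicator (cyl A [a])) x / lam ^ n)"
proof -
  have "indicator (cyl A [a]) \<in> Cc_nonneg A"
    using Cc_indicator_cyl[OF lc, of "[a]"] by (simp add: Cc_nonneg_def)
  moreover have "\<exists>x\<in>tms A. indicator (cyl A [a]) x \<noteq> (0::real)"
    using cyl_single_nonempty[of a] by (auto simp: cyl_single indicator_def)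
  ultimately show ?thesis
    using transient assms unfolding transient_potential_def by blast
qed

lemma summable_green_sum_single:
  assumes "finite F" "x \<in> tms A"
  shows "summable (\<lambda>n. (L ^^ n) (\<lambda>y. \<Sum>a\<in>F. M * indicator (cyl A [a]) y) x / lam ^ n)"
proof -
  have "summable (\<lambda>n. \<Sum>a\<in>F. M * ((L ^^ n) (indicator (cyl A [a])) x / lam ^ n))"
    by (intro summable_sum summable_mult summable_single assms)
  then show ?thesis
    using assms funpow_ruelle_sum[OF lc, of F "\<lambda>a. indicator (cyl A [a])" x _ \<phi> "\<lambda>_. M"]
    by (simp add: bdd_fin_supp_cyl sum_divide_distrib)
qed

text \<open>A multiple of finitely many one-letter indicators dominates
  \<open>\<bar>f\<bar>\<close>, and transience applies to each of these.\<close>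

lemma summable_green:
  assumes f: "bdd_fin_supp A f" and x: "x \<in> tms A"
  shows "summable (\<lambda>n. (L ^^ n) f x / lam ^ n)"
proof -
  obtain F M where F: "finite F" "\<And>x. x \<in> tms A \<Longrightarrow> \<bar>f x\<bar> \<le> M * indicator F (x 0)"
    using f unfolding bdd_fin_supp_def by meson
  let ?g = "\<lambda>y. \<Sum>a\<in>F. M * indicator (cyl A [a]) y"
  have g: "?g y = M * indicator F (y 0)" if "y \<in> tms A" for y
  proof -
    have "?g y = (\<Sum>a\<in>F. if a = y 0 then M else 0)"
      using that by (intro sum.cong) (auto simp: cyl_single)
    then show ?thesis using F(1) by (simp add: indicator_def)
  qed
  have bg: "bdd_fin_supp A ?g" by (intro bdd_fin_supp_sum bdd_fin_supp_cyl) simp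
  have "norm ((L ^^ n) f x / lam ^ n) \<le> (L ^^ n) ?g x / lam ^ n" for n
  proof -
    have "(L ^^ n) f x \<le> (L ^^ n) ?g x"
      using F(2) g by (intro funpow_ruelle_mono lc x bdd_fin_supp_imp f bg) (force simp: abs_le_iff)
    \<comment> \<open>The function \<open>-f\<close>, written in the shape to which
      \<open>funpow_ruelle_lin\<close> applies; it yields the lower bound.\<close>
    moreover have "(L ^^ n) (\<lambda>x. (-1) * f x + 0 * f x) x \<le> (L ^^ n) ?g x"
      using F(2) g by (intro funpow_ruelle_mono lc x bdd_fin_supp_imp bdd_fin_supp_lin f bg) (force simp: abs_le_iff)
    ultimately have "\<bar>(L ^^ n) f x\<bar> \<le> (L ^^ n) ?g x"
      unfolding funpow_ruelle_lin[OF lc bdd_fin_supp_imp[OF f] bdd_fin_supp_imp[OF f] x] by simp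
    then show ?thesis using lam_pos by (simp add: divide_right_mono)
  qed
  then show ?thesis
    by (intro summable_comparison_test'[OF summable_green_sum_single[OF F(1) x], of 0])
qed

lemma green_sum:
  assumes f: "\<And>i. i \<in> I \<Longrightarrow> bdd_fin_supp A (f i)" and x: "x \<in> tms A" and I: "finite I"
  shows "green A \<phi> lam (\<lambda>x. \<Sum>i\<in>I. c i * f i x) x = (\<Sum>i\<in>I. c i * green A \<phi> lam (f i) x)"
proof -
  have "green A \<phi> lam (\<lambda>x. \<Sum>i\<in>I. c i * f i x) x = (\<Sum>n. \<Sum>i\<in>I. c i * ((L ^^ n) (f i) x / lam ^ n))"
    unfolding green_def using funpow_ruelle_sum[OF lc f x I, where c = c] by (simp add: sum_divide_distrib)
  also have "\<dots> = (\<Sum>i\<in>I. \<Sum>n. c i * ((L ^^ n) (f i) x / lam ^ n))"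
    using f x by (intro suminf_sum summable_mult summable_green)
  also have "\<dots> = (\<Sum>i\<in>I. c i * green A \<phi> lam (f i) x)"
    unfolding green_def using f x by (intro sum.cong refl suminf_mult summable_green)
  finally show ?thesis .
qed

lemma green_mono:
  assumes "bdd_fin_supp A f" "bdd_fin_supp A g" "x \<in> tms A" "\<And>y. y \<in> tms A \<Longrightarrow> f y \<le> g y"
  shows "green A \<phi> lam f x \<le> green A \<phi> lam g x"
  unfolding green_def using assms lam_pos
  by (intro suminf_le summable_green divide_right_mono funpow_ruelle_mono lc bdd_fin_supp_imp) auto

lemma green_cong:
  assumes "x \<in> tms A" "\<And>y. y \<in> tms A \<Longrightarrow> f y = g y"
  shows "green A \<phi> lam f x = green A \<phi> lam g x"
  unfolding green_def using funpow_ruelle_cong[OF assms(2,1)] by simp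

lemma green_nonneg:
  assumes "bdd_fin_supp A f" "x \<in> tms A" "\<And>y. y \<in> tms A \<Longrightarrow> 0 \<le> f y"
  shows "0 \<le> green A \<phi> lam f x"
  unfolding green_def using assms lam_pos
  by (intro suminf_nonneg summable_green divide_nonneg_nonneg funpow_ruelle_nonneg lc bdd_fin_supp_imp) auto

text \<open>The Ruelle operator for arbitrary nonnegative extended functions, summed over all
  letters: sums and integrals can be exchanged without summability conditions. On nonnegative
  functions with \<open>fin_supp\<close> it agrees with \<open>ruelle\<close>.\<close>

definition Lp :: "((nat \<Rightarrow> 's) \<Rightarrow> ennreal) \<Rightarrow> (nat \<Rightarrow> 's) \<Rightarrow> ennreal" where
  "Lp g x = (\<integral>\<^sup>+a. (if A a (x 0) then ennreal (exp (\<phi> (case_nat a x))) * g (case_nat a x) else 0) \<partial>count_space UNIV)"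

definition Gp :: "((nat \<Rightarrow> 's) \<Rightarrow> ennreal) \<Rightarrow> (nat \<Rightarrow> 's) \<Rightarrow> ennreal" where
  "Gp g x = (\<Sum>n. ennreal (1 / lam ^ n) * (Lp ^^ n) g x)"

lemma Lp_cong:
  assumes "x \<in> tms A" "\<And>y. y \<in> tms A \<Longrightarrow> g y = h y" shows "Lp g x = Lp h x"
  unfolding Lp_def using assms by (intro nn_integral_cong) (simp add: case_nat_tms)

lemma Lp_ge:
  assumes "y \<in> tms A" shows "ennreal (exp (\<phi> y)) * g y \<le> Lp g (shift y)"
proof -
  let ?f = "\<lambda>a. if A a (shift y 0) then ennreal (exp (\<phi> (case_nat a (shift y)))) * g (case_nat a (shift y)) else 0"
  have "A (y 0) (shift y 0)" using assms by (auto simp: tms_def shift_def)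
  then have "ennreal (exp (\<phi> y)) * g y = ?f (y 0)" by (simp add: case_nat_shift)
  also have "\<dots> = (\<integral>\<^sup>+a. ?f (y 0) * indicator {y 0} a \<partial>count_space UNIV)"
    by (subst nn_integral_cmult_indicator) auto
  also have "\<dots> \<le> (\<integral>\<^sup>+a. ?f a \<partial>count_space UNIV)"
    by (intro nn_integral_mono) (simp add: indicator_def)
  finally show ?thesis unfolding Lp_def .
qed

lemma funpow_Lp_pos:
  assumes "y \<in> tms A" "g y > 0" shows "(Lp ^^ n) g ((shift ^^ n) y) > 0"
proof (induction n)
  case (Suc n)
  have "0 < ennreal (exp (\<phi> ((shift ^^ n) y))) * (Lp ^^ n) g ((shift ^^ n) y)"
    using Suc by (simp add: ennreal_zero_less_mult_iff)
  also have "\<dots> \<le> Lp ((Lp ^^ n) g) (shift ((shift ^^ n) y))"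
    by (rule Lp_ge[OF funpow_shift_tms[OF assms(1)]])
  finally show ?case by simp
qed (use assms in simp)

text \<open>Transitivity provides a path from \<open>a\<close> to \<open>x 0\<close>. Put in front
  of \<open>x\<close> it gives a preimage of \<open>x\<close> in the cylinder of \<open>a\<close>,
  which makes one term of the series positive.\<close>

lemma Gp_single_pos:
  assumes x: "x \<in> tms A" shows "Gp (indicator (cyl A [a])) x > 0"
proof -
  obtain n where "(shift ^^ n) -` cyl A [x 0] \<inter> cyl A [a] \<noteq> {}"
    using transitive unfolding transitive_tms_def by blast
  then obtain z where "(shift ^^ n) z \<in> cyl A [x 0]" "z \<in> cyl A [a]" by blast
  then have z: "z \<in> tms A" "z 0 = a" "z n = x 0" by (auto simp: cyl_single funpow_shift)
  \<comment> \<open>The first \<open>n\<close> letters of \<open>z\<close> followed by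
    \<open>x\<close>; the splice is admissible because \<open>z n = x 0\<close>.\<close>
  define y where "y i = (if i < n then z i else x (i - n))" for i
  have y: "y \<in> tms A"
  proof -
    have "A (y i) (y (Suc i))" for i
    proof -
      consider "Suc i < n" | "Suc i = n" | "i \<ge> n" by linarith
      then show ?thesis
      proof cases
        case 2
        have "A (z i) (z (Suc i))" using z(1) by (simp add: tms_def)
        then show ?thesis using 2 z(3) by (simp add: y_def)
      next
        case 3
        have "A (x (i - n)) (x (Suc (i - n)))" using x by (simp add: tms_def)
        then show ?thesis using 3 by (simp add: y_def Suc_diff_le)
      qed (use z(1) in \<open>simp add: y_def tms_def\<close>)
    qed
    then show ?thesis by (simp add: tms_def)
  qed
  have yx: "(shift ^^ n) y = x" by (auto simp: funpow_shift y_def)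
  have y0: "y 0 = a" using z(2,3) by (cases "n = 0") (auto simp: y_def)
  then have "(Lp ^^ n) (indicator (cyl A [a])) x > 0"
    using funpow_Lp_pos[OF y, of "indicator (cyl A [a])" n] y yx by (simp add: cyl_single)
  then have "0 < ennreal (1 / lam ^ n) * (Lp ^^ n) (indicator (cyl A [a])) x"
    using lam_pos by (simp add: ennreal_zero_less_mult_iff)
  also have "\<dots> \<le> Gp (indicator (cyl A [a])) x"
    unfolding Gp_def
    using sum_le_suminf[of "\<lambda>n. ennreal (1 / lam ^ n) * (Lp ^^ n) (indicator (cyl A [a])) x" "{n}"] by simp
  finally show ?thesis .
qed

lemma Lp_eq_ruelle:
  assumes f: "fin_supp A f" and nn: "\<And>y. y \<in> tms A \<Longrightarrow> 0 \<le> f y" and x: "x \<in> tms A"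
  shows "Lp (\<lambda>x. ennreal (f x)) x = ennreal (L f x)"
proof -
  obtain F where F: "finite F" "\<forall>x\<in>tms A. f x \<noteq> 0 \<longrightarrow> x 0 \<in> F"
    using f unfolding fin_supp_def by meson
  let ?h = "\<lambda>a. if A a (x 0) then exp (\<phi> (case_nat a x)) * f (case_nat a x) else 0"
  have nnh: "0 \<le> ?h a" for a using nn x by (simp add: case_nat_tms)
  have "Lp (\<lambda>x. ennreal (f x)) x = (\<integral>\<^sup>+a. ennreal (?h a) \<partial>count_space UNIV)"
    unfolding Lp_def using nn x by (intro nn_integral_cong) (auto simp: ennreal_mult' case_nat_tms)
  also have "\<dots> = (\<Sum>a\<in>F. ennreal (?h a))"
  proof (rule nn_integral_count_space'[OF F(1)])
    show "ennreal (?h a) = 0" if "a \<notin> F" for a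
    proof (cases "A a (x 0)")
      case True
      then have "f (case_nat a x) = 0" using bspec[OF F(2), of "case_nat a x"] that x by (auto simp: case_nat_tms)
      then show ?thesis by simp
    qed simp
  qed simp
  also have "\<dots> = ennreal (L f x)"
    unfolding ruelle_eq[OF F x] using nnh by (intro sum_ennreal) blast
  finally show ?thesis .
qed

lemma funpow_Lp_eq_ruelle:
  assumes f: "fin_supp A f" and nn: "\<And>y. y \<in> tms A \<Longrightarrow> 0 \<le> f y" and "x \<in> tms A"
  shows "(Lp ^^ n) (\<lambda>x. ennreal (f x)) x = ennreal ((L ^^ n) f x)"
  using \<open>x \<in> tms A\<close>
proof (induction n arbitrary: x)
  case (Suc n)
  have "(Lp ^^ Suc n) (\<lambda>x. ennreal (f x)) x = Lp (\<lambda>x. ennreal ((L ^^ n) f x)) x"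
    using Lp_cong[OF Suc.prems Suc.IH] by simp
  also have "\<dots> = ennreal (L ((L ^^ n) f) x)"
    using Suc.prems nn by (intro Lp_eq_ruelle funpow_ruelle_fin_supp funpow_ruelle_nonneg lc f)
  finally show ?case by simp
qed simp

lemma Gp_eq_green:
  assumes f: "bdd_fin_supp A f" and nn: "\<And>y. y \<in> tms A \<Longrightarrow> 0 \<le> f y" and x: "x \<in> tms A"
  shows "Gp (\<lambda>x. ennreal (f x)) x = ennreal (green A \<phi> lam f x)"
proof -
  have nn': "0 \<le> (L ^^ n) f x / lam ^ n" for n
    using funpow_ruelle_nonneg[OF lc bdd_fin_supp_imp[OF f] x nn] lam_pos by simp
  have "Gp (\<lambda>x. ennreal (f x)) x = (\<Sum>n. ennreal ((L ^^ n) f x / lam ^ n))"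
    unfolding Gp_def
  proof (rule suminf_cong)
    fix n
    have "ennreal (1 / lam ^ n) * ennreal ((L ^^ n) f x) = ennreal (1 / lam ^ n * (L ^^ n) f x)"
      using lam_pos by (intro ennreal_mult'[symmetric]) simp
    then show "ennreal (1 / lam ^ n) * (Lp ^^ n) (\<lambda>x. ennreal (f x)) x = ennreal ((L ^^ n) f x / lam ^ n)"
      by (simp add: funpow_Lp_eq_ruelle[OF bdd_fin_supp_imp[OF f] nn x])
  qed
  also have "\<dots> = ennreal (green A \<phi> lam f x)"
    unfolding green_def by (intro suminf_ennreal2 nn' summable_green[OF f x])
  finally show ?thesis .
qed

lemma Gp_cyl_eq_green:
  assumes "w \<noteq> []" "x \<in> tms A"
  shows "Gp (indicator (cyl A w)) x = ennreal (green A \<phi> lam (indicator (cyl A w)) x)"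
  using Gp_eq_green[OF bdd_fin_supp_cyl[OF assms(1)] _ assms(2)] by (simp add: ennreal_indicator)

lemma green_single_pos:
  assumes "x \<in> tms A" shows "green A \<phi> lam (indicator (cyl A [a])) x > 0"
  using Gp_single_pos[OF assms, of a] Gp_cyl_eq_green[of "[a]" x] assms by simp

section \<open>Regularity of the potential and bounded distortion\<close>

lemma continuous_potential: "continuous_map (tms_top A) euclideanreal \<phi>"
proof -
  obtain V where V: "\<And>m. 0 \<le> V m" "summable (\<lambda>m. V (m + 2))"
    "\<And>m x y. m \<ge> 2 \<Longrightarrow> x \<in> tms A \<Longrightarrow> y \<in> tms A \<Longrightarrow> \<forall>i<m. x i = y i \<Longrightarrow> \<bar>\<phi> x - \<phi> y\<bar> \<le> V m"
    using Var_bound[OF summable_var] by metis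
  show ?thesis
    unfolding continuous_map_def
  proof (intro conjI allI impI)
    fix U assume "openin euclideanreal U"
    then have "open U" by simp
    have "\<exists>n. cyl A (map x [0..<n]) \<subseteq> {x \<in> tms A. \<phi> x \<in> U}" if x: "x \<in> tms A" "\<phi> x \<in> U" for x
    proof -
      obtain e where e: "e > 0" "ball (\<phi> x) e \<subseteq> U"
        using \<open>open U\<close> x(2) unfolding open_contains_ball by blast
      have "\<forall>\<^sub>F m in sequentially. V (m + 2) < e"
        using order_tendstoD(2)[OF summable_LIMSEQ_zero[OF V(2)] e(1)] .
      then obtain m where m: "V (m + 2) < e" by (auto simp: eventually_sequentially)
      have "cyl A (map x [0..<m+2]) \<subseteq> {x \<in> tms A. \<phi> x \<in> U}"
      proof
        fix y assume "y \<in> cyl A (map x [0..<m+2])"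
        then have y: "y \<in> tms A" "\<forall>i<m+2. y i = x i" unfolding cyl_prefix by auto
        then have "\<bar>\<phi> y - \<phi> x\<bar> \<le> V (m + 2)" by (intro V(3) x) auto
        then have "\<phi> y \<in> ball (\<phi> x) e" using m by (simp add: dist_real_def)
        then show "y \<in> {x \<in> tms A. \<phi> x \<in> U}" using e y by blast
      qed
      then show ?thesis by blast
    qed
    then show "openin (tms_top A) {x \<in> topspace (tms_top A). \<phi> x \<in> U}"
      unfolding openin_tms_top by auto
  qed auto
qed

lemma measurable_potential [measurable]: "\<phi> \<in> borel_measurable (tms_M A)"
  by (rule continuous_imp_measurable[OF continuous_potential])

text \<open>
  With \<open>t m\<close> the tail of the variations beyond \<open>m\<close>, this property is preserved by the Ruelle operator.
\<close>

definition distorted :: "(nat \<Rightarrow> real) \<Rightarrow> ((nat \<Rightarrow> 's) \<Rightarrow> ennreal) \<Rightarrow> bool" where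
  "distorted t g \<longleftrightarrow> (\<forall>m\<ge>1. \<forall>x\<in>tms A. \<forall>y\<in>tms A. (\<forall>i<m. x i = y i) \<longrightarrow> g x \<le> ennreal (exp (t m)) * g y)"

text \<open>Bounded distortion: all iterates of the indicator vary on \<open>[b]\<close> by at most
  the factor \<open>exp (t 1)\<close>, so finiteness at one reference point, given by transience,
  becomes a bound on the whole cylinder.\<close>

lemma Gp_bounded_on_cyl:
  "\<exists>C. \<forall>x\<in>cyl A [b]. Gp (indicator (cyl A [a])) x \<le> ennreal C"
proof -
  obtain V where V: "\<And>m. 0 \<le> V m" "summable (\<lambda>m. V (m + 2))"
    "\<And>m x y. m \<ge> 2 \<Longrightarrow> x \<in> tms A \<Longrightarrow> y \<in> tms A \<Longrightarrow> \<forall>i<m. x i = y i \<Longrightarrow> \<bar>\<phi> x - \<phi> y\<bar> \<le> V m"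
    using Var_bound[OF summable_var] by metis
  \<comment> \<open>The tail starts at \<open>V (m + 1)\<close>: points agreeing in \<open>m\<close>
    coordinates agree in \<open>m + 1\<close> once a common letter is prepended. For
    \<open>m \<ge> 1\<close> only variations of index at least 2 occur, and
    \<open>t m = V (m + 1) + t (Suc m)\<close> makes the estimate reproduce itself.\<close>
  define t where "t m = (\<Sum>j. V (j + (m + 1)))" for m
  have sV: "summable (\<lambda>j. V (j + (m + 1)))" if "m \<ge> 1" for m
  proof -
    have "summable (\<lambda>j. V (j + (m - 1) + 2))" using V(2) by (rule summable_ignore_initial_segment)
    then show ?thesis using that by (simp add: add.assoc)
  qed
  have t_nonneg: "0 \<le> t m" if "m \<ge> 1" for m
    unfolding t_def using V(1) by (intro suminf_nonneg sV that)
  have t_Suc: "t m = V (m + 1) + t (Suc m)" if "m \<ge> 1" for m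
    unfolding t_def using suminf_split_head[OF sV[OF that]] by simp
  let ?g = "indicator (cyl A [a]) :: _ \<Rightarrow> ennreal"
  have Lp_distorted: "distorted t (Lp g)" if g: "distorted t g" for g
    unfolding distorted_def
  proof (intro allI impI ballI)
    fix m :: nat and x y assume m: "m \<ge> 1" and xy: "x \<in> tms A" "y \<in> tms A" "\<forall>i<m. x i = y i"
    have x0: "x 0 = y 0" using m xy by simp
    let ?h = "\<lambda>x a. if A a (x 0) then ennreal (exp (\<phi> (case_nat a x))) * g (case_nat a x) else 0"
    have "?h x a \<le> ennreal (exp (t m)) * ?h y a" for a
    proof (cases "A a (x 0)")
      case True
      then have ax: "case_nat a x \<in> tms A" "case_nat a y \<in> tms A"
        using xy x0 by (auto simp: case_nat_tms)
      have agree: "\<forall>i<Suc m. case_nat a x i = case_nat a y i"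
        using xy(3) by (auto split: nat.split)
      have "\<phi> (case_nat a x) - \<phi> (case_nat a y) \<le> V (m + 1)"
        using V(3)[OF _ ax, of "Suc m"] agree m by auto
      then have "exp (\<phi> (case_nat a x)) \<le> exp (V (m + 1)) * exp (\<phi> (case_nat a y))"
        by (simp flip: exp_add)
      then have e: "ennreal (exp (\<phi> (case_nat a x))) \<le> ennreal (exp (V (m + 1))) * ennreal (exp (\<phi> (case_nat a y)))"
        by (simp add: ennreal_leI flip: ennreal_mult)
      have "g (case_nat a x) \<le> ennreal (exp (t (Suc m))) * g (case_nat a y)"
        using g ax agree m unfolding distorted_def by (meson le_SucI)
      with e have "ennreal (exp (\<phi> (case_nat a x))) * g (case_nat a x)
        \<le> (ennreal (exp (V (m + 1))) * ennreal (exp (\<phi> (case_nat a y)))) * (ennreal (exp (t (Suc m))) * g (case_nat a y))"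
        by (intro mult_mono) auto
      also have "\<dots> = (ennreal (exp (V (m + 1))) * ennreal (exp (t (Suc m)))) * (ennreal (exp (\<phi> (case_nat a y))) * g (case_nat a y))"
        by (simp add: ac_simps)
      also have "ennreal (exp (V (m + 1))) * ennreal (exp (t (Suc m))) = ennreal (exp (t m))"
        unfolding t_Suc[OF m] by (simp add: exp_add ennreal_mult)
      finally show ?thesis using True x0 by simp
    qed (simp add: x0)
    then have "Lp g x \<le> (\<integral>\<^sup>+a. ennreal (exp (t m)) * ?h y a \<partial>count_space UNIV)"
      unfolding Lp_def by (intro nn_integral_mono)
    also have "\<dots> = ennreal (exp (t m)) * Lp g y"
      unfolding Lp_def by (intro nn_integral_cmult) simp
    finally show "Lp g x \<le> ennreal (exp (t m)) * Lp g y" .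
  qed
  have "distorted t ?g"
    unfolding distorted_def
  proof (intro allI impI ballI)
    fix m :: nat and x y assume m: "m \<ge> 1" and xy: "x \<in> tms A" "y \<in> tms A" "\<forall>i<m. x i = y i"
    then have "?g x = ?g y" by (auto simp: indicator_def cyl_single)
    moreover have "1 \<le> ennreal (exp (t m))" using t_nonneg[OF m] by (simp add: ennreal_1[symmetric] ennreal_leI del: ennreal_1)
    ultimately show "?g x \<le> ennreal (exp (t m)) * ?g y"
      using mult_right_mono[of 1 "ennreal (exp (t m))" "?g y"] by simp
  qed
  then have dist: "distorted t ((Lp ^^ n) ?g)" for n
    by (induction n) (simp_all add: Lp_distorted)
  obtain y where y: "y \<in> tms A" "y 0 = b" using cyl_single_nonempty by blast
  have "Gp ?g x \<le> ennreal (exp (t 1) * green A \<phi> lam (indicator (cyl A [a])) y)" if "x \<in> cyl A [b]" for x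
  proof -
    have x: "x \<in> tms A" "x 0 = y 0" using that y by (auto simp: cyl_single)
    have le: "(Lp ^^ n) ?g x \<le> ennreal (exp (t 1)) * (Lp ^^ n) ?g y" for n
      using dist[of n] x y unfolding distorted_def by simp
    have "ennreal (1 / lam ^ n) * (Lp ^^ n) ?g x
        \<le> ennreal (exp (t 1)) * (ennreal (1 / lam ^ n) * (Lp ^^ n) ?g y)" for n
      using mult_left_mono[OF le[of n], of "ennreal (1 / lam ^ n)"] by (simp add: mult.left_commute)
    then have "Gp ?g x \<le> (\<Sum>n. ennreal (exp (t 1)) * (ennreal (1 / lam ^ n) * (Lp ^^ n) ?g y))"
      unfolding Gp_def by (intro suminf_le) auto
    also have "\<dots> = ennreal (exp (t 1)) * Gp ?g y"
      unfolding Gp_def by simp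
    also have "\<dots> = ennreal (exp (t 1) * green A \<phi> lam (indicator (cyl A [a])) y)"
      using Gp_cyl_eq_green[of "[a]" y] y by (simp add: ennreal_mult')
    finally show ?thesis .
  qed
  then show ?thesis by blast
qed

section \<open>Inverse branches and measurability of the operator\<close>

lemma measurable_pair_symbols:
  "(\<lambda>p. f (fst p i) (snd p)) \<in> tms_M A \<Otimes>\<^sub>M count_space (UNIV :: 's set) \<rightarrow>\<^sub>M count_space UNIV"
proof -
  have "(\<lambda>p. (fst p i, snd p)) \<in> tms_M A \<Otimes>\<^sub>M count_space (UNIV :: 's set)
      \<rightarrow>\<^sub>M count_space UNIV \<Otimes>\<^sub>M count_space UNIV"
    by measurable
  then have "(\<lambda>p. (fst p i, snd p)) \<in> tms_M A \<Otimes>\<^sub>M count_space (UNIV :: 's set) \<rightarrow>\<^sub>M count_space UNIV"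
    by (simp add: pair_measure_countable)
  from measurable_compose[OF this, of "\<lambda>q. f (fst q) (snd q)" "count_space UNIV"]
  show ?thesis by simp
qed

text \<open>The inverse branches of the shift as one map on a product space, which presents
  \<open>Lp\<close> as a fibre integral. For a forbidden transition the value is the base point
  itself, merely to stay in \<open>tms A\<close>; \<open>branch_weight\<close> vanishes
  there.\<close>

definition branch :: "(nat \<Rightarrow> 's) \<times> 's \<Rightarrow> (nat \<Rightarrow> 's)" where
  "branch p = (if A (snd p) (fst p 0) then case_nat (snd p) (fst p) else fst p)"

lemma measurable_branch [measurable]:
  "branch \<in> tms_M A \<Otimes>\<^sub>M count_space UNIV \<rightarrow>\<^sub>M tms_M A"
proof (rule measurable_into_tms_M)
  show "branch p \<in> tms A" if "p \<in> space (tms_M A \<Otimes>\<^sub>M count_space UNIV)" for p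
    using that by (auto simp: branch_def space_pair_measure case_nat_tms)
  have [measurable]: "Measurable.pred (tms_M A \<Otimes>\<^sub>M count_space (UNIV :: 's set)) (\<lambda>p. A (snd p) (fst p 0))"
    using measurable_pair_symbols[of "\<lambda>s a. A a s" 0] .
  show "(\<lambda>p. branch p i) \<in> tms_M A \<Otimes>\<^sub>M count_space UNIV \<rightarrow>\<^sub>M count_space UNIV" for i
  proof (cases i)
    case 0
    have "(\<lambda>p. branch p i) = (\<lambda>p. if A (snd p) (fst p 0) then snd p else fst p 0)"
      by (auto simp: branch_def 0)
    then show ?thesis by simp
  next
    case (Suc j)
    have "(\<lambda>p. branch p i) = (\<lambda>p. if A (snd p) (fst p 0) then fst p j else fst p (Suc j))"
      by (auto simp: branch_def Suc)
    then show ?thesis by simp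
  qed
qed

definition branch_weight :: "(nat \<Rightarrow> 's) \<times> 's \<Rightarrow> ennreal" where
  "branch_weight p = (if A (snd p) (fst p 0) then ennreal (exp (\<phi> (branch p))) else 0)"

lemma measurable_branch_weight [measurable]:
  "branch_weight \<in> borel_measurable (tms_M A \<Otimes>\<^sub>M count_space UNIV)"
proof -
  have [measurable]: "Measurable.pred (tms_M A \<Otimes>\<^sub>M count_space (UNIV :: 's set)) (\<lambda>p. A (snd p) (fst p 0))"
    using measurable_pair_symbols[of "\<lambda>s a. A a s" 0] .
  show ?thesis unfolding branch_weight_def[abs_def] by measurable
qed

lemma Lp_branch: "Lp g x = (\<integral>\<^sup>+a. branch_weight (x, a) * g (branch (x, a)) \<partial>count_space UNIV)"
  unfolding Lp_def by (intro nn_integral_cong) (simp add: branch_weight_def branch_def)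

lemma measurable_Lp [measurable]:
  assumes [measurable]: "g \<in> borel_measurable (tms_M A)"
  shows "Lp g \<in> borel_measurable (tms_M A)"
proof -
  interpret sigma_finite_measure "count_space (UNIV :: 's set)"
    by (rule sigma_finite_measure_count_space_countable) simp
  show ?thesis
    unfolding Lp_branch[abs_def]
    by (rule borel_measurable_nn_integral_fst[of "\<lambda>p. branch_weight p * g (branch p)", simplified]) measurable
qed

lemma measurable_funpow_Lp [measurable]:
  "g \<in> borel_measurable (tms_M A) \<Longrightarrow> (Lp ^^ n) g \<in> borel_measurable (tms_M A)"
  by (induction n) (simp_all add: measurable_Lp)

lemma measurable_Gp [measurable]:
  "g \<in> borel_measurable (tms_M A) \<Longrightarrow> Gp g \<in> borel_measurable (tms_M A)"
  unfolding Gp_def[abs_def] by measurable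

text \<open>All preimages of \<open>x\<close> give \<open>h (shift y)\<close> the same value
  \<open>h x\<close>, which leaves the sum.\<close>

lemma Lp_mult_shift:
  assumes "x \<in> tms A"
  shows "Lp (\<lambda>y. g y * h (shift y)) x = Lp g x * h x"
proof -
  have "Lp (\<lambda>y. g y * h (shift y)) x
      = (\<integral>\<^sup>+a. (if A a (x 0) then ennreal (exp (\<phi> (case_nat a x))) * g (case_nat a x) else 0) * h x \<partial>count_space UNIV)"
    unfolding Lp_def by (intro nn_integral_cong) (simp add: shift_case_nat mult.assoc)
  also have "\<dots> = Lp g x * h x"
    unfolding Lp_def by (intro nn_integral_multc) simp
  finally show ?thesis .
qed

end

section \<open>Orbits under a conformal measure\<close>

lemma measurable_indicator_cyl [measurable, simp]:
  fixes A :: "'s::countable \<Rightarrow> 's \<Rightarrow> bool"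
  shows "(indicator (cyl A w) :: _ \<Rightarrow> ennreal) \<in> borel_measurable (tms_M A)"
  by (rule borel_measurable_indicator) (simp add: sets_tms_M)

lemma emeasure_space_zero_if_AE_False:
  assumes "AE x in M. False" shows "emeasure M (space M) = 0"
proof -
  obtain N where N: "{x \<in> space M. \<not> False} \<subseteq> N" "emeasure M N = 0" "N \<in> sets M"
    using assms by (rule AE_E)
  have "emeasure M (space M) \<le> emeasure M N" using N by (intro emeasure_mono) auto
  then show ?thesis using N(2) by simp
qed

locale conformal_measure = transient_tms A \<phi> lam
  for A :: "'s::countable \<Rightarrow> 's \<Rightarrow> bool" and \<phi> lam +
  fixes \<mu> :: "(nat \<Rightarrow> 's) measure"
  assumes conf: "\<mu> \<in> Conf A \<phi> lam"
begin

lemma radon: "radon_measure A \<mu>"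
  using conf by (simp add: Conf_def)

lemmas sets_mu = radon_measureD(1)[OF radon]
lemmas space_mu = radon_measureD(2)[OF radon]
lemmas emeasure_single_finite = radon_measureD(3)[OF radon lc]

lemma measurable_mu: "measurable \<mu> N = measurable (tms_M A) N"
  by (rule measurable_cong_sets) (simp_all add: sets_mu sets_tms_M)

text \<open>Conformality is given for indicators of compact sets. Both sides are integrals of
  \<open>g\<close> against a measure, and two measures agreeing on the compact cylinders are
  equal.\<close>

lemma nn_integral_Lp:
  assumes [measurable]: "g \<in> borel_measurable (tms_M A)"
  shows "(\<integral>\<^sup>+x. Lp g x \<partial>\<mu>) = ennreal lam * (\<integral>\<^sup>+x. g x \<partial>\<mu>)"
proof -
  interpret count: sigma_finite_measure "count_space (UNIV :: 's set)"
    by (rule sigma_finite_measure_count_space_countable) simp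
  let ?P = "\<mu> \<Otimes>\<^sub>M count_space (UNIV :: 's set)"
  have sP: "sets ?P = sets (tms_M A \<Otimes>\<^sub>M count_space (UNIV :: 's set))"
    by (intro sets_pair_measure_cong) (simp_all add: sets_mu sets_tms_M)
  have mP: "measurable ?P N = measurable (tms_M A \<Otimes>\<^sub>M count_space (UNIV :: 's set)) N" for N :: "'z measure"
    by (rule measurable_cong_sets[OF sP refl])
  have [measurable]: "branch \<in> ?P \<rightarrow>\<^sub>M tms_M A"
    by (subst mP) measurable
  have [measurable]: "branch_weight \<in> borel_measurable ?P"
    by (subst measurable_cong_sets[OF sP refl]) measurable
  \<comment> \<open>The measure whose integral is \<open>\<integral> Lp g d\<mu>\<close>: weight the
    product by the branches and push it forward along them.\<close>
  define \<kappa> where "\<kappa> = distr (density ?P branch_weight) (tms_M A) branch"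
  have \<kappa>: "(\<integral>\<^sup>+x. g x \<partial>\<kappa>) = (\<integral>\<^sup>+x. Lp g x \<partial>\<mu>)" if [measurable]: "g \<in> borel_measurable (tms_M A)" for g
  proof -
    have "(\<integral>\<^sup>+x. g x \<partial>\<kappa>) = (\<integral>\<^sup>+p. branch_weight p * g (branch p) \<partial>?P)"
      unfolding \<kappa>_def by (simp add: nn_integral_distr nn_integral_density)
    also have "\<dots> = (\<integral>\<^sup>+x. Lp g x \<partial>\<mu>)"
      unfolding Lp_branch by (rule count.nn_integral_fst[symmetric]) measurable
    finally show ?thesis .
  qed
  have "\<kappa> = scale_measure (ennreal lam) \<mu>"
  proof (rule measure_eq_tms_on_cyls[where A = A])
    show "{} \<in> nonempty_cyls A" by (rule empty_in_nonempty_cyls[OF infinite_states lc])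
    show "sets \<kappa> = tms_sets A" by (simp add: \<kappa>_def sets_tms_M)
    show "sets (scale_measure (ennreal lam) \<mu>) = tms_sets A" by (simp add: sets_mu)
    have cyl: "emeasure \<kappa> (cyl A w) = emeasure (scale_measure (ennreal lam) \<mu>) (cyl A w)" if w: "w \<noteq> []" for w
    proof -
      have "emeasure \<kappa> (cyl A w) = (\<integral>\<^sup>+x. indicator (cyl A w) x \<partial>\<kappa>)"
        by (simp add: \<kappa>_def sets_tms_M)
      also have "\<dots> = (\<integral>\<^sup>+x. Lp (\<lambda>x. ennreal (indicator (cyl A w) x)) x \<partial>\<mu>)"
        by (subst \<kappa>) (simp_all add: sets_tms_M ennreal_indicator)
      also have "\<dots> = (\<integral>\<^sup>+x. ennreal (ruelle A \<phi> (indicator (cyl A w)) x) \<partial>\<mu>)"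
        using w by (intro nn_integral_cong Lp_eq_ruelle bdd_fin_supp_imp bdd_fin_supp_cyl) (simp_all add: space_mu)
      also have "\<dots> = ennreal lam * emeasure \<mu> (cyl A w)"
        using conf compactin_cyl[OF lc w] by (simp add: Conf_def)
      finally show ?thesis by simp
    qed
    then show "emeasure \<kappa> (cyl A w) = emeasure (scale_measure (ennreal lam) \<mu>) (cyl A w)"
      if "w \<in> admissible_words A" for w
      using that by (simp add: admissible_words_def)
    show "emeasure \<kappa> (cyl A [a]) < \<infinity>" for a
      using cyl[of "[a]"] emeasure_single_finite[of a] by (simp add: ennreal_mult_less_top)
  qed
  then have "(\<integral>\<^sup>+x. Lp g x \<partial>\<mu>) = (\<integral>\<^sup>+x. g x \<partial>scale_measure (ennreal lam) \<mu>)"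
    using \<kappa>[OF assms] by simp
  also have "\<dots> = ennreal lam * (\<integral>\<^sup>+x. g x \<partial>\<mu>)"
    by (rule nn_integral_scale_measure) (simp add: measurable_mu)
  finally show ?thesis .
qed

lemma nn_integral_Lp_mult:
  assumes [measurable]: "g \<in> borel_measurable (tms_M A)" "h \<in> borel_measurable (tms_M A)"
  shows "(\<integral>\<^sup>+x. Lp g x * h x \<partial>\<mu>) = ennreal lam * (\<integral>\<^sup>+x. g x * h (shift x) \<partial>\<mu>)"
proof -
  have "(\<integral>\<^sup>+x. Lp g x * h x \<partial>\<mu>) = (\<integral>\<^sup>+x. Lp (\<lambda>y. g y * h (shift y)) x \<partial>\<mu>)"
    by (intro nn_integral_cong) (simp add: Lp_mult_shift space_mu)
  also have "\<dots> = ennreal lam * (\<integral>\<^sup>+x. g x * h (shift x) \<partial>\<mu>)"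
    by (rule nn_integral_Lp) measurable
  finally show ?thesis .
qed

text \<open>Removing one operator from \<open>g\<close> costs a factor \<open>lam\<close> and one
  shift inside \<open>h\<close>.\<close>

lemma nn_integral_funpow_Lp_mult:
  assumes [measurable]: "g \<in> borel_measurable (tms_M A)" and "h \<in> borel_measurable (tms_M A)"
  shows "(\<integral>\<^sup>+x. (Lp ^^ n) g x * h x \<partial>\<mu>) = ennreal (lam ^ n) * (\<integral>\<^sup>+x. g x * h ((shift ^^ n) x) \<partial>\<mu>)"
  using assms(2)
proof (induction n arbitrary: h)
  case (Suc n)
  note [measurable] = Suc.prems
  have "(\<integral>\<^sup>+x. (Lp ^^ Suc n) g x * h x \<partial>\<mu>) = ennreal lam * (\<integral>\<^sup>+x. (Lp ^^ n) g x * h (shift x) \<partial>\<mu>)"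
    using nn_integral_Lp_mult[of "(Lp ^^ n) g" h] by (simp add: Suc.prems)
  also have "(\<integral>\<^sup>+x. (Lp ^^ n) g x * h (shift x) \<partial>\<mu>)
      = ennreal (lam ^ n) * (\<integral>\<^sup>+x. g x * h (shift ((shift ^^ n) x)) \<partial>\<mu>)"
    by (rule Suc.IH) measurable
  finally show ?case using lam_pos by (simp add: ennreal_mult mult.assoc)
qed simp

text \<open>The weights \<open>1 / lam ^ n\<close> of Green's function cancel the factors
  \<open>lam ^ n\<close> of the iterated duality, leaving an unweighted sum along the orbit.\<close>

lemma nn_integral_Gp_mult:
  assumes [measurable]: "g \<in> borel_measurable (tms_M A)" "h \<in> borel_measurable (tms_M A)"
  shows "(\<integral>\<^sup>+x. Gp g x * h x \<partial>\<mu>) = (\<integral>\<^sup>+x. g x * (\<Sum>n. h ((shift ^^ n) x)) \<partial>\<mu>)"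
proof -
  have m[measurable]: "f \<in> borel_measurable \<mu>" if "f \<in> borel_measurable (tms_M A)" for f :: "_ \<Rightarrow> ennreal"
    using that by (simp add: measurable_mu)
  have "(\<integral>\<^sup>+x. Gp g x * h x \<partial>\<mu>) = (\<integral>\<^sup>+x. (\<Sum>n. ennreal (1 / lam ^ n) * ((Lp ^^ n) g x * h x)) \<partial>\<mu>)"
    unfolding Gp_def by (intro nn_integral_cong) (simp add: mult.assoc flip: ennreal_suminf_multc)
  also have "\<dots> = (\<Sum>n. \<integral>\<^sup>+x. ennreal (1 / lam ^ n) * ((Lp ^^ n) g x * h x) \<partial>\<mu>)"
    by (intro nn_integral_suminf m) measurable
  also have "\<dots> = (\<Sum>n. \<integral>\<^sup>+x. g x * h ((shift ^^ n) x) \<partial>\<mu>)"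
  proof (rule suminf_cong)
    fix n
    have "(\<integral>\<^sup>+x. ennreal (1 / lam ^ n) * ((Lp ^^ n) g x * h x) \<partial>\<mu>)
        = ennreal (1 / lam ^ n) * (ennreal (lam ^ n) * (\<integral>\<^sup>+x. g x * h ((shift ^^ n) x) \<partial>\<mu>))"
      by (subst nn_integral_cmult) (simp_all add: nn_integral_funpow_Lp_mult m)
    also have "ennreal (1 / lam ^ n) * ennreal (lam ^ n) = 1"
      using lam_pos by (simp flip: ennreal_mult)
    then have "ennreal (1 / lam ^ n) * (ennreal (lam ^ n) * (\<integral>\<^sup>+x. g x * h ((shift ^^ n) x) \<partial>\<mu>))
        = (\<integral>\<^sup>+x. g x * h ((shift ^^ n) x) \<partial>\<mu>)"
      by (simp flip: mult.assoc)
    finally show "(\<integral>\<^sup>+x. ennreal (1 / lam ^ n) * ((Lp ^^ n) g x * h x) \<partial>\<mu>)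
        = (\<integral>\<^sup>+x. g x * h ((shift ^^ n) x) \<partial>\<mu>)" .
  qed
  also have "\<dots> = (\<integral>\<^sup>+x. (\<Sum>n. g x * h ((shift ^^ n) x)) \<partial>\<mu>)"
    by (intro nn_integral_suminf[symmetric] m) measurable
  also have "\<dots> = (\<integral>\<^sup>+x. g x * (\<Sum>n. h ((shift ^^ n) x)) \<partial>\<mu>)"
    by simp
  finally show ?thesis .
qed

lemma suminf_indicator_nat: "(\<Sum>n. indicator S n :: ennreal) = emeasure (count_space (UNIV :: nat set)) S"
  using nn_integral_count_space_nat[of "indicator S :: nat \<Rightarrow> ennreal"] by simp

text \<open>With indicators of \<open>[a]\<close> and \<open>[b]\<close> in the duality, the number
  of visits to \<open>[b]\<close>, integrated over \<open>[a]\<close>, is at most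
  \<open>C * \<mu>[b]\<close>, because Green's function is bounded on \<open>[b]\<close>. A finite
  integral forces finite counts, and there are countably many pairs of states.\<close>

lemma AE_finite_visits: "AE x in \<mu>. \<forall>b. finite {n. x n = b}"
proof -
  have one: "AE x in \<mu>. x \<in> cyl A [a] \<longrightarrow> finite {n. x n = b}" for a b
  proof -
    let ?a = "indicator (cyl A [a]) :: _ \<Rightarrow> ennreal" and ?b = "indicator (cyl A [b]) :: _ \<Rightarrow> ennreal"
    obtain C where C: "\<And>x. x \<in> cyl A [b] \<Longrightarrow> Gp ?a x \<le> ennreal C"
      using Gp_bounded_on_cyl[of b a] by blast
    have "(\<integral>\<^sup>+x. ?a x * (\<Sum>n. ?b ((shift ^^ n) x)) \<partial>\<mu>) = (\<integral>\<^sup>+x. Gp ?a x * ?b x \<partial>\<mu>)"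
      by (rule nn_integral_Gp_mult[symmetric]) measurable
    also have "\<dots> \<le> (\<integral>\<^sup>+x. ennreal C * ?b x \<partial>\<mu>)"
      using C by (intro nn_integral_mono) (auto simp: indicator_def)
    also have "\<dots> = ennreal C * emeasure \<mu> (cyl A [b])"
      by (rule nn_integral_cmult_indicator) (simp add: sets_mu)
    also have "\<dots> < \<infinity>" using emeasure_single_finite[of b] by (simp add: ennreal_mult_less_top)
    finally have "(\<integral>\<^sup>+x. ?a x * (\<Sum>n. ?b ((shift ^^ n) x)) \<partial>\<mu>) \<noteq> \<infinity>" by simp
    then have "AE x in \<mu>. ?a x * (\<Sum>n. ?b ((shift ^^ n) x)) \<noteq> \<infinity>"
      by (intro nn_integral_noteq_infinite) (simp_all add: measurable_mu)
    then show ?thesis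
    proof (rule AE_mp, intro AE_I2 impI)
      fix x assume x: "x \<in> space \<mu>" "?a x * (\<Sum>n. ?b ((shift ^^ n) x)) \<noteq> \<infinity>" "x \<in> cyl A [a]"
      have "?b ((shift ^^ n) x) = indicator {n. x n = b} n" for n
        using x funpow_shift_tms[of x A n] by (simp add: space_mu cyl_single indicator_def funpow_shift)
      then have "emeasure (count_space (UNIV :: nat set)) {n. x n = b} \<noteq> \<infinity>"
        using x by (simp add: suminf_indicator_nat)
      then show "finite {n. x n = b}" by (auto simp: emeasure_count_space split: if_splits)
    qed
  qed
  have "AE x in \<mu>. \<forall>a b. x \<in> cyl A [a] \<longrightarrow> finite {n. x n = b}"
    unfolding AE_all_countable using one by blast
  then show ?thesis
    by (rule AE_mp) (intro AE_I2, auto simp: space_mu cyl_single)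
qed

text \<open>
  The point of last visit of an orbit to \<open>U \<inter> window A N\<close> lies in the set \<open>W'\<close> of points which never
  return; summing over the time of the last visit produces Green's function.
\<close>

lemma emeasure_hitting:
  assumes U: "U \<in> tms_sets A"
  obtains W' where "W' \<in> tms_sets A" "W' \<subseteq> U"
    "\<And>B. B \<in> tms_sets A \<Longrightarrow> emeasure \<mu> (B \<inter> {x \<in> tms A. \<exists>n. (shift ^^ n) x \<in> U \<inter> window A N})
       = (\<integral>\<^sup>+x. Gp (indicator B) x * indicator W' x \<partial>\<mu>)"
proof -
  define W where "W = U \<inter> window A N"
  \<comment> \<open>Only strictly later times count as a return, so an orbit point in
    \<open>W'\<close> is at its last visit to \<open>W\<close>.\<close>
  define W' where "W' = {y \<in> tms A. y \<in> W \<and> (\<forall>n. (shift ^^ Suc n) y \<notin> W)}"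
  have W[measurable]: "W \<in> sets (tms_M A)"
    unfolding W_def using U by (intro sets.Int) (simp_all add: sets_tms_M)
  have [measurable]: "{x \<in> space (tms_M A). x \<in> W \<and> (\<forall>n. (shift ^^ Suc n) x \<notin> W)} \<in> sets (tms_M A)"
    by measurable
  then have W'[measurable]: "W' \<in> sets (tms_M A)" by (simp add: W'_def)
  let ?H = "{x \<in> tms A. \<exists>n. (shift ^^ n) x \<in> W}"
  have "{x \<in> space (tms_M A). \<exists>n. (shift ^^ n) x \<in> W} \<in> sets (tms_M A)" by measurable
  then have H[measurable]: "?H \<in> sets (tms_M A)" by simp
  \<comment> \<open>An orbit with finitely many visits has exactly one last visit if it hits
    \<open>W\<close>, and none otherwise; hence the orbit sum is an indicator.\<close>
  have last: "(\<Sum>n. indicator W' ((shift ^^ n) x)) = (indicator ?H x :: ennreal)"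
    if x: "x \<in> tms A" and fin: "\<forall>b. finite {n. x n = b}" for x
  proof (cases "x \<in> ?H")
    case True
    \<comment> \<open>The intersection with a window pays off here: a visit to \<open>W\<close> is a
      visit to one of finitely many letters.\<close>
    have "{n. (shift ^^ n) x \<in> W} \<subseteq> (\<Union>b\<in>{s. to_nat s < N}. {n. x n = b})"
      by (auto simp: W_def window_def funpow_shift)
    moreover have "finite (\<Union>b\<in>{s. to_nat s < N}. {n. x n = b})" using fin by simp
    ultimately have finW: "finite {n. (shift ^^ n) x \<in> W}" by (rule finite_subset)
    define k where "k = Max {n. (shift ^^ n) x \<in> W}"
    have k: "(shift ^^ k) x \<in> W" and kmax: "\<And>n. (shift ^^ n) x \<in> W \<Longrightarrow> n \<le> k"
      using Max_in[OF finW] Max_ge[OF finW] True unfolding k_def by auto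
    have add: "(shift ^^ j) ((shift ^^ n) x) = (shift ^^ (j + n)) x" for j n
      by (simp add: funpow_add)
    have "(shift ^^ n) x \<in> W' \<longleftrightarrow> n = k" for n
    proof
      assume "(shift ^^ n) x \<in> W'"
      then have n: "(shift ^^ n) x \<in> W" "\<And>j. (shift ^^ (Suc j + n)) x \<notin> W"
        unfolding W'_def using add by fastforce+
      show "n = k"
      proof (rule ccontr)
        assume "n \<noteq> k"
        then have "k = Suc (k - n - 1) + n" using kmax[OF n(1)] by simp
        then show False using n(2)[of "k - n - 1"] k by simp
      qed
    next
      assume "n = k"
      have "(shift ^^ (Suc j + k)) x \<notin> W" for j using kmax[of "Suc j + k"] by auto
      then show "(shift ^^ n) x \<in> W'"
        unfolding W'_def \<open>n = k\<close> using k funpow_shift_tms[OF x] add[of "Suc _" k] by auto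
    qed
    then have "(\<Sum>n. indicator W' ((shift ^^ n) x) :: ennreal) = (\<Sum>n. indicator {k} n)"
      by (intro suminf_cong) (simp add: indicator_def)
    also have "\<dots> = 1" by (simp add: suminf_indicator_nat)
    finally show ?thesis using True by simp
  next
    case False
    then have "indicator W' ((shift ^^ n) x) = (0 :: ennreal)" for n
      using x by (auto simp: indicator_def W'_def)
    then show ?thesis using False by simp
  qed
  show thesis
  proof (rule that)
    show "W' \<in> tms_sets A" using W' by (simp add: sets_tms_M)
    show "W' \<subseteq> U" by (auto simp: W'_def W_def)
    fix B assume B: "B \<in> tms_sets A"
    then have [measurable]: "B \<in> sets (tms_M A)" by (simp add: sets_tms_M)
    have "(\<integral>\<^sup>+x. Gp (indicator B) x * indicator W' x \<partial>\<mu>)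
        = (\<integral>\<^sup>+x. indicator B x * (\<Sum>n. indicator W' ((shift ^^ n) x)) \<partial>\<mu>)"
      by (rule nn_integral_Gp_mult) measurable
    also have "\<dots> = (\<integral>\<^sup>+x. indicator (B \<inter> ?H) x \<partial>\<mu>)"
    proof (rule nn_integral_cong_AE)
      show "AE x in \<mu>. indicator B x * (\<Sum>n. indicator W' ((shift ^^ n) x)) = (indicator (B \<inter> ?H) x :: ennreal)"
        using AE_finite_visits
      proof (rule AE_mp, intro AE_I2 impI)
        fix x assume "x \<in> space \<mu>" "\<forall>b. finite {n. x n = b}"
        then have "(\<Sum>n. indicator W' ((shift ^^ n) x)) = (indicator ?H x :: ennreal)"
          by (intro last) (simp_all add: space_mu)
        then show "indicator B x * (\<Sum>n. indicator W' ((shift ^^ n) x)) = (indicator (B \<inter> ?H) x :: ennreal)"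
          by (simp add: indicator_inter_arith)
      qed
    qed
    also have "\<dots> = emeasure \<mu> (B \<inter> ?H)"
      using B H by (intro nn_integral_indicator sets.Int) (simp_all add: sets_mu sets_tms_M)
    finally show "emeasure \<mu> (B \<inter> {x \<in> tms A. \<exists>n. (shift ^^ n) x \<in> U \<inter> window A N})
       = (\<integral>\<^sup>+x. Gp (indicator B) x * indicator W' x \<partial>\<mu>)" by (simp add: W_def)
  qed
qed

text \<open>The last-visit set is common to \<open>B1\<close> and \<open>B2\<close> and lies in
  \<open>U\<close>, so the pointwise inequality integrates to one between the parts hitting
  \<open>U \<inter> window A N\<close>. As \<open>N\<close> grows, these parts exhaust
  \<open>B1\<close> and \<open>B2\<close> up to null sets, by \<open>hit\<close>.\<close>

lemma measure_compare:
  assumes U: "U \<in> tms_sets A" and B: "B1 \<in> tms_sets A" "B2 \<in> tms_sets A"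
    and le: "\<And>x. x \<in> U \<Longrightarrow> q1 * Gp (indicator B1) x \<le> q2 * Gp (indicator B2) x"
    and hit: "AE x in \<mu>. \<exists>n. (shift ^^ n) x \<in> U"
  shows "q1 * emeasure \<mu> B1 \<le> q2 * emeasure \<mu> B2"
proof -
  define H where "H N = {x \<in> tms A. \<exists>n. (shift ^^ n) x \<in> U \<inter> window A N}" for N
  have [measurable]: "U \<in> sets (tms_M A)" "window A N \<in> sets (tms_M A)" for N
    using U by (simp_all add: sets_tms_M)
  have "{x \<in> space (tms_M A). \<exists>n. (shift ^^ n) x \<in> U \<inter> window A N} \<in> sets (tms_M A)" for N by measurable
  then have H: "H N \<in> sets \<mu>" for N by (simp add: H_def sets_mu sets_tms_M)
  have le_N: "q1 * emeasure \<mu> (B1 \<inter> H N) \<le> q2 * emeasure \<mu> (B2 \<inter> H N)" for N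
  proof -
    obtain W' where W': "W' \<in> tms_sets A" "W' \<subseteq> U"
      and em: "\<And>B. B \<in> tms_sets A \<Longrightarrow> emeasure \<mu> (B \<inter> H N) = (\<integral>\<^sup>+x. Gp (indicator B) x * indicator W' x \<partial>\<mu>)"
      using emeasure_hitting[OF U, of N] unfolding H_def by blast
    have m: "(\<lambda>x. Gp (indicator B) x * indicator W' x) \<in> borel_measurable \<mu>" if "B \<in> tms_sets A" for B
    proof -
      have [measurable]: "B \<in> sets (tms_M A)" "W' \<in> sets (tms_M A)" using that W' by (simp_all add: sets_tms_M)
      show ?thesis unfolding measurable_mu by measurable
    qed
    have "q1 * emeasure \<mu> (B1 \<inter> H N) = (\<integral>\<^sup>+x. q1 * (Gp (indicator B1) x * indicator W' x) \<partial>\<mu>)"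
      unfolding em[OF B(1)] by (rule nn_integral_cmult[symmetric, OF m[OF B(1)]])
    also have "\<dots> \<le> (\<integral>\<^sup>+x. q2 * (Gp (indicator B2) x * indicator W' x) \<partial>\<mu>)"
      using le W'(2) by (intro nn_integral_mono) (auto simp: indicator_def)
    also have "\<dots> = q2 * emeasure \<mu> (B2 \<inter> H N)"
      unfolding em[OF B(2)] by (rule nn_integral_cmult[OF m[OF B(2)]])
    finally show ?thesis .
  qed
  have SUP: "emeasure \<mu> B = (SUP N. emeasure \<mu> (B \<inter> H N))" if B: "B \<in> tms_sets A" for B
  proof -
    have BH: "B \<inter> H N \<in> sets \<mu>" for N
      using B H by (intro sets.Int) (simp_all add: sets_mu)
    have "(SUP N. emeasure \<mu> (B \<inter> H N)) = emeasure \<mu> (\<Union>N. B \<inter> H N)"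
    proof (rule SUP_emeasure_incseq)
      show "range (\<lambda>N. B \<inter> H N) \<subseteq> sets \<mu>" using BH by blast
      have "H N \<subseteq> H N'" if "N \<le> N'" for N N'
        unfolding H_def using window_mono[OF that, of A] by blast
      then show "incseq (\<lambda>N. B \<inter> H N)"
        unfolding incseq_def by blast
    qed
    also have "\<dots> = emeasure \<mu> B"
    proof (rule emeasure_eq_AE)
      show "AE x in \<mu>. (x \<in> (\<Union>N. B \<inter> H N)) = (x \<in> B)"
        using hit
      proof (rule AE_mp, intro AE_I2 impI)
        fix x assume x: "x \<in> space \<mu>" "\<exists>n. (shift ^^ n) x \<in> U"
        then obtain n where n: "(shift ^^ n) x \<in> U" by blast
        have xt: "x \<in> tms A" using x by (simp add: space_mu)
        have "(shift ^^ n) x \<in> window A (Suc (to_nat ((shift ^^ n) x 0)))"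
          using funpow_shift_tms[OF xt] by (simp add: window_def)
        then have "x \<in> H (Suc (to_nat ((shift ^^ n) x 0)))" using n xt unfolding H_def by blast
        then show "(x \<in> (\<Union>N. B \<inter> H N)) = (x \<in> B)" by blast
      qed
      show "(\<Union>N. B \<inter> H N) \<in> sets \<mu>" using BH by (intro sets.countable_UN) blast
      show "B \<in> sets \<mu>" using B by (simp add: sets_mu)
    qed
    finally show ?thesis by simp
  qed
  have "q2 * emeasure \<mu> (B2 \<inter> H N) \<le> q2 * emeasure \<mu> B2" for N
    using B(2) by (intro mult_left_mono emeasure_mono) (simp_all add: sets_mu)
  then have "q1 * emeasure \<mu> (B1 \<inter> H N) \<le> q2 * emeasure \<mu> B2" for N
    by (rule order_trans[OF le_N])
  then have "(SUP N. q1 * emeasure \<mu> (B1 \<inter> H N)) \<le> q2 * emeasure \<mu> B2"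
    by (intro SUP_least)
  then show ?thesis
    unfolding SUP[OF B(1)] by (simp add: SUP_mult_left_ennreal)
qed

text \<open>Duality with \<open>h = 1\<close> turns a null cylinder \<open>[a]\<close> into a
  vanishing integral of its Green's function, since an infinite orbit sum on a null set contributes
  nothing. But that Green's function is positive everywhere.\<close>

lemma emeasure_single_pos:
  assumes "emeasure \<mu> (tms A) \<noteq> 0"
  shows "emeasure \<mu> (cyl A [a]) > 0"
proof (rule ccontr)
  assume "\<not> ?thesis"
  then have 0: "emeasure \<mu> (cyl A [a]) = 0" by simp
  let ?a = "indicator (cyl A [a]) :: _ \<Rightarrow> ennreal"
  have "(\<integral>\<^sup>+x. Gp ?a x * 1 \<partial>\<mu>) = (\<integral>\<^sup>+x. ?a x * (\<Sum>n. 1) \<partial>\<mu>)"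
    by (rule nn_integral_Gp_mult) measurable
  also have "\<dots> = 0"
    using 0 by (subst nn_integral_multc) (simp_all add: measurable_mu sets_mu)
  finally have "AE x in \<mu>. Gp ?a x = 0"
    by (subst (asm) nn_integral_0_iff_AE) (simp_all add: measurable_mu)
  then have "AE x in \<mu>. False"
  proof (rule AE_mp, intro AE_I2 impI)
    fix x assume "x \<in> space \<mu>" "Gp ?a x = 0"
    then show False using Gp_single_pos[of x a] by (simp add: space_mu)
  qed
  then show False using assms emeasure_space_zero_if_AE_False[of \<mu>] by (simp add: space_mu)
qed

text \<open>Duality moves the indicator of \<open>V\<close> to the other side composed with the
  shift, and invariance removes the shift again.\<close>

lemma restrict_invariant_Conf:
  assumes V: "V \<in> tms_sets A" and inv: "\<And>x. x \<in> tms A \<Longrightarrow> shift x \<in> V \<longleftrightarrow> x \<in> V"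
  shows "density \<mu> (indicator V) \<in> Conf A \<phi> lam"
proof -
  let ?\<nu> = "density \<mu> (indicator V)"
  have [measurable]: "V \<in> sets (tms_M A)" using V by (simp add: sets_tms_M)
  have em: "emeasure ?\<nu> B = emeasure \<mu> (V \<inter> B)" if "B \<in> tms_sets A" for B
    using that V by (intro emeasure_restricted) (simp_all add: sets_mu)
  have "radon_measure A ?\<nu>"
  proof (rule radon_measureI[OF lc])
    show "sets ?\<nu> = tms_sets A" by (simp add: sets_mu)
    show "emeasure ?\<nu> (cyl A [a]) < \<infinity>" for a
    proof -
      have "emeasure \<mu> (V \<inter> cyl A [a]) \<le> emeasure \<mu> (cyl A [a])" by (intro emeasure_mono) (auto simp: sets_mu)
      then show ?thesis using emeasure_single_finite[of a] by (simp add: em le_less_trans)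
    qed
  qed
  moreover have "(\<integral>\<^sup>+x. ennreal (ruelle A \<phi> (indicator K) x) \<partial>?\<nu>) = ennreal lam * emeasure ?\<nu> K"
    if K: "compactin (tms_top A) K" for K
  proof -
    have Ks: "K \<in> tms_sets A" by (rule compactin_tms_sets[OF K])
    then have [measurable]: "K \<in> sets (tms_M A)" by (simp add: sets_tms_M)
    obtain F where F: "finite F" "K \<subseteq> {x \<in> tms A. x 0 \<in> F}"
      using compactin_imp_finite_first_symbols[OF K] by blast
    have "fin_supp A (indicator K)"
      unfolding fin_supp_def using F by (intro exI[of _ F]) (auto simp: indicator_def)
    then have L: "ennreal (ruelle A \<phi> (indicator K) x) = Lp (indicator K) x" if "x \<in> tms A" for x
      using Lp_eq_ruelle[of "indicator K" x] that by (simp add: ennreal_indicator)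
    have "(\<integral>\<^sup>+x. ennreal (ruelle A \<phi> (indicator K) x) \<partial>?\<nu>) = (\<integral>\<^sup>+x. Lp (indicator K) x \<partial>?\<nu>)"
      by (intro nn_integral_cong) (simp add: L space_mu)
    also have "\<dots> = (\<integral>\<^sup>+x. indicator V x * Lp (indicator K) x \<partial>\<mu>)"
      by (intro nn_integral_density) (simp_all add: measurable_mu)
    also have "\<dots> = (\<integral>\<^sup>+x. Lp (indicator K) x * indicator V x \<partial>\<mu>)" by (simp add: mult.commute)
    also have "\<dots> = ennreal lam * (\<integral>\<^sup>+x. indicator K x * indicator V (shift x) \<partial>\<mu>)"
      by (rule nn_integral_Lp_mult) measurable
    also have "(\<integral>\<^sup>+x. indicator K x * indicator V (shift x) \<partial>\<mu>) = (\<integral>\<^sup>+x. indicator (V \<inter> K) x \<partial>\<mu>)"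
      by (intro nn_integral_cong) (auto simp: inv space_mu indicator_def)
    also have "\<dots> = emeasure \<mu> (V \<inter> K)"
      using V Ks by (intro nn_integral_indicator sets.Int) (simp_all add: sets_mu)
    finally show ?thesis by (simp add: em Ks)
  qed
  ultimately show ?thesis by (simp add: Conf_def)
qed

end

section \<open>Zero-one law and kernel approximation for extremal measures\<close>

locale extremal_conformal_measure = conformal_measure A \<phi> lam \<mu>
  for A :: "'s::countable \<Rightarrow> 's \<Rightarrow> bool" and \<phi> lam \<mu> +
  assumes extremal: "extremal A \<phi> lam \<mu>"
begin

text \<open>The restrictions to \<open>V\<close> and to its complement are conformal and add up to
  \<open>\<mu>\<close>. Extremality makes the first equal to \<open>c\<close> times
  \<open>\<mu>\<close>; evaluation on the complement shows that \<open>c = 0\<close> or the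
  complement is null.\<close>

lemma invariant_null_or_conull:
  assumes V: "V \<in> tms_sets A" and inv: "\<And>x. x \<in> tms A \<Longrightarrow> shift x \<in> V \<longleftrightarrow> x \<in> V"
  shows "emeasure \<mu> V = 0 \<or> emeasure \<mu> (tms A - V) = 0"
proof -
  let ?V' = "tms A - V"
  have V': "?V' \<in> tms_sets A" using V by (metis sets.compl_sets sets_mu space_mu)
  have inv': "shift x \<in> ?V' \<longleftrightarrow> x \<in> ?V'" if "x \<in> tms A" for x
    using inv[OF that] that shift_tms by blast
  have em: "emeasure (density \<mu> (indicator S)) B = emeasure \<mu> (S \<inter> B)"
    if "S \<in> tms_sets A" "B \<in> tms_sets A" for S B
    using that by (intro emeasure_restricted) (simp_all add: sets_mu)
  have "emeasure \<mu> B = emeasure (density \<mu> (indicator V)) B + emeasure (density \<mu> (indicator ?V')) B"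
    if B: "B \<in> sets \<mu>" for B
  proof -
    have "emeasure \<mu> (V \<inter> B) + emeasure \<mu> (?V' \<inter> B) = emeasure \<mu> ((V \<inter> B) \<union> (?V' \<inter> B))"
      using V V' B by (intro plus_emeasure) (auto simp: sets_mu[symmetric])
    also have "(V \<inter> B) \<union> (?V' \<inter> B) = B" using sets.sets_into_space[OF B] by (auto simp: space_mu)
    finally show ?thesis using V V' B by (simp add: em sets_mu)
  qed
  then have "proportional (density \<mu> (indicator V)) \<mu>"
    using extremal restrict_invariant_Conf[OF V inv] restrict_invariant_Conf[OF V' inv']
    unfolding extremal_def by blast
  then obtain c where c: "density \<mu> (indicator V) = scale_measure (ennreal c) \<mu>"
    unfolding proportional_def by blast
  have "ennreal c * emeasure \<mu> ?V' = emeasure (density \<mu> (indicator V)) ?V'" by (simp add: c)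
  also have "\<dots> = 0" using em[OF V V'] by simp
  finally have "ennreal c = 0 \<or> emeasure \<mu> ?V' = 0" by simp
  moreover have "emeasure \<mu> V = 0" if "ennreal c = 0"
    using em[OF V V] that by (simp add: c)
  ultimately show ?thesis by blast
qed

text \<open>Up to null sets these are the points visiting \<open>U\<close> infinitely often, because
  almost every orbit meets each window only finitely often.\<close>

definition escaping_visits :: "(nat \<Rightarrow> 's) set \<Rightarrow> (nat \<Rightarrow> 's) set" where
  "escaping_visits U = {x \<in> tms A. \<forall>N. \<exists>n. (shift ^^ n) x \<in> U \<and> (shift ^^ n) x \<notin> window A N}"

lemma escaping_visits_sets:
  assumes "U \<in> tms_sets A" shows "escaping_visits U \<in> tms_sets A"
proof -
  have [measurable]: "U \<in> sets (tms_M A)" "window A N \<in> sets (tms_M A)" for N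
    using assms by (simp_all add: sets_tms_M)
  have "{x \<in> space (tms_M A). \<forall>N. \<exists>n. (shift ^^ n) x \<in> U \<and> (shift ^^ n) x \<notin> window A N} \<in> sets (tms_M A)"
    by measurable
  then show ?thesis by (simp add: escaping_visits_def sets_tms_M)
qed

lemma escaping_visits_invariant:
  assumes x: "x \<in> tms A" shows "shift x \<in> escaping_visits U \<longleftrightarrow> x \<in> escaping_visits U"
proof
  assume S: "shift x \<in> escaping_visits U"
  have "\<exists>n. (shift ^^ n) x \<in> U \<and> (shift ^^ n) x \<notin> window A N" for N
  proof -
    obtain n where "(shift ^^ n) (shift x) \<in> U" "(shift ^^ n) (shift x) \<notin> window A N"
      using S unfolding escaping_visits_def by blast
    then show ?thesis by (intro exI[of _ "Suc n"]) (simp add: funpow_swap1)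
  qed
  then show "x \<in> escaping_visits U" using x by (simp add: escaping_visits_def)
next
  assume R: "x \<in> escaping_visits U"
  have "\<exists>n. (shift ^^ n) (shift x) \<in> U \<and> (shift ^^ n) (shift x) \<notin> window A N" for N
  proof -
    \<comment> \<open>Enlarging the window to contain \<open>x\<close> itself rules out
      \<open>n = 0\<close>, so the visit found also belongs to the orbit of
      \<open>shift x\<close>.\<close>
    let ?N = "max N (Suc (to_nat (x 0)))"
    obtain n where n: "(shift ^^ n) x \<in> U" "(shift ^^ n) x \<notin> window A ?N"
      using R unfolding escaping_visits_def by blast
    have "n \<noteq> 0"
    proof
      assume "n = 0"
      then show False using n(2) x by (simp add: window_def)
    qed
    then obtain j where "n = Suc j" by (cases n) auto
    moreover have "(shift ^^ n) x \<notin> window A N" using n(2) window_mono[of N ?N A] by auto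
    ultimately show ?thesis using n(1) by (intro exI[of _ j]) (simp add: funpow_swap1)
  qed
  then show "shift x \<in> escaping_visits U" using shift_tms[OF x] by (simp add: escaping_visits_def)
qed

text \<open>Otherwise every member would have null escaping visits by the zero-one law. Almost every
  orbit would then meet each of the finitely many members only inside some window, yet it leaves all
  windows and must be covered when it does.\<close>

lemma exists_conull_escaping_visits:
  assumes "finite \<U>" and \<U>: "\<And>U. U \<in> \<U> \<Longrightarrow> U \<in> tms_sets A"
    and cover: "tms A - window A N \<subseteq> \<Union>\<U>" and nz: "emeasure \<mu> (tms A) \<noteq> 0"
  shows "\<exists>U\<in>\<U>. AE x in \<mu>. x \<in> escaping_visits U"
proof (rule ccontr)
  assume not: "\<not> ?thesis"
  have null: "AE x in \<mu>. x \<notin> escaping_visits U" if U: "U \<in> \<U>" for U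
  proof -
    have R: "escaping_visits U \<in> tms_sets A" by (rule escaping_visits_sets[OF \<U>[OF U]])
    have "emeasure \<mu> (tms A - escaping_visits U) \<noteq> 0"
    proof
      assume "emeasure \<mu> (tms A - escaping_visits U) = 0"
      then have "AE x in \<mu>. x \<in> escaping_visits U"
        using R by (intro AE_I[of _ _ "tms A - escaping_visits U"]) (auto simp: space_mu sets_mu[symmetric] simp flip: space_mu)
      then show False using not U by blast
    qed
    then have "emeasure \<mu> (escaping_visits U) = 0"
      using invariant_null_or_conull[OF R escaping_visits_invariant] by blast
    then show ?thesis
      using R by (intro AE_I[of _ _ "escaping_visits U"]) (auto simp: sets_mu)
  qed
  have null_all: "AE x in \<mu>. \<forall>U\<in>\<U>. x \<notin> escaping_visits U"
    using null \<open>finite \<U>\<close> by (intro AE_finite_allI) auto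
  have contr: False
    if x: "x \<in> space \<mu>" and fin: "\<forall>b. finite {n. x n = b}" and nrec: "\<forall>U\<in>\<U>. x \<notin> escaping_visits U" for x
  proof -
    have xt: "x \<in> tms A" using x by (simp add: space_mu)
    have "\<exists>M. \<forall>n. (shift ^^ n) x \<in> U \<longrightarrow> (shift ^^ n) x \<in> window A M" if "U \<in> \<U>" for U
      using nrec that xt unfolding escaping_visits_def by blast
    then obtain M where M: "\<And>U n. U \<in> \<U> \<Longrightarrow> (shift ^^ n) x \<in> U \<Longrightarrow> (shift ^^ n) x \<in> window A (M U)"
      by metis
    define K where "K = Max (insert N (M ` \<U>))"
    have K: "N \<le> K" "\<And>U. U \<in> \<U> \<Longrightarrow> M U \<le> K"
      unfolding K_def using \<open>finite \<U>\<close> by (auto intro!: Max_ge)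
    have "finite (\<Union>b\<in>{s. to_nat s < K}. {n. x n = b})" using fin by simp
    then obtain n where n: "n \<notin> (\<Union>b\<in>{s. to_nat s < K}. {n. x n = b})"
      using infinite_UNIV_nat ex_new_if_finite by blast
    have out: "(shift ^^ n) x \<notin> window A K" using n by (auto simp: window_def funpow_shift)
    then have "(shift ^^ n) x \<in> \<Union>\<U>"
      using cover window_mono[OF K(1), of A] funpow_shift_tms[OF xt, of n] by blast
    then obtain U where U: "U \<in> \<U>" "(shift ^^ n) x \<in> U" by blast
    then show False using M[OF U] window_mono[OF K(2)[OF U(1)], of A] out by blast
  qed
  have "AE x in \<mu>. False"
    using null_all AE_finite_visits AE_space[of \<mu>] by eventually_elim (rule contr)
  then show False using nz emeasure_space_zero_if_AE_False[of \<mu>] by (simp add: space_mu)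
qed

lemma exists_kernel_approximation:
  assumes nz: "emeasure \<mu> (tms A) \<noteq> 0" and I: "finite I" "[] \<notin> I" and \<epsilon>: "\<epsilon> > 0"
  shows "\<exists>x\<in>tms A - window A N. \<forall>w\<in>I. \<bar>martin_kernel A \<phi> lam org (indicator (cyl A w)) x
      - measure \<mu> (cyl A w) / measure \<mu> (cyl A [org])\<bar> < \<epsilon>"
proof (rule ccontr)
  assume not: "\<not> ?thesis"
  define K where "K w x = martin_kernel A \<phi> lam org (indicator (cyl A w)) x" for w x
  define t where "t w = measure \<mu> (cyl A w) / measure \<mu> (cyl A [org])" for w
  define g where "g w x = green A \<phi> lam (indicator (cyl A w)) x" for w x
  have K: "K w x = g w x / g [org] x" for w x by (simp add: K_def g_def martin_kernel_def)
  have Gp: "Gp (indicator (cyl A w)) x = ennreal (g w x)" if "w \<noteq> []" "x \<in> tms A" for w x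
    using Gp_cyl_eq_green[OF that] by (simp add: g_def)
  have g0: "0 < g [org] x" if "x \<in> tms A" for x
    using green_single_pos[OF that] by (simp add: g_def)
  have gw: "0 \<le> g w x" if "w \<noteq> []" "x \<in> tms A" for w x
    using green_nonneg[OF bdd_fin_supp_cyl[OF that(1)] that(2)] by (simp add: g_def)
  have em: "emeasure \<mu> (cyl A w) = ennreal (measure \<mu> (cyl A w))" if "w \<noteq> []" for w
    using radon_measureD(4)[OF radon compactin_cyl[OF lc that]] by (intro emeasure_eq_ennreal_measure) simp
  have m0: "0 < measure \<mu> (cyl A [org])"
    using emeasure_single_pos[OF nz, of org] em[of "[org]"] by simp
  \<comment> \<open>A failure of the approximation at \<open>x\<close> puts \<open>x\<close> into
    one of these two half-spaces for some word of \<open>I\<close>.\<close>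
  define up where "up w = {x \<in> tms A. t w + \<epsilon> \<le> K w x}" for w
  define dn where "dn w = {x \<in> tms A. K w x \<le> t w - \<epsilon>}" for w
  have [measurable]: "K w \<in> borel_measurable (tms_M A)" if "w \<noteq> []" for w
  proof -
    \<comment> \<open>Measurability comes through the extended version, for which it is already
      known.\<close>
    have "(\<lambda>x. enn2real (Gp (indicator (cyl A w)) x) / enn2real (Gp (indicator (cyl A [org])) x))
        \<in> borel_measurable (tms_M A)" by measurable
    then show ?thesis
      by (rule measurable_cong[THEN iffD1, rotated])
        (simp add: Gp that K gw less_imp_le[OF g0])
  qed
  have sets: "up w \<in> tms_sets A" "dn w \<in> tms_sets A" if "w \<noteq> []" for w
  proof -
    note [measurable] = \<open>w \<noteq> [] \<Longrightarrow> K w \<in> borel_measurable (tms_M A)\<close>[OF that]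
    have "{x \<in> space (tms_M A). t w + \<epsilon> \<le> K w x} \<in> sets (tms_M A)"
      "{x \<in> space (tms_M A). K w x \<le> t w - \<epsilon>} \<in> sets (tms_M A)" by measurable
    then show "up w \<in> tms_sets A" "dn w \<in> tms_sets A" by (simp_all add: up_def dn_def sets_tms_M)
  qed
  have cover: "tms A - window A N \<subseteq> \<Union>(up ` I \<union> dn ` I)"
  proof
    fix x assume x: "x \<in> tms A - window A N"
    then obtain w where w: "w \<in> I" "\<not> \<bar>K w x - t w\<bar> < \<epsilon>"
      using not unfolding K_def t_def by blast
    then have "x \<in> up w \<or> x \<in> dn w" using x by (auto simp: up_def dn_def)
    then show "x \<in> \<Union>(up ` I \<union> dn ` I)" using w(1) by blast
  qed
  have "finite (up ` I \<union> dn ` I)" using I by simp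
  moreover have "U \<in> tms_sets A" if U: "U \<in> up ` I \<union> dn ` I" for U
  proof -
    obtain w where "w \<in> I" "U = up w \<or> U = dn w" using U by blast
    then show ?thesis using sets[of w] I(2) by metis
  qed
  ultimately obtain U where U: "U \<in> up ` I \<union> dn ` I" and rec: "AE x in \<mu>. x \<in> escaping_visits U"
    using exists_conull_escaping_visits[OF _ _ cover nz] by blast
  have hit: "AE x in \<mu>. \<exists>n. (shift ^^ n) x \<in> U"
    using rec by eventually_elim (auto simp: escaping_visits_def)
  have "U \<noteq> {}"
  proof
    assume "U = {}"
    then have "AE x in \<mu>. False" using hit by simp
    then show False using nz emeasure_space_zero_if_AE_False[of \<mu>] by (simp add: space_mu)
  qed
  then obtain z where z: "z \<in> U" by blast
  from U obtain w where w: "w \<in> I" "U = up w \<or> U = dn w" by blast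
  have wn: "w \<noteq> []" using w I by blast
  have t0: "0 \<le> t w" by (simp add: t_def)
  have tm: "measure \<mu> (cyl A w) = t w * measure \<mu> (cyl A [org])" using m0 by (simp add: t_def)
  from w(2) show False
  proof
    assume Uw: "U = up w"
    define s where "s = t w + \<epsilon>"
    have s: "0 \<le> s" "t w < s" using t0 \<epsilon> by (simp_all add: s_def)
    \<comment> \<open>On \<open>U\<close> the Green's function of \<open>w\<close> is at least
      \<open>s\<close> times that of the origin. The same inequality for the measures contradicts
      \<open>t w < s\<close>, as the origin cylinder has positive measure.\<close>
    have "ennreal s * emeasure \<mu> (cyl A [org]) \<le> 1 * emeasure \<mu> (cyl A w)"
    proof (rule measure_compare[of U])
      fix x assume "x \<in> U"
      then have x: "x \<in> tms A" "s \<le> g w x / g [org] x" by (auto simp: Uw up_def K s_def)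
      then have "s * g [org] x \<le> g w x" using g0[OF x(1)] by (simp add: pos_le_divide_eq)
      then show "ennreal s * Gp (indicator (cyl A [org])) x \<le> 1 * Gp (indicator (cyl A w)) x"
        using x(1) wn s g0[OF x(1)] by (simp add: Gp ennreal_leI flip: ennreal_mult)
    qed (use sets[OF wn] Uw hit in auto)
    then have "ennreal (s * measure \<mu> (cyl A [org])) \<le> ennreal (t w * measure \<mu> (cyl A [org]))"
      using s wn by (simp add: em tm flip: ennreal_mult)
    then have "s * measure \<mu> (cyl A [org]) \<le> t w * measure \<mu> (cyl A [org])"
      using t0 by (subst (asm) ennreal_le_iff) simp_all
    then show False using m0 s by simp
  next
    assume Uw: "U = dn w"
    define s where "s = t w - \<epsilon>"
    \<comment> \<open>A point \<open>z\<close> of the half-space shows that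
      \<open>t w - \<epsilon>\<close> is nonnegative, so that \<open>ennreal s\<close> loses
      nothing.\<close>
    have "0 \<le> K w z" "K w z \<le> s" using z gw[OF wn, of z] g0[of z] by (auto simp: Uw dn_def K s_def)
    then have s: "0 \<le> s" "s < t w" using \<epsilon> by (simp_all add: s_def)
    have "1 * emeasure \<mu> (cyl A w) \<le> ennreal s * emeasure \<mu> (cyl A [org])"
    proof (rule measure_compare[of U])
      fix x assume "x \<in> U"
      then have x: "x \<in> tms A" "g w x / g [org] x \<le> s" by (auto simp: Uw dn_def K s_def)
      then have "g w x \<le> s * g [org] x" using g0[OF x(1)] by (simp add: pos_divide_le_eq)
      then show "1 * Gp (indicator (cyl A w)) x \<le> ennreal s * Gp (indicator (cyl A [org])) x"
        using x(1) wn s g0[OF x(1)] by (simp add: Gp ennreal_leI flip: ennreal_mult)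
    qed (use sets[OF wn] Uw hit in auto)
    then have "ennreal (t w * measure \<mu> (cyl A [org])) \<le> ennreal (s * measure \<mu> (cyl A [org]))"
      using s wn by (simp add: em tm flip: ennreal_mult)
    then have "t w * measure \<mu> (cyl A [org]) \<le> s * measure \<mu> (cyl A [org])"
      using s by (subst (asm) ennreal_le_iff) simp_all
    then show False using m0 s by simp
  qed
qed

end

section \<open>The Martin boundary\<close>

locale martin_compactification = transient_tms A \<phi> lam
  for A :: "'s::countable \<Rightarrow> 's \<Rightarrow> bool" and \<phi> lam +
  fixes org :: 's and w :: "nat \<Rightarrow> 's list" and C :: "nat \<Rightarrow> real"
    and Xh :: "'b metric" and \<iota> :: "(nat \<Rightarrow> 's) \<Rightarrow> 'b"
  assumes words: "word_enumeration A w"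
    and bounds: "kernel_bounds A \<phi> lam org w C"
    and completion: "is_completion (tms A) (martin_dist A \<phi> lam org w C) Xh \<iota>"
begin

abbreviation K :: "((nat \<Rightarrow> 's) \<Rightarrow> real) \<Rightarrow> (nat \<Rightarrow> 's) \<Rightarrow> real" where
  "K \<equiv> martin_kernel A \<phi> lam org"

abbreviation Kc :: "'s list \<Rightarrow> (nat \<Rightarrow> 's) \<Rightarrow> real" where
  "Kc v \<equiv> K (indicator (cyl A v))"

section \<open>The Martin kernel as a positive linear functional\<close>

lemma kernel_sum:
  assumes "\<And>i. i \<in> I \<Longrightarrow> bdd_fin_supp A (f i)" "x \<in> tms A" "finite I"
  shows "K (\<lambda>x. \<Sum>i\<in>I. c i * f i x) x = (\<Sum>i\<in>I. c i * K (f i) x)"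
proof -
  have "green A \<phi> lam (\<lambda>x. \<Sum>i\<in>I. c i * f i x) x = (\<Sum>i\<in>I. c i * green A \<phi> lam (f i) x)"
    by (rule green_sum[OF assms])
  then show ?thesis by (simp add: martin_kernel_def sum_divide_distrib)
qed

lemma kernel_mono:
  assumes "bdd_fin_supp A f" "bdd_fin_supp A g" "x \<in> tms A" "\<And>y. y \<in> tms A \<Longrightarrow> f y \<le> g y"
  shows "K f x \<le> K g x"
  unfolding martin_kernel_def
  using green_mono[OF assms] green_single_pos[OF assms(3), of org] by (intro divide_right_mono) auto

lemma kernel_cong:
  assumes "x \<in> tms A" "\<And>y. y \<in> tms A \<Longrightarrow> f y = g y"
  shows "K f x = K g x"
  unfolding martin_kernel_def using green_cong[OF assms] by simp

lemma kernel_lin: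
  assumes "bdd_fin_supp A f" "bdd_fin_supp A g" "x \<in> tms A"
  shows "K (\<lambda>x. c * f x + d * g x) x = c * K f x + d * K g x"
proof -
  have "K (\<lambda>x. \<Sum>b\<in>UNIV. (if b then c else d) * (if b then f else g) x) x
      = (\<Sum>b\<in>UNIV. (if b then c else d) * K (if b then f else g) x)"
    using assms by (intro kernel_sum) auto
  then show ?thesis by (simp add: UNIV_bool add.commute)
qed

lemma kernel_cyl_nonneg: "v \<noteq> [] \<Longrightarrow> x \<in> tms A \<Longrightarrow> 0 \<le> Kc v x"
  unfolding martin_kernel_def
  using green_nonneg[OF bdd_fin_supp_cyl, of v x] green_single_pos[of x org] by (intro divide_nonneg_nonneg) auto

lemma word_admissible: "i \<ge> 1 \<Longrightarrow> w i \<in> admissible_words A" "i \<ge> 1 \<Longrightarrow> w i \<noteq> []"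
  using words unfolding word_enumeration_def bij_betw_def by (auto simp: admissible_words_def)

lemma admissible_word: "v \<in> admissible_words A \<Longrightarrow> \<exists>i\<ge>1. v = w i"
  using words unfolding word_enumeration_def bij_betw_def by force

lemma bound_pos: "i \<ge> 1 \<Longrightarrow> 0 < C i"
  using bounds by (simp add: kernel_bounds_def)

lemma kernel_le_bound: "i \<ge> 1 \<Longrightarrow> x \<in> tms A \<Longrightarrow> Kc (w i) x \<le> C i"
  using bounds by (simp add: kernel_bounds_def)

lemma kernel_word_nonneg: "i \<ge> 1 \<Longrightarrow> x \<in> tms A \<Longrightarrow> 0 \<le> Kc (w i) x"
  by (simp add: kernel_cyl_nonneg word_admissible)

text \<open>Linearity and monotonicity of the kernel carry the approximation of \<open>f\<close> by
  step functions over to \<open>K f\<close>, with an error uniform in \<open>x\<close> once the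
  one-letter kernels are bounded.\<close>

lemma Cc_kernel_approx:
  assumes f: "f \<in> Cc A"
  obtains F where "finite F" "bdd_fin_supp A f"
    "\<forall>\<epsilon>>0. \<exists>W c. finite W \<and> W \<subseteq> admissible_words A \<and>
        (\<forall>x\<in>tms A. \<bar>f x - (\<Sum>v\<in>W. c v * indicator (cyl A v) x)\<bar> \<le> \<epsilon> * (\<Sum>a\<in>F. indicator (cyl A [a]) x) \<and>
          \<bar>K f x - (\<Sum>v\<in>W. c v * Kc v x)\<bar> \<le> \<epsilon> * (\<Sum>a\<in>F. Kc [a] x))"
proof -
  obtain F where F: "finite F"
    and ap: "\<forall>\<epsilon>>0. \<exists>W c. finite W \<and> W \<subseteq> admissible_words A \<and>
        (\<forall>x\<in>tms A. \<bar>f x - (\<Sum>v\<in>W. c v * indicator (cyl A v) x)\<bar> \<le> \<epsilon> * indicator F (x 0))"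
    by (rule Cc_approx[OF lc f])
  have ind: "indicator F (x 0) = (\<Sum>a\<in>F. indicator (cyl A [a]) x :: real)" if "x \<in> tms A" for x
  proof -
    have "(\<Sum>a\<in>F. indicator (cyl A [a]) x :: real) = (\<Sum>a\<in>F. if a = x 0 then 1 else 0)"
      using that by (intro sum.cong) (auto simp: cyl_single)
    then show ?thesis using F by (simp add: indicator_def)
  qed
  have bs: "bdd_fin_supp A (\<lambda>x. \<Sum>v\<in>W. c v * indicator (cyl A v) x)" if "W \<subseteq> admissible_words A" for W c
    using that by (intro bdd_fin_supp_sum bdd_fin_supp_cyl) (auto simp: admissible_words_def)
  have bf: "bdd_fin_supp A f"
  proof -
    obtain W c where W: "finite W" "W \<subseteq> admissible_words A"
      "\<forall>x\<in>tms A. \<bar>f x - (\<Sum>v\<in>W. c v * indicator (cyl A v) x)\<bar> \<le> 1 * indicator F (x 0)"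
      using ap[rule_format, OF zero_less_one] by (elim exE conjE)
    let ?d = "\<lambda>x. f x - (\<Sum>v\<in>W. c v * indicator (cyl A v) x)"
    have "bdd_fin_supp A ?d"
      unfolding bdd_fin_supp_def using F W(3) by blast
    from bdd_fin_supp_lin[OF this bs[OF W(2), of c], of 1 1] show ?thesis by simp
  qed
  show thesis
  proof (rule that[OF F bf], intro allI impI)
    fix \<epsilon> :: real assume "\<epsilon> > 0"
    from ap[rule_format, OF this] obtain W c where W: "finite W" "W \<subseteq> admissible_words A"
      and "\<forall>x\<in>tms A. \<bar>f x - (\<Sum>v\<in>W. c v * indicator (cyl A v) x)\<bar> \<le> \<epsilon> * indicator F (x 0)"
      by (elim exE conjE)
    note le = bspec[OF this(3)]
    let ?s = "\<lambda>x. \<Sum>v\<in>W. c v * indicator (cyl A v) x"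
    let ?e = "\<lambda>x. \<Sum>a\<in>F. \<epsilon> * indicator (cyl A [a]) x :: real"
    have be: "bdd_fin_supp A ?e" by (intro bdd_fin_supp_sum bdd_fin_supp_cyl) simp
    have le': "\<bar>f x - ?s x\<bar> \<le> ?e x" if "x \<in> tms A" for x
      using le[OF that] ind[OF that] by (simp add: sum_distrib_left)
    have "\<bar>K f x - (\<Sum>v\<in>W. c v * Kc v x)\<bar> \<le> \<epsilon> * (\<Sum>a\<in>F. Kc [a] x)" if x: "x \<in> tms A" for x
    proof -
      have s: "K ?s x = (\<Sum>v\<in>W. c v * Kc v x)"
        using W x by (intro kernel_sum bdd_fin_supp_cyl) (auto simp: admissible_words_def)
      have e: "K ?e x = \<epsilon> * (\<Sum>a\<in>F. Kc [a] x)"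
        using kernel_sum[of F "\<lambda>a. indicator (cyl A [a])" x "\<lambda>_. \<epsilon>"] x F
        by (simp add: bdd_fin_supp_cyl sum_distrib_left)
      have "K f x \<le> K (\<lambda>x. 1 * ?s x + 1 * ?e x) x"
      proof (rule kernel_mono[OF bf bdd_fin_supp_lin[OF bs[OF W(2)] be] x])
        show "f y \<le> 1 * ?s y + 1 * ?e y" if "y \<in> tms A" for y
          using le'[OF that] by linarith
      qed
      moreover have "K (\<lambda>x. 1 * ?s x + (-1) * ?e x) x \<le> K f x"
      proof (rule kernel_mono[OF bdd_fin_supp_lin[OF bs[OF W(2)] be] bf x])
        show "1 * ?s y + (-1) * ?e y \<le> f y" if "y \<in> tms A" for y
          using le'[OF that] by linarith
      qed
      ultimately show ?thesis
        unfolding kernel_lin[OF bs[OF W(2)] be x] s e by linarith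
    qed
    then show "\<exists>W c. finite W \<and> W \<subseteq> admissible_words A \<and>
        (\<forall>x\<in>tms A. \<bar>f x - (\<Sum>v\<in>W. c v * indicator (cyl A v) x)\<bar> \<le> \<epsilon> * (\<Sum>a\<in>F. indicator (cyl A [a]) x) \<and>
          \<bar>K f x - (\<Sum>v\<in>W. c v * Kc v x)\<bar> \<le> \<epsilon> * (\<Sum>a\<in>F. Kc [a] x))"
      using W le ind by (intro exI[of _ W] exI[of _ c]) simp
  qed
qed

section \<open>The Martin metric and extension of the kernels\<close>

definition dist_term :: "nat \<Rightarrow> (nat \<Rightarrow> 's) \<Rightarrow> (nat \<Rightarrow> 's) \<Rightarrow> real" where
  "dist_term i x y = (\<bar>Kc (w i) x - Kc (w i) y\<bar> + \<bar>indicator (cyl A (w i)) x - indicator (cyl A (w i)) y\<bar>)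
     / (2 ^ i * (C i + 1))"

lemma martin_dist_eq: "martin_dist A \<phi> lam org w C x y = (\<Sum>j. dist_term (Suc j) x y)"
  unfolding martin_dist_def dist_term_def Let_def ..

lemma dist_term_nonneg: "i \<ge> 1 \<Longrightarrow> 0 \<le> dist_term i x y"
  unfolding dist_term_def using bound_pos[of i] by simp

lemma dist_term_le:
  assumes "i \<ge> 1" "\<bar>Kc (w i) x - Kc (w i) y\<bar> \<le> C i"
  shows "dist_term i x y \<le> (1/2) ^ i"
proof -
  have "\<bar>indicator (cyl A (w i)) x - indicator (cyl A (w i)) y\<bar> \<le> (1::real)"
    by (auto simp: indicator_def)
  then have "dist_term i x y \<le> (C i + 1) / (2 ^ i * (C i + 1))"
    unfolding dist_term_def using assms bound_pos[OF assms(1)] by (intro divide_right_mono) auto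
  then show ?thesis using bound_pos[OF assms(1)] by (simp add: power_divide)
qed

lemma kernel_diff_le_bound:
  assumes "i \<ge> 1" "x \<in> tms A" "y \<in> tms A"
  shows "\<bar>Kc (w i) x - Kc (w i) y\<bar> \<le> C i"
  using kernel_le_bound[OF assms(1,2)] kernel_le_bound[OF assms(1,3)]
    kernel_word_nonneg[OF assms(1,2)] kernel_word_nonneg[OF assms(1,3)] by linarith

lemma summable_half_Suc: "summable (\<lambda>j. (1/2::real) ^ Suc j)"
  using power_half_series by (rule sums_summable)

lemma summable_dist_term:
  assumes "x \<in> tms A" "y \<in> tms A"
  shows "summable (\<lambda>j. dist_term (Suc j) x y)"
proof (rule summable_comparison_test'[OF summable_half_Suc, of 0])
  show "norm (dist_term (Suc j) x y) \<le> (1/2) ^ Suc j" for j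
    using dist_term_le[OF _ kernel_diff_le_bound[OF _ assms], of "Suc j"] dist_term_nonneg[of "Suc j" x y]
    by (simp only: real_norm_def abs_of_nonneg)
qed

lemma dist_term_le_martin_dist:
  assumes "x \<in> tms A" "y \<in> tms A" "i \<ge> 1"
  shows "dist_term i x y \<le> martin_dist A \<phi> lam org w C x y"
  unfolding martin_dist_eq
  using sum_le_suminf[OF summable_dist_term[OF assms(1,2)], of "{i - 1}"] dist_term_nonneg assms(3) by simp

text \<open>A single summand of the metric already controls the kernel of its word.\<close>

lemma kernel_word_Lipschitz:
  assumes "x \<in> tms A" "y \<in> tms A" "i \<ge> 1"
  shows "\<bar>Kc (w i) x - Kc (w i) y\<bar> \<le> 2 ^ i * (C i + 1) * martin_dist A \<phi> lam org w C x y"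
proof -
  have pos: "0 < 2 ^ i * (C i + 1)" using bound_pos[OF assms(3)] by simp
  have "\<bar>Kc (w i) x - Kc (w i) y\<bar> / (2 ^ i * (C i + 1)) \<le> dist_term i x y"
    unfolding dist_term_def using pos by (intro divide_right_mono) auto
  also have "\<dots> \<le> martin_dist A \<phi> lam org w C x y" by (rule dist_term_le_martin_dist[OF assms])
  finally show ?thesis using pos by (simp add: pos_divide_le_eq mult.commute)
qed

lemma kernel_admissible_Lipschitz:
  assumes "v \<in> admissible_words A"
  obtains B where "0 \<le> B"
    "\<And>x y. x \<in> tms A \<Longrightarrow> y \<in> tms A \<Longrightarrow> \<bar>Kc v x - Kc v y\<bar> \<le> B * martin_dist A \<phi> lam org w C x y"
proof -
  obtain i where i: "i \<ge> 1" "v = w i" using admissible_word[OF assms] by blast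
  show thesis
    by (rule that[of "2 ^ i * (C i + 1)"])
      (use kernel_word_Lipschitz i bound_pos[OF i(1)] in auto)
qed

lemma kernel_admissible_bound:
  assumes "v \<in> admissible_words A"
  obtains B where "0 \<le> B" "\<And>x. x \<in> tms A \<Longrightarrow> Kc v x \<le> B"
proof -
  obtain i where i: "i \<ge> 1" "v = w i" using admissible_word[OF assms] by blast
  show thesis
    by (rule that[of "C i"]) (use kernel_le_bound i bound_pos[OF i(1)] in auto)
qed

lemma sum_single_kernel_bound:
  assumes "finite F"
  obtains M where "0 < M" "\<And>x. x \<in> tms A \<Longrightarrow> (\<Sum>a\<in>F. Kc [a] x) \<le> M"
proof -
  have "\<exists>B. 0 \<le> B \<and> (\<forall>x\<in>tms A. Kc [a] x \<le> B)" for a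
    by (rule kernel_admissible_bound[OF single_admissible[of a]]) auto
  then obtain B where B: "\<And>a. 0 \<le> B a" "\<And>a x. x \<in> tms A \<Longrightarrow> Kc [a] x \<le> B a" by metis
  show thesis
  proof (rule that[of "sum B F + 1"])
    show "0 < sum B F + 1" using B(1) by (simp add: sum_nonneg add_nonneg_pos)
    show "(\<Sum>a\<in>F. Kc [a] x) \<le> sum B F + 1" if "x \<in> tms A" for x
      using sum_mono[of F "\<lambda>a. Kc [a] x" B] B(2)[OF that] by fastforce
  qed
qed

text \<open>Kernels of words are Lipschitz for the Martin metric, hence so are finite linear
  combinations, and \<open>K f\<close> is a uniform limit of these.\<close>

lemma kernel_uniformly_continuous:
  assumes f: "f \<in> Cc A" and \<epsilon>: "\<epsilon> > 0"
  shows "\<exists>\<delta>>0. \<forall>x\<in>tms A. \<forall>y\<in>tms A. martin_dist A \<phi> lam org w C x y < \<delta> \<longrightarrow> \<bar>K f x - K f y\<bar> < \<epsilon>"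
proof -
  obtain F where F: "finite F" and "bdd_fin_supp A f" and ap: "\<forall>\<epsilon>>0. \<exists>W c. finite W \<and> W \<subseteq> admissible_words A \<and>
        (\<forall>x\<in>tms A. \<bar>f x - (\<Sum>v\<in>W. c v * indicator (cyl A v) x)\<bar> \<le> \<epsilon> * (\<Sum>a\<in>F. indicator (cyl A [a]) x) \<and>
          \<bar>K f x - (\<Sum>v\<in>W. c v * Kc v x)\<bar> \<le> \<epsilon> * (\<Sum>a\<in>F. Kc [a] x))"
    by (rule Cc_kernel_approx[OF f])
  obtain M where M: "0 < M" "\<And>x. x \<in> tms A \<Longrightarrow> (\<Sum>a\<in>F. Kc [a] x) \<le> M"
    using sum_single_kernel_bound[OF F] by blast
  have "0 < \<epsilon> / (3 * M)" using \<epsilon> M(1) by simp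
  from ap[rule_format, OF this] obtain W c where W: "finite W" "W \<subseteq> admissible_words A"
    and appr: "\<forall>x\<in>tms A. \<bar>f x - (\<Sum>v\<in>W. c v * indicator (cyl A v) x)\<bar> \<le> \<epsilon> / (3 * M) * (\<Sum>a\<in>F. indicator (cyl A [a]) x) \<and>
      \<bar>K f x - (\<Sum>v\<in>W. c v * Kc v x)\<bar> \<le> \<epsilon> / (3 * M) * (\<Sum>a\<in>F. Kc [a] x)"
    by (elim exE conjE)
  note le = conjunct2[OF bspec[OF appr]]
  have le': "\<bar>K f x - (\<Sum>v\<in>W. c v * Kc v x)\<bar> \<le> \<epsilon> / 3" if "x \<in> tms A" for x
  proof -
    have "\<epsilon> / (3 * M) * (\<Sum>a\<in>F. Kc [a] x) \<le> \<epsilon> / (3 * M) * M"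
      using M \<epsilon> that by (intro mult_left_mono) auto
    then show ?thesis using le[OF that] M(1) by simp
  qed
  have "\<exists>B. 0 \<le> B \<and> (\<forall>x\<in>tms A. \<forall>y\<in>tms A. \<bar>Kc v x - Kc v y\<bar> \<le> B * martin_dist A \<phi> lam org w C x y)"
    if "v \<in> W" for v
  proof -
    have "v \<in> admissible_words A" using W(2) that by blast
    then obtain B where "0 \<le> B" "\<And>x y. x \<in> tms A \<Longrightarrow> y \<in> tms A
        \<Longrightarrow> \<bar>Kc v x - Kc v y\<bar> \<le> B * martin_dist A \<phi> lam org w C x y"
      using kernel_admissible_Lipschitz by blast
    then show ?thesis by (intro exI[of _ B]) simp
  qed
  then obtain B where B: "\<And>v. v \<in> W \<Longrightarrow> 0 \<le> B v"
    "\<And>v x y. v \<in> W \<Longrightarrow> x \<in> tms A \<Longrightarrow> y \<in> tms A \<Longrightarrow> \<bar>Kc v x - Kc v y\<bar> \<le> B v * martin_dist A \<phi> lam org w C x y"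
    by metis
  define D where "D = (\<Sum>v\<in>W. \<bar>c v\<bar> * B v)"
  have D: "0 \<le> D" unfolding D_def using B(1) by (intro sum_nonneg) simp
  have "\<bar>K f x - K f y\<bar> < \<epsilon>"
    \<comment> \<open>The radius gives the step function an oscillation below
      \<open>\<epsilon>/3\<close>; the added 1 guards against \<open>D = 0\<close>. Two
      approximation errors take the other two thirds.\<close>
    if x: "x \<in> tms A" and y: "y \<in> tms A" and d: "martin_dist A \<phi> lam org w C x y < \<epsilon> / (3 * (D + 1))" for x y
  proof -
    have "\<bar>(\<Sum>v\<in>W. c v * Kc v x) - (\<Sum>v\<in>W. c v * Kc v y)\<bar> = \<bar>\<Sum>v\<in>W. c v * (Kc v x - Kc v y)\<bar>"
      by (simp add: sum_subtractf right_diff_distrib)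
    also have "\<dots> \<le> (\<Sum>v\<in>W. \<bar>c v * (Kc v x - Kc v y)\<bar>)" by (rule sum_abs)
    also have "\<dots> \<le> (\<Sum>v\<in>W. \<bar>c v\<bar> * (B v * martin_dist A \<phi> lam org w C x y))"
      using B(2) x y by (intro sum_mono) (simp add: abs_mult mult_left_mono)
    also have "\<dots> = D * martin_dist A \<phi> lam org w C x y"
      by (simp add: D_def sum_distrib_right mult.assoc)
    also have "\<dots> \<le> D * (\<epsilon> / (3 * (D + 1)))" using d D by (intro mult_left_mono) auto
    also have "\<dots> < \<epsilon> / 3" using D \<epsilon> by (simp add: field_simps)
    finally show ?thesis using le'[OF x] le'[OF y] by linarith
  qed
  moreover have "0 < \<epsilon> / (3 * (D + 1))" using \<epsilon> D by simp
  ultimately show ?thesis by blast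
qed

text \<open>A uniformly continuous function on a dense subset is Cauchy continuous and hence extends
  continuously to the closure.\<close>

lemma kernel_extension:
  assumes f: "f \<in> Cc A"
  obtains g where "continuous_map (mtopology_of Xh) euclideanreal g"
    "\<And>x. x \<in> tms A \<Longrightarrow> g (\<iota> x) = K f x"
proof -
  have \<iota>: "\<iota> ` tms A \<subseteq> mspace Xh"
    and isom: "\<And>x y. x \<in> tms A \<Longrightarrow> y \<in> tms A \<Longrightarrow> mdist Xh (\<iota> x) (\<iota> y) = martin_dist A \<phi> lam org w C x y"
    and dense: "mtopology_of Xh closure_of (\<iota> ` tms A) = mspace Xh"
    using completion unfolding is_completion_def by auto
  define h where "h p = K f (inv_into (tms A) \<iota> p)" for p
  have "inv_into (tms A) \<iota> p \<in> tms A \<and> \<iota> (inv_into (tms A) \<iota> p) = p" if "p \<in> \<iota> ` tms A" for p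
    using that by (simp add: inv_into_into f_inv_into_f)
  note inv = this
  \<comment> \<open>Well-definedness: points with the same image are at Martin distance 0, and
    uniform continuity equates their kernels.\<close>
  have h: "h (\<iota> x) = K f x" if x: "x \<in> tms A" for x
  proof (rule ccontr)
    assume ne: "h (\<iota> x) \<noteq> K f x"
    let ?x = "inv_into (tms A) \<iota> (\<iota> x)"
    have x': "?x \<in> tms A" "\<iota> ?x = \<iota> x" using inv[of "\<iota> x"] x by auto
    have d0: "martin_dist A \<phi> lam org w C ?x x = 0"
    proof -
      have "\<iota> x \<in> mspace Xh" using \<iota> x by blast
      then have "mdist Xh (\<iota> x) (\<iota> x) = 0" by simp
      then show ?thesis using isom[OF x'(1) x] x'(2) by simp
    qed
    obtain \<delta>' where "\<delta>' > 0" "\<forall>u\<in>tms A. \<forall>y\<in>tms A. martin_dist A \<phi> lam org w C u y < \<delta>'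
        \<longrightarrow> \<bar>K f u - K f y\<bar> < \<bar>h (\<iota> x) - K f x\<bar>"
      using kernel_uniformly_continuous[OF f, of "\<bar>h (\<iota> x) - K f x\<bar>"] ne by auto
    then have "\<bar>K f ?x - K f x\<bar> < \<bar>h (\<iota> x) - K f x\<bar>" using x' x d0 by auto
    then show False by (simp add: h_def)
  qed
  have "uniformly_continuous_map (submetric Xh (\<iota> ` tms A)) euclidean_metric h"
    unfolding uniformly_continuous_map_def
  proof (intro conjI allI impI)
    fix \<epsilon> :: real assume "\<epsilon> > 0"
    then obtain \<delta> where "\<delta> > 0" "\<forall>x\<in>tms A. \<forall>y\<in>tms A. martin_dist A \<phi> lam org w C x y < \<delta>
        \<longrightarrow> \<bar>K f x - K f y\<bar> < \<epsilon>"
      using kernel_uniformly_continuous[OF f] by blast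
    then show "\<exists>\<delta>>0. \<forall>p\<in>mspace (submetric Xh (\<iota> ` tms A)). \<forall>q\<in>mspace (submetric Xh (\<iota> ` tms A)).
        mdist (submetric Xh (\<iota> ` tms A)) q p < \<delta> \<longrightarrow> mdist euclidean_metric (h q) (h p) < \<epsilon>"
      by (intro exI[of _ \<delta>]) (auto simp: h isom dist_real_def)
  qed auto
  then have "Cauchy_continuous_map (submetric Xh (\<iota> ` tms A)) euclidean_metric h"
    by (rule uniformly_imp_Cauchy_continuous_map)
  moreover have "mcomplete_of (euclidean_metric :: real metric)"
    by (simp add: mcomplete_of_def complete_UNIV)
  ultimately obtain g where g: "continuous_map (subtopology (mtopology_of Xh) (mtopology_of Xh closure_of (\<iota> ` tms A)))
      (mtopology_of euclidean_metric) g" "\<And>p. p \<in> \<iota> ` tms A \<Longrightarrow> g p = h p"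
    using Cauchy_continuous_map_extends_to_continuous_closure_of by metis
  have "continuous_map (mtopology_of Xh) euclideanreal g"
    using g(1) unfolding dense by (metis mtopology_of_euclidean mtopology_of_submetric submetric_mspace)
  then show thesis using g(2) h by (intro that) auto
qed

section \<open>Limits along escaping sequences\<close>

text \<open>Convergence on cylinders passes to step functions; the approximation error is uniform
  both for the kernels and for the limit measure.\<close>

lemma kernel_tendsto_integral:
  assumes x: "\<And>k. x k \<in> tms A"
    and conv: "\<And>v. v \<in> admissible_words A \<Longrightarrow> (\<lambda>k. Kc v (x k)) \<longlonglongrightarrow> measure \<nu> (cyl A v)"
    and \<nu>: "radon_measure A \<nu>" and f: "f \<in> Cc A"
  shows "(\<lambda>k. K f (x k)) \<longlonglongrightarrow> (\<integral>x. f x \<partial>\<nu>)"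
proof (rule LIMSEQ_I)
  fix \<epsilon> :: real assume \<epsilon>: "\<epsilon> > 0"
  obtain F where F: "finite F" and bf: "bdd_fin_supp A f" and ap: "\<forall>\<epsilon>>0. \<exists>W c. finite W \<and> W \<subseteq> admissible_words A \<and>
        (\<forall>x\<in>tms A. \<bar>f x - (\<Sum>v\<in>W. c v * indicator (cyl A v) x)\<bar> \<le> \<epsilon> * (\<Sum>a\<in>F. indicator (cyl A [a]) x) \<and>
          \<bar>K f x - (\<Sum>v\<in>W. c v * Kc v x)\<bar> \<le> \<epsilon> * (\<Sum>a\<in>F. Kc [a] x))"
    by (rule Cc_kernel_approx[OF f])
  obtain M where M: "0 < M" "\<And>x. x \<in> tms A \<Longrightarrow> (\<Sum>a\<in>F. Kc [a] x) \<le> M"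
    using sum_single_kernel_bound[OF F] by blast
  have "(\<lambda>k. \<Sum>a\<in>F. Kc [a] (x k)) \<longlonglongrightarrow> (\<Sum>a\<in>F. measure \<nu> (cyl A [a]))"
    by (intro tendsto_sum conv single_admissible)
  then have \<nu>M: "(\<Sum>a\<in>F. measure \<nu> (cyl A [a])) \<le> M"
    by (rule LIMSEQ_le_const2) (use M(2) x in auto)
  \<comment> \<open>\<open>M\<close> bounds the one-letter kernels and, in the limit, the one-letter
    measures. Both approximation errors are then at most \<open>\<epsilon>/4\<close>, and the
    convergence of the step functions takes a third quarter.\<close>
  define e where "e = \<epsilon> / (4 * M)"
  have e: "0 < e" "e * M = \<epsilon> / 4" using \<epsilon> M(1) by (simp_all add: e_def)
  from ap[rule_format, OF e(1)] obtain W c where W: "finite W" "W \<subseteq> admissible_words A"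
    and appr: "\<forall>x\<in>tms A. \<bar>f x - (\<Sum>v\<in>W. c v * indicator (cyl A v) x)\<bar> \<le> e * (\<Sum>a\<in>F. indicator (cyl A [a]) x) \<and>
      \<bar>K f x - (\<Sum>v\<in>W. c v * Kc v x)\<bar> \<le> e * (\<Sum>a\<in>F. Kc [a] x)"
    by (elim exE conjE)
  note \<nu>D = radon_measureD[OF \<nu>]
  have int_cyl: "integrable \<nu> (indicator (cyl A v) :: _ \<Rightarrow> real)" if "v \<noteq> []" for v
    using \<nu>D(4)[OF compactin_cyl[OF lc that]] by (intro integrable_real_indicator) (simp_all add: \<nu>D)
  have Wn: "v \<noteq> []" if "v \<in> W" for v using W(2) that by (auto simp: admissible_words_def)
  have int_s: "integrable \<nu> (\<lambda>x. \<Sum>v\<in>W. c v * indicator (cyl A v) x)"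
    using Wn by (intro Bochner_Integration.integrable_sum integrable_mult_right int_cyl)
  have s_eq: "(\<integral>x. (\<Sum>v\<in>W. c v * indicator (cyl A v) x) \<partial>\<nu>) = (\<Sum>v\<in>W. c v * measure \<nu> (cyl A v))"
    using Wn cyl_subset[of A] by (subst Bochner_Integration.integral_sum)
      (auto intro!: int_cyl sum.cong simp: \<nu>D Int_absorb2)
  have int_e: "integrable \<nu> (\<lambda>x. e * (\<Sum>a\<in>F. indicator (cyl A [a]) x))"
    by (intro integrable_mult_right Bochner_Integration.integrable_sum int_cyl) simp
  have e_eq: "(\<integral>x. e * (\<Sum>a\<in>F. indicator (cyl A [a]) x) \<partial>\<nu>) = e * (\<Sum>a\<in>F. measure \<nu> (cyl A [a]))"
    using cyl_subset[of A] by (simp add: Bochner_Integration.integral_sum int_cyl \<nu>D Int_absorb2)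
  have mf: "f \<in> borel_measurable \<nu>"
  proof -
    have "f \<in> borel_measurable (tms_M A)"
      using f by (intro continuous_imp_measurable) (simp add: Cc_def)
    then show ?thesis
      by (subst measurable_cong_sets[of \<nu> "tms_M A" borel borel]) (simp_all add: \<nu>D sets_tms_M)
  qed
  have int_d: "integrable \<nu> (\<lambda>x. f x - (\<Sum>v\<in>W. c v * indicator (cyl A v) x))"
  proof (rule Bochner_Integration.integrable_bound[OF int_e])
    show "(\<lambda>x. f x - (\<Sum>v\<in>W. c v * indicator (cyl A v) x)) \<in> borel_measurable \<nu>"
      using mf borel_measurable_integrable[OF int_s] by (rule borel_measurable_diff)
    show "AE x in \<nu>. norm (f x - (\<Sum>v\<in>W. c v * indicator (cyl A v) x))
        \<le> norm (e * (\<Sum>a\<in>F. indicator (cyl A [a]) x :: real))"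
    proof (rule AE_I2)
      fix x assume "x \<in> space \<nu>"
      then have "\<bar>f x - (\<Sum>v\<in>W. c v * indicator (cyl A v) x)\<bar> \<le> e * (\<Sum>a\<in>F. indicator (cyl A [a]) x)"
        using appr by (simp add: \<nu>D)
      then show "norm (f x - (\<Sum>v\<in>W. c v * indicator (cyl A v) x))
        \<le> norm (e * (\<Sum>a\<in>F. indicator (cyl A [a]) x :: real))" by simp
    qed
  qed
  have I1: "\<bar>(\<integral>x. f x \<partial>\<nu>) - (\<Sum>v\<in>W. c v * measure \<nu> (cyl A v))\<bar> \<le> \<epsilon> / 4"
  proof -
    have int_f: "integrable \<nu> f"
      using Bochner_Integration.integrable_add[OF int_d int_s] by simp
    have "(\<integral>x. f x \<partial>\<nu>) - (\<Sum>v\<in>W. c v * measure \<nu> (cyl A v))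
        = (\<integral>x. f x - (\<Sum>v\<in>W. c v * indicator (cyl A v) x) \<partial>\<nu>)"
      using Bochner_Integration.integral_diff[OF int_f int_s] s_eq by simp
    also have "\<bar>\<dots>\<bar> \<le> (\<integral>x. \<bar>f x - (\<Sum>v\<in>W. c v * indicator (cyl A v) x)\<bar> \<partial>\<nu>)"
      by (rule integral_abs_bound)
    also have "\<dots> \<le> (\<integral>x. e * (\<Sum>a\<in>F. indicator (cyl A [a]) x) \<partial>\<nu>)"
      using appr by (intro integral_mono integrable_abs int_d int_e) (simp add: \<nu>D)
    also have "\<dots> \<le> e * M" unfolding e_eq using \<nu>M e(1) by (intro mult_left_mono) auto
    finally show ?thesis using e(2) by simp
  qed
  have I2: "\<bar>K f (x k) - (\<Sum>v\<in>W. c v * Kc v (x k))\<bar> \<le> \<epsilon> / 4" for k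
  proof -
    have "\<bar>K f (x k) - (\<Sum>v\<in>W. c v * Kc v (x k))\<bar> \<le> e * (\<Sum>a\<in>F. Kc [a] (x k))"
      using appr x by blast
    also have "\<dots> \<le> e * M" using M(2)[OF x] e(1) by (intro mult_left_mono) auto
    finally show ?thesis using e(2) by simp
  qed
  have "(\<lambda>k. \<Sum>v\<in>W. c v * Kc v (x k)) \<longlonglongrightarrow> (\<Sum>v\<in>W. c v * measure \<nu> (cyl A v))"
    using W(2) by (intro tendsto_sum tendsto_mult_left conv) auto
  then obtain k0 where I3: "\<And>k. k \<ge> k0 \<Longrightarrow>
      \<bar>(\<Sum>v\<in>W. c v * Kc v (x k)) - (\<Sum>v\<in>W. c v * measure \<nu> (cyl A v))\<bar> < \<epsilon> / 4"
    using \<epsilon> unfolding LIMSEQ_iff real_norm_def by (meson divide_pos_pos zero_less_numeral)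
  have "norm (K f (x k) - (\<integral>x. f x \<partial>\<nu>)) < \<epsilon>" if "k \<ge> k0" for k
    using I1 I2[of k] I3[OF that] \<epsilon> unfolding real_norm_def by linarith
  then have "\<forall>k\<ge>k0. norm (K f (x k) - (\<integral>x. f x \<partial>\<nu>)) < \<epsilon>" by blast
  then show "\<exists>k0. \<forall>k\<ge>k0. norm (K f (x k) - (\<integral>x. f x \<partial>\<nu>)) < \<epsilon>" ..
qed

lemma martin_dist_Cauchy:
  assumes x: "\<And>k. x k \<in> tms A"
    and esc: "\<And>N. \<forall>\<^sub>F k in sequentially. x k \<notin> window A N"
    and conv: "\<And>i. i \<ge> 1 \<Longrightarrow> (\<lambda>k. Kc (w i) (x k)) \<longlonglongrightarrow> m i"
    and \<epsilon>: "\<epsilon> > 0"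
  shows "\<exists>k0. \<forall>k\<ge>k0. \<forall>l\<ge>k0. martin_dist A \<phi> lam org w C (x k) (x l) < \<epsilon>"
proof -
  \<comment> \<open>The \<open>i\<close>-th summand of the distance from \<open>x k\<close> to a
    fictitious limit with kernel values \<open>m i\<close> and all cylinder indicators equal to
    0.\<close>
  define a where "a i k = (\<bar>Kc (w i) (x k) - m i\<bar> + indicator (cyl A (w i)) (x k)) / (2 ^ i * (C i + 1))" for i k
  have m: "0 \<le> m i" "m i \<le> C i" if "i \<ge> 1" for i
    using LIMSEQ_le_const[OF conv[OF that]] LIMSEQ_le_const2[OF conv[OF that]]
      kernel_word_nonneg[OF that x] kernel_le_bound[OF that x] by blast+
  have a_nonneg: "0 \<le> a i k" if "i \<ge> 1" for i k
    unfolding a_def using bound_pos[OF that] by simp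
  have a_le: "a i k \<le> (1/2) ^ i" if i: "i \<ge> 1" for i k
  proof -
    have "\<bar>Kc (w i) (x k) - m i\<bar> \<le> C i"
      using m[OF i] kernel_word_nonneg[OF i x[of k]] kernel_le_bound[OF i x[of k]] by linarith
    moreover have "indicator (cyl A (w i)) (x k) \<le> (1::real)" by (simp add: indicator_def)
    ultimately have "\<bar>Kc (w i) (x k) - m i\<bar> + indicator (cyl A (w i)) (x k) \<le> C i + 1"
      by (rule add_mono)
    then have "a i k \<le> (C i + 1) / (2 ^ i * (C i + 1))"
      unfolding a_def using bound_pos[OF i] by (intro divide_right_mono) auto
    then show ?thesis using bound_pos[OF i] by (simp add: power_divide)
  qed
  have a0: "(\<lambda>k. a i k) \<longlonglongrightarrow> 0" if i: "i \<ge> 1" for i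
  proof -
    \<comment> \<open>Escape from a window containing the first letter of \<open>w i\<close> means
      leaving its cylinder for good.\<close>
    have "\<forall>\<^sub>F k in sequentially. indicator (cyl A (w i)) (x k) = (0::real)"
      using esc[of "Suc (to_nat (hd (w i)))"]
    proof eventually_elim
      case (elim k)
      have "x k 0 \<noteq> hd (w i)" using elim x[of k] by (auto simp: window_def)
      then show ?case
        using word_admissible(2)[OF i] by (auto simp: cyl_def hd_conv_nth indicator_def)
    qed
    then have ind: "(\<lambda>k. indicator (cyl A (w i)) (x k) :: real) \<longlonglongrightarrow> 0"
      by (rule tendsto_eventually)
    have "(\<lambda>k. \<bar>Kc (w i) (x k) - m i\<bar>) \<longlonglongrightarrow> \<bar>m i - m i\<bar>"
      by (intro tendsto_rabs tendsto_diff conv i tendsto_const)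
    from tendsto_divide[OF tendsto_add[OF this ind] tendsto_const, of "2 ^ i * (C i + 1)"]
    show ?thesis unfolding a_def using bound_pos[OF i] by simp
  qed
  have sum_a: "summable (\<lambda>j. a (Suc j) k)" for k
  proof (rule summable_comparison_test'[OF summable_half_Suc, of 0])
    show "norm (a (Suc j) k) \<le> (1/2) ^ Suc j" for j
      using a_le[of "Suc j" k] a_nonneg[of "Suc j" k] by (simp only: real_norm_def abs_of_nonneg)
  qed
  \<comment> \<open>Dominated convergence for series, with the geometric majorant that the
    normalisation by \<open>C i + 1\<close> provides.\<close>
  have "(\<lambda>k. \<Sum>j. a (Suc j) k) \<longlonglongrightarrow> (\<Sum>j. 0)"
  proof (rule conjunct2[OF conjunct2[OF tannerys_theorem[where M = "\<lambda>j. (1/2) ^ Suc j"]]])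
    show "(\<lambda>k. a (Suc j) k) \<longlonglongrightarrow> 0" for j by (rule a0) simp
    show "\<forall>\<^sub>F (j, k) in sequentially \<times>\<^sub>F sequentially. norm (a (Suc j) k) \<le> (1/2) ^ Suc j"
    proof (rule always_eventually, clarify)
      fix j k
      show "norm (a (Suc j) k) \<le> (1/2) ^ Suc j"
        using a_le[of "Suc j" k] a_nonneg[of "Suc j" k] by (simp only: real_norm_def abs_of_nonneg)
    qed
  qed (rule summable_half_Suc, simp)
  then have "\<forall>\<^sub>F k in sequentially. (\<Sum>j. a (Suc j) k) < \<epsilon> / 2"
    using \<epsilon> by (intro order_tendstoD(2)) auto
  then obtain k0 where k0: "\<And>k. k \<ge> k0 \<Longrightarrow> (\<Sum>j. a (Suc j) k) < \<epsilon> / 2"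
    by (auto simp: eventually_sequentially)
  have "martin_dist A \<phi> lam org w C (x k) (x l) < \<epsilon>" if "k \<ge> k0" "l \<ge> k0" for k l
  proof -
    have "dist_term i (x k) (x l) \<le> a i k + a i l" if i: "i \<ge> 1" for i
    proof -
      have "\<bar>indicator (cyl A (w i)) (x k) - indicator (cyl A (w i)) (x l)\<bar>
          \<le> (indicator (cyl A (w i)) (x k) + indicator (cyl A (w i)) (x l) :: real)"
        by (simp add: indicator_def)
      then show ?thesis
        unfolding dist_term_def a_def add_divide_distrib[symmetric]
        using bound_pos[OF i] by (intro divide_right_mono) auto
    qed
    then have "martin_dist A \<phi> lam org w C (x k) (x l) \<le> (\<Sum>j. a (Suc j) k + a (Suc j) l)"
      unfolding martin_dist_eq
      by (intro suminf_le summable_dist_term x summable_add sum_a) simp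
    also have "\<dots> = (\<Sum>j. a (Suc j) k) + (\<Sum>j. a (Suc j) l)"
      by (rule suminf_add[symmetric, OF sum_a sum_a])
    finally show ?thesis using k0[OF that(1)] k0[OF that(2)] by linarith
  qed
  then show ?thesis by blast
qed

lemma radon_measure_unique:
  assumes "radon_measure A \<nu>" "radon_measure A \<nu>'"
    and eq: "\<And>f. f \<in> Cc A \<Longrightarrow> (\<integral>x. f x \<partial>\<nu>) = (\<integral>x. f x \<partial>\<nu>')"
  shows "\<nu> = \<nu>'"
proof (rule measure_eq_tms_on_cyls[where A = A])
  note D = radon_measureD[OF assms(1)] and D' = radon_measureD[OF assms(2)]
  show "{} \<in> nonempty_cyls A" by (rule empty_in_nonempty_cyls[OF infinite_states lc])
  show "sets \<nu> = tms_sets A" "sets \<nu>' = tms_sets A" by (simp_all add: D D')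
  show "emeasure \<nu> (cyl A [a]) < \<infinity>" for a by (rule D(3)[OF lc])
  fix v assume "v \<in> admissible_words A"
  then have v: "v \<noteq> []" by (simp add: admissible_words_def)
  have "(\<integral>x. indicator (cyl A v) x \<partial>\<nu>) = (\<integral>x. indicator (cyl A v) x \<partial>\<nu>' :: real)"
    by (rule eq[OF Cc_indicator_cyl[OF lc v]])
  then have "measure \<nu> (cyl A v) = measure \<nu>' (cyl A v)"
    using cyl_subset[of A v] by (simp add: D D' Int_absorb2)
  moreover have "emeasure \<nu> (cyl A v) \<noteq> \<infinity>" "emeasure \<nu>' (cyl A v) \<noteq> \<infinity>"
    using D(4)[OF compactin_cyl[OF lc v]] D'(4)[OF compactin_cyl[OF lc v]] by auto
  ultimately show "emeasure \<nu> (cyl A v) = emeasure \<nu>' (cyl A v)"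
    by (simp add: emeasure_eq_ennreal_measure)
qed

text \<open>Convergent kernels and vanishing indicators make the sequence Cauchy; its limit in the
  completion inherits the kernel limits as its Martin measure.\<close>

lemma boundary_point_of_escaping_sequence:
  assumes x: "\<And>k. x k \<in> tms A"
    and esc: "\<And>N. \<forall>\<^sub>F k in sequentially. x k \<notin> window A N"
    and conv: "\<And>v. v \<in> admissible_words A \<Longrightarrow> (\<lambda>k. Kc v (x k)) \<longlonglongrightarrow> measure \<nu> (cyl A v)"
    and \<nu>: "radon_measure A \<nu>"
  shows "\<exists>\<omega>\<in>martin_boundary A Xh \<iota>. martin_measure A \<phi> lam org Xh \<iota> \<omega> = \<nu>"
proof -
  interpret X: Metric_space "mspace Xh" "mdist Xh" by (rule Metric_space_mspace_mdist)
  have \<iota>: "\<iota> ` tms A \<subseteq> mspace Xh" and complete: "mcomplete_of Xh"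
    and isom: "\<And>x y. x \<in> tms A \<Longrightarrow> y \<in> tms A \<Longrightarrow> mdist Xh (\<iota> x) (\<iota> y) = martin_dist A \<phi> lam org w C x y"
    using completion unfolding is_completion_def by auto
  have "X.MCauchy (\<lambda>k. \<iota> (x k))"
    unfolding X.MCauchy_def
  proof (intro conjI allI impI)
    show "range (\<lambda>k. \<iota> (x k)) \<subseteq> mspace Xh" using \<iota> x by blast
    fix \<epsilon> :: real assume "\<epsilon> > 0"
    from martin_dist_Cauchy[OF x esc conv[OF word_admissible(1)] this]
    show "\<exists>N. \<forall>n n'. N \<le> n \<longrightarrow> N \<le> n' \<longrightarrow> mdist Xh (\<iota> (x n)) (\<iota> (x n')) < \<epsilon>"
      using isom[OF x x] by simp
  qed
  then obtain \<omega> where \<omega>: "limitin X.mtopology (\<lambda>k. \<iota> (x k)) \<omega> sequentially"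
    using complete unfolding mcomplete_of_def X.mcomplete_def by blast
  have \<omega>X: "\<omega> \<in> mspace Xh" using limitin_topspace[OF \<omega>] by simp
  \<comment> \<open>The indicator part of the metric does this: an escaping sequence leaves the
    cylinder \<open>[y 0]\<close>, which keeps it at a fixed positive distance from
    \<open>y\<close>.\<close>
  have "\<omega> \<notin> \<iota> ` tms A"
  proof
    assume "\<omega> \<in> \<iota> ` tms A"
    then obtain y where y: "y \<in> tms A" "\<omega> = \<iota> y" by blast
    obtain i where i: "i \<ge> 1" "[y 0] = w i" using admissible_word[OF single_admissible] by blast
    have pos: "0 < 1 / (2 ^ i * (C i + 1))" using bound_pos[OF i(1)] by simp
    have "\<forall>\<^sub>F k in sequentially. \<iota> (x k) \<in> mspace Xh \<and> mdist Xh (\<iota> (x k)) \<omega> < 1 / (2 ^ i * (C i + 1))"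
      using \<omega> pos unfolding X.limitin_metric by blast
    then have "\<forall>\<^sub>F k in sequentially. False"
      using esc[of "Suc (to_nat (y 0))"]
    proof eventually_elim
      case (elim k)
      have "x k 0 \<noteq> y 0" using elim(2) x[of k] by (auto simp: window_def)
      then have "\<bar>indicator (cyl A (w i)) (x k) - indicator (cyl A (w i)) y\<bar> = (1::real)"
        using y(1) x[of k] by (simp add: i(2)[symmetric] cyl_single)
      then have "1 / (2 ^ i * (C i + 1)) \<le> dist_term i (x k) y"
        unfolding dist_term_def using bound_pos[OF i(1)] by (intro divide_right_mono) auto
      also have "\<dots> \<le> mdist Xh (\<iota> (x k)) \<omega>"
        using dist_term_le_martin_dist[OF x y(1) i(1)] isom[OF x y(1)] y(2) by simp
      finally show ?case using elim(1) by simp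
    qed
    then show False by simp
  qed
  then have boundary: "\<omega> \<in> martin_boundary A Xh \<iota>"
    using \<omega>X by (simp add: martin_boundary_def)
  have ext: "ext_kernel A \<phi> lam org Xh \<iota> f \<omega> = (\<integral>x. f x \<partial>\<nu>)" if f: "f \<in> Cc A" for f
  proof -
    \<comment> \<open>Every continuous extension is determined at \<open>\<omega>\<close> by the
      sequence, which settles the uniqueness demanded by the definite description.\<close>
    have lim: "g \<omega> = (\<integral>x. f x \<partial>\<nu>)"
      if g: "continuous_map (mtopology_of Xh) euclideanreal g" "\<forall>x\<in>tms A. g (\<iota> x) = K f x" for g
    proof -
      have "limitin (mtopology_of Xh) (\<lambda>k. \<iota> (x k)) \<omega> sequentially"
        using \<omega> by (simp add: mtopology_of_def)
      from continuous_map_limit[OF g(1) this]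
      have "(\<lambda>k. g (\<iota> (x k))) \<longlonglongrightarrow> g \<omega>" by (simp add: o_def)
      then have "(\<lambda>k. K f (x k)) \<longlonglongrightarrow> g \<omega>" using g(2) x by simp
      then show ?thesis
        using kernel_tendsto_integral[OF x conv \<nu> f] by (rule LIMSEQ_unique)
    qed
    obtain g where g: "continuous_map (mtopology_of Xh) euclideanreal g" "\<And>x. x \<in> tms A \<Longrightarrow> g (\<iota> x) = K f x"
      using kernel_extension[OF f] by blast
    show ?thesis
      unfolding ext_kernel_def
    proof (rule the_equality)
      show "\<exists>g. continuous_map (mtopology_of Xh) euclideanreal g \<and> (\<forall>x\<in>tms A. g (\<iota> x) = K f x) \<and> g \<omega> = (\<integral>x. f x \<partial>\<nu>)"
        using g lim[of g] by blast
    qed (use lim in blast)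
  qed
  have "martin_measure A \<phi> lam org Xh \<iota> \<omega> = \<nu>"
    unfolding martin_measure_def
  proof (rule the_equality)
    show "radon_measure A \<nu> \<and> (\<forall>f\<in>Cc A. (\<integral>x. f x \<partial>\<nu>) = ext_kernel A \<phi> lam org Xh \<iota> f \<omega>)"
      using \<nu> ext by simp
    show "\<nu>' = \<nu>" if "radon_measure A \<nu>' \<and> (\<forall>f\<in>Cc A. (\<integral>x. f x \<partial>\<nu>') = ext_kernel A \<phi> lam org Xh \<iota> f \<omega>)" for \<nu>'
      using that ext by (intro radon_measure_unique \<nu>) auto
  qed
  with boundary show ?thesis by blast
qed

section \<open>Existence of boundary measures\<close>

lemma kernel_convergent_subsequence:
  assumes x: "\<And>k. x k \<in> tms A"
  obtains r :: "nat \<Rightarrow> nat" where "strict_mono r" "\<And>v. v \<in> admissible_words A \<Longrightarrow> convergent (\<lambda>k. Kc v (x (r k)))"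
proof -
  \<comment> \<open>Words are numbered from 1 and the diagonal construction from 0, hence
    \<open>Suc n\<close>.\<close>
  define P where "P n r \<longleftrightarrow> convergent (\<lambda>k. Kc (w (Suc n)) (x (r k)))" for n and r :: "nat \<Rightarrow> nat"
  interpret subseqs P
  proof
    fix n and s :: "nat \<Rightarrow> nat"
    have "\<bar>Kc (w (Suc n)) (x (s k))\<bar> \<le> C (Suc n)" for k
      using kernel_le_bound[of "Suc n", OF _ x] kernel_word_nonneg[of "Suc n", OF _ x] by simp
    then have "bounded (range (\<lambda>k. Kc (w (Suc n)) (x (s k))))"
      unfolding bounded_iff by auto
    from bounded_imp_convergent_subsequence[OF this]
    show "\<exists>r'. strict_mono r' \<and> P n (s \<circ> r')"
      by (auto simp: P_def o_def convergent_def)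
  qed
  have P: "P n (diagseq \<circ> (+) (Suc n))" for n
  proof (rule diagseq_holds)
    fix r s :: "nat \<Rightarrow> nat" and n assume "strict_mono r" "P n s"
    then show "P n (s \<circ> r)"
      using convergent_subseq_convergent[of "\<lambda>k. Kc (w (Suc n)) (x (s k))" r] by (simp add: P_def o_def)
  qed
  show thesis
  proof (rule that[OF subseq_diagseq])
    fix v assume "v \<in> admissible_words A"
    then obtain i where "i \<ge> 1" "v = w i" using admissible_word by blast
    then obtain n where n: "v = w (Suc n)" by (cases i) auto
    \<comment> \<open>The diagonal sequence is a subsequence of the \<open>n\<close>-th one only
      from index \<open>Suc n\<close> on; dropping an initial segment does not affect the
      limit.\<close>
    obtain l where "(\<lambda>k. Kc v (x (diagseq (k + Suc n)))) \<longlonglongrightarrow> l"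
      using P[of n] by (auto simp: P_def o_def n add.commute convergent_def)
    then have "(\<lambda>k. Kc v (x (diagseq k))) \<longlonglongrightarrow> l" by (rule LIMSEQ_offset)
    then show "convergent (\<lambda>k. Kc v (x (diagseq k)))" by (auto simp: convergent_def)
  qed
qed

text \<open>The limits are finitely additive because the kernel is linear. On cylinders this is
  already countable additivity: they are compact and open, so a disjoint countable decomposition of
  one has only finitely many nonempty parts.\<close>

lemma kernel_limit_measure:
  assumes x: "\<And>k. x k \<in> tms A"
    and conv: "\<And>v. v \<in> admissible_words A \<Longrightarrow> convergent (\<lambda>k. Kc v (x k))"
  obtains \<nu> where "radon_measure A \<nu>"
    "\<And>v. v \<in> admissible_words A \<Longrightarrow> (\<lambda>k. Kc v (x k)) \<longlonglongrightarrow> measure \<nu> (cyl A v)"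
proof -
  have empty: "{} \<in> nonempty_cyls A" by (rule empty_in_nonempty_cyls[OF infinite_states lc])
  interpret semiring_of_sets "tms A" "nonempty_cyls A" by (rule semiring_nonempty_cyls[OF lc empty])
  have K0: "K (indicator {}) y = 0" if "y \<in> tms A" for y
  proof -
    have "K (\<lambda>x. \<Sum>i\<in>({} :: nat set). 0 * (indicator {} :: _ \<Rightarrow> real) x) y = 0"
      using that by (subst kernel_sum) auto
    then show ?thesis using kernel_cong[OF that, of "indicator {}" "\<lambda>_. 0"] by simp
  qed
  have bdd: "bdd_fin_supp A (indicator S)" if "S \<in> nonempty_cyls A" for S
    using that bdd_fin_supp_cyl by (auto simp: nonempty_cyls_def)
  have conv': "convergent (\<lambda>k. K (indicator S) (x k))" if "S \<in> nonempty_cyls A" for S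
  proof (cases "S = {}")
    case True
    then show ?thesis using K0 x by (simp add: convergent_const)
  next
    case False
    then show ?thesis using that conv by (auto simp: nonempty_cyls_def admissible_words_def)
  qed
  define m where "m S = lim (\<lambda>k. K (indicator S) (x k))" for S
  have m: "(\<lambda>k. K (indicator S) (x k)) \<longlonglongrightarrow> m S" if "S \<in> nonempty_cyls A" for S
    unfolding m_def using conv'[OF that] by (simp add: convergent_LIMSEQ_iff)
  have m_nonneg: "0 \<le> m S" if S: "S \<in> nonempty_cyls A" for S
  proof (rule LIMSEQ_le_const[OF m[OF S]])
    obtain v where "v \<noteq> []" "S = cyl A v" using S by (auto simp: nonempty_cyls_def)
    then show "\<exists>N. \<forall>k\<ge>N. 0 \<le> K (indicator S) (x k)" using kernel_cyl_nonneg x by auto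
  qed
  have m_empty: "m {} = 0"
    using m[OF empty] K0 x by (simp add: LIMSEQ_const_iff)
  define \<nu> where "\<nu> = extend_measure (tms A) (nonempty_cyls A) (\<lambda>S. S) (\<lambda>S. ennreal (m S))"
  have \<nu>: "emeasure \<nu> S = ennreal (m S)" if S: "S \<in> nonempty_cyls A" for S
  proof (rule extend_measure_caratheodory[OF \<nu>_def S])
    show "semiring_of_sets (tms A) ((\<lambda>S. S) ` nonempty_cyls A)" using semiring_of_sets_axioms by simp
    fix B :: "nat \<Rightarrow> _" and D
    assume B: "B \<in> UNIV \<rightarrow> nonempty_cyls A" and D: "D \<in> nonempty_cyls A"
      and disj: "disjoint_family ((\<lambda>S. S) \<circ> B)" and un: "(\<Union>i. B i) = D"
    have Bc: "B i \<in> nonempty_cyls A" for i using B by blast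
    obtain v where v: "v \<noteq> []" "D = cyl A v" using D by (auto simp: nonempty_cyls_def)
    have "\<exists>\<F>. finite \<F> \<and> \<F> \<subseteq> range B \<and> D \<subseteq> \<Union>\<F>"
    proof (rule compactinD)
      show "compactin (tms_top A) D" unfolding v(2) by (rule compactin_cyl[OF lc v(1)])
      show "openin (tms_top A) U" if "U \<in> range B" for U
      proof -
        obtain i where "U = B i" using \<open>U \<in> range B\<close> by blast
        then show ?thesis using Bc[of i] openin_cyl by (auto simp: nonempty_cyls_def)
      qed
      show "D \<subseteq> \<Union>(range B)" using un by simp
    qed
    then obtain \<F> where \<F>: "finite \<F>" "\<F> \<subseteq> range B" "D \<subseteq> \<Union>\<F>" by (elim exE conjE)
    from finite_subset_image[OF \<F>(1,2)] obtain J where J: "finite J" "\<F> = B ` J" by blast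
    have Bdisj: "B i \<inter> B j = {}" if "i \<noteq> j" for i j
      using disj that by (simp add: disjoint_family_on_def)
    \<comment> \<open>The finite subcover \<open>J\<close> exhausts \<open>D\<close>, so by
      disjointness nothing is left for the other indices.\<close>
    have B0: "B i = {}" if "i \<notin> J" for i
    proof (rule ccontr)
      assume "B i \<noteq> {}"
      then obtain z where z: "z \<in> B i" by blast
      then have "z \<in> D" using un by blast
      then obtain j where "j \<in> J" "z \<in> B j" using \<F>(3) J(2) by blast
      then show False using Bdisj[of i j] z that by blast
    qed
    have ind: "indicator D y = (\<Sum>i\<in>J. 1 * indicator (B i) y :: real)" for y
    proof (cases "y \<in> D")
      case True
      then obtain j where j: "j \<in> J" "y \<in> B j" using \<F>(3) J(2) by blast
      have "(\<Sum>i\<in>J. indicator (B i) y :: real) = (\<Sum>i\<in>J. if i = j then 1 else 0)"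
        using j Bdisj by (intro sum.cong) (auto simp: indicator_def)
      then show ?thesis using True j J(1) by simp
    next
      case False
      then have "y \<notin> B i" for i using un by blast
      then show ?thesis using False by simp
    qed
    have "K (indicator D) (x k) = (\<Sum>i\<in>J. 1 * K (indicator (B i)) (x k))" for k
    proof -
      have "K (indicator D) (x k) = K (\<lambda>y. \<Sum>i\<in>J. 1 * indicator (B i) y) (x k)"
        by (rule kernel_cong[OF x ind])
      also have "\<dots> = (\<Sum>i\<in>J. 1 * K (indicator (B i)) (x k))"
        by (rule kernel_sum[OF bdd[OF Bc] x J(1)])
      finally show ?thesis .
    qed
    then have "(\<lambda>k. K (indicator D) (x k)) \<longlonglongrightarrow> (\<Sum>i\<in>J. m (B i))"
      using tendsto_sum[of J "\<lambda>i k. K (indicator (B i)) (x k)" "\<lambda>i. m (B i)"] m[OF Bc] by simp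
    then have "m D = (\<Sum>i\<in>J. m (B i))" using m[OF D] by (rule LIMSEQ_unique[rotated])
    then have "ennreal (m D) = (\<Sum>i\<in>J. ennreal (m (B i)))"
      using m_nonneg[OF Bc] by (simp add: sum_ennreal)
    also have "\<dots> = (\<Sum>i. ennreal (m (B i)))"
      using J(1) B0 m_empty by (intro suminf_finite[symmetric]) auto
    finally show "(\<Sum>n. ennreal (m (B n))) = ennreal (m D)" by simp
  qed (auto simp: m_empty)
  have "radon_measure A \<nu>"
  proof (rule radon_measureI[OF lc])
    show "sets \<nu> = tms_sets A"
      unfolding \<nu>_def tms_sets_eq_cyls using nonempty_cyls_subset[of A] by (subst sets_extend_measure) auto
    show "emeasure \<nu> (cyl A [a]) < \<infinity>" for a
      by (subst \<nu>) (auto simp: nonempty_cyls_def)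
  qed
  moreover have "(\<lambda>k. Kc v (x k)) \<longlonglongrightarrow> measure \<nu> (cyl A v)" if "v \<in> admissible_words A" for v
  proof -
    have c: "cyl A v \<in> nonempty_cyls A" using that by (auto simp: nonempty_cyls_def admissible_words_def)
    then have "measure \<nu> (cyl A v) = m (cyl A v)" using \<nu>[OF c] m_nonneg[OF c] by (simp add: measure_def)
    then show ?thesis using m[OF c] by simp
  qed
  ultimately show thesis by (rule that)
qed

text \<open>Infinitely many states provide points outside every window; the kernels converge along a
  subsequence, and the limit measure belongs to a boundary point.\<close>

lemma boundary_measure_exists:
  "\<exists>\<omega>\<in>martin_boundary A Xh \<iota>. radon_measure A (martin_measure A \<phi> lam org Xh \<iota> \<omega>)"
proof -
  have "\<exists>y\<in>tms A. y \<notin> window A k" for k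
  proof -
    obtain a :: 's where "\<not> to_nat a < k"
      using infinite_states finite_to_nat_less[of k] by (metis (mono_tags, lifting) UNIV_eq_I mem_Collect_eq)
    moreover obtain y where "y \<in> tms A" "y 0 = a" using cyl_single_nonempty by blast
    ultimately show ?thesis by (intro bexI[of _ y]) (auto simp: window_def)
  qed
  then obtain y where y: "\<And>k. y k \<in> tms A" "\<And>k. y k \<notin> window A k" by metis
  obtain r :: "nat \<Rightarrow> nat" where r: "strict_mono r"
    and c: "\<And>v. v \<in> admissible_words A \<Longrightarrow> convergent (\<lambda>k. Kc v (y (r k)))"
    using kernel_convergent_subsequence[of y, OF y(1)] by blast
  obtain \<nu> where \<nu>: "radon_measure A \<nu>"
    "\<And>v. v \<in> admissible_words A \<Longrightarrow> (\<lambda>k. Kc v (y (r k))) \<longlonglongrightarrow> measure \<nu> (cyl A v)"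
    using kernel_limit_measure[of "\<lambda>k. y (r k)", OF y(1) c] by blast
  have "\<forall>\<^sub>F k in sequentially. y (r k) \<notin> window A N" for N
    unfolding eventually_sequentially
  proof (intro exI allI impI)
    fix k assume "N \<le> k"
    then have "N \<le> r k" using seq_suble[OF r, of k] by linarith
    then show "y (r k) \<notin> window A N" using y(2)[of "r k"] window_mono[of N "r k" A] by blast
  qed
  from boundary_point_of_escaping_sequence[of "\<lambda>k. y (r k)", OF y(1) this \<nu>(2,1)]
  show ?thesis using \<nu>(1) by metis
qed

end

theorem corollary3p9:
  fixes A :: "'s::countable \<Rightarrow> 's \<Rightarrow> bool"
    and \<phi> :: "(nat \<Rightarrow> 's) \<Rightarrow> real"
    and lam :: real
    and org :: 's
    and w :: "nat \<Rightarrow> 's list"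
    and C :: "nat \<Rightarrow> real"
    and Xh :: "'b metric"
    and \<iota> :: "(nat \<Rightarrow> 's) \<Rightarrow> 'b"
    and \<mu> :: "(nat \<Rightarrow> 's) measure"
  assumes "infinite (UNIV :: 's set)"
    and "transitive_tms A"
    and "locally_compact_tms A"
    and "lam > 0"
    and "summable_variations A \<phi>"
    and "transient_potential A \<phi> lam"
    and "word_enumeration A w"
    and "kernel_bounds A \<phi> lam org w C"
    and "is_completion (tms A) (martin_dist A \<phi> lam org w C) Xh \<iota>"
    and "\<mu> \<in> Conf A \<phi> lam"
    and "extremal A \<phi> lam \<mu>"
  shows "\<exists>\<omega>\<in>martin_boundary A Xh \<iota>.
           proportional \<mu> (martin_measure A \<phi> lam org Xh \<iota> \<omega>)"
proof -
  interpret martin_compactification A \<phi> lam org w C Xh \<iota>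
    by unfold_locales (fact assms)+
  interpret extremal_conformal_measure A \<phi> lam \<mu>
    by unfold_locales (fact assms)+
  show ?thesis
  proof (cases "emeasure \<mu> (tms A) = 0")
    case True
    obtain \<omega> where \<omega>: "\<omega> \<in> martin_boundary A Xh \<iota>"
      and rad: "radon_measure A (martin_measure A \<phi> lam org Xh \<iota> \<omega>)"
      using boundary_measure_exists by blast
    \<comment> \<open>Even a factor 0 keeps the sigma-algebra of the scaled measure, so
      \<open>martin_measure\<close> has to denote a genuine Radon measure here.\<close>
    have "\<mu> = scale_measure (ennreal 0) (martin_measure A \<phi> lam org Xh \<iota> \<omega>)"
    proof (rule measure_eqI)
      fix S assume "S \<in> sets \<mu>"
      then have "emeasure \<mu> S \<le> emeasure \<mu> (tms A)"
        using emeasure_space[of \<mu> S] by (simp add: space_mu)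
      then show "emeasure \<mu> S = emeasure (scale_measure (ennreal 0) (martin_measure A \<phi> lam org Xh \<iota> \<omega>)) S"
        using True by simp
    qed (simp add: sets_mu radon_measureD(1)[OF rad])
    then show ?thesis using \<omega> unfolding proportional_def by (metis order_refl)
  next
    case nz: False
    define c where "c = measure \<mu> (cyl A [org])"
    have em_org: "emeasure \<mu> (cyl A [org]) = ennreal c"
      unfolding c_def using emeasure_single_finite[of org] by (intro emeasure_eq_ennreal_measure) simp
    have c: "0 < c" using emeasure_single_pos[OF nz, of org] em_org by simp
    \<comment> \<open>Normalised to give the origin cylinder mass 1, as every Martin kernel
      does.\<close>
    define \<nu> where "\<nu> = scale_measure (ennreal (1 / c)) \<mu>"
    have rad: "radon_measure A \<nu>"
      using emeasure_single_finite
      by (intro radon_measureI[OF lc]) (simp_all add: \<nu>_def sets_mu ennreal_mult_less_top)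
    have \<nu>: "measure \<nu> S = measure \<mu> S / c" for S
      unfolding \<nu>_def measure_def using c by (simp add: enn2real_mult)
    \<comment> \<open>Stage \<open>k\<close> treats the first \<open>k\<close> words with accuracy
      \<open>1 / Suc k\<close> outside the \<open>k\<close>-th window; a single sequence then
      escapes and converges on every word.\<close>
    have "\<exists>y\<in>tms A - window A k. \<forall>v\<in>w ` {1..k}. \<bar>Kc v y - measure \<mu> (cyl A v) / c\<bar> < 1 / Suc k" for k
      unfolding c_def using word_admissible(2)
      by (intro exists_kernel_approximation[OF nz]) force+
    then obtain y where y: "\<And>k. y k \<in> tms A" "\<And>k. y k \<notin> window A k"
      and near: "\<And>k v. v \<in> w ` {1..k} \<Longrightarrow> \<bar>Kc v (y k) - measure \<mu> (cyl A v) / c\<bar> < 1 / Suc k"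
      by (metis DiffE)
    have conv: "(\<lambda>k. Kc v (y k)) \<longlonglongrightarrow> measure \<nu> (cyl A v)" if v: "v \<in> admissible_words A" for v
    proof -
      obtain i where i: "i \<ge> 1" "v = w i" using admissible_word[OF v] by blast
      have "(\<lambda>k. Kc v (y k) - measure \<nu> (cyl A v)) \<longlonglongrightarrow> 0"
      proof (rule tendsto_rabs_zero_cancel, rule tendsto_sandwich[OF _ _ tendsto_const LIMSEQ_inverse_real_of_nat])
        show "\<forall>\<^sub>F k in sequentially. \<bar>Kc v (y k) - measure \<nu> (cyl A v)\<bar> \<le> inverse (real (Suc k))"
          unfolding eventually_sequentially
        proof (intro exI allI impI)
          fix k assume "i \<le> k"
          then have "v \<in> w ` {1..k}" using i by auto
          from near[OF this] show "\<bar>Kc v (y k) - measure \<nu> (cyl A v)\<bar> \<le> inverse (real (Suc k))"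
            by (simp add: \<nu> inverse_eq_divide)
        qed
      qed simp
      then show ?thesis by (simp add: LIM_zero_iff)
    qed
    have esc: "\<forall>\<^sub>F k in sequentially. y k \<notin> window A N" for N
      unfolding eventually_sequentially using y(2) window_mono[of N _ A] by blast
    obtain \<omega> where \<omega>: "\<omega> \<in> martin_boundary A Xh \<iota>" "martin_measure A \<phi> lam org Xh \<iota> \<omega> = \<nu>"
      using boundary_point_of_escaping_sequence[OF y(1) esc conv rad] by blast
    have "ennreal c * ennreal (1 / c) = 1" using c by (simp flip: ennreal_mult)
    then have "\<mu> = scale_measure (ennreal c) \<nu>"
      by (simp add: \<nu>_def scale_scale_measure scale_measure_1)
    then have "proportional \<mu> (martin_measure A \<phi> lam org Xh \<iota> \<omega>)"
      unfolding proportional_def \<omega>(2) using c by (intro exI[of _ c]) simp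
    then show ?thesis using \<omega>(1) by blast
  qed
qed

end
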